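(* Let $\lambda=(\lambda_1,\ldots,\lambda_\ell)$ be a partition. For each partition $\nu$ of $2|\lambda|$ set - $(K^{\nu}_{\lambda^2})^{+}=\#\{Q \text{ semistandard tableau of shape }\nu\text{ and content }\lambda^2 : \mathrm{sign}(Q)=1\}$, - $(K^{\nu}_{\lambda^2})^{-}=\#\{Q \text{ semistandard tableau of shape }\nu\text{ and content }\lambda^2 : \mathrm{sign}(Q)=-1\}$, - $(K^{\nu'}_{\lambda^2})^{+}=\#\{\widetilde Q' \text{ semistandard tableau of shape }\nu'\text{ and content }\lambda^2 : \mathrm{sign}_c(\widetilde Q)=1\}$, - $(K^{\nu'}_{\lambda^2})^{-}=\#\{\widetilde Q' \text{ semistandard tableau of shape }\nu'\text{ and content }\lambda^2 : \mathrm{sign}_c(\widetilde Q)=-1\}$, where the last two numbers (defined with $\mathrm{sign}_c$) are those used in the formulas for $e_\lambda$ below and the first two (defined with $\mathrm{sign}$) those used in the formulas for $h_\lambda$. Then $$s_2[h_\lambda]=\sum_{\nu}(K^{\nu}_{\lambda^2})^{+}s_\nu,\qquad s_{11}[h_\lambda]=\sum_{\nu}(K^{\nu}_{\lambda^2})^{-}s_\nu,$$ $$s_2[e_\lambda]=\sum_{\nu}(K^{\nu'}_{\lambda^2})^{+}s_\nu,\qquad s_{11}[e_\lambda]=\sum_{\nu}(K^{\nu'}_{\lambda^2})^{-}s_\nu,$$ the sums being over partitions $\nu$ of $2|\lambda|$.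
   Context: Partitions are identified with their diagrams in English notation (left- and top-justified, $\lambda_i$ boxes in row $i$ from the top). $|\lambda|=\sum_i\lambda_i$, $\lambda'$ is the conjugate partition, and $\lambda^2=(\lambda_1,\lambda_1,\lambda_2,\lambda_2,\ldots,\lambda_\ell,\lambda_\ell)$. A semistandard tableau of straight or skew shape is a filling with positive integers, weakly increasing along rows from left to right and strictly increasing down columns. Its content is $(\alpha_1,\alpha_2,\ldots)$ where $\alpha_k$ is the number of entries equal to $k$. The conjugate $t'$ of a filling $t$ is its reflection in the main diagonal. A conjugate tableau is a filling $\widetilde Q$ whose conjugate $\widetilde Q'$ is a semistandard tableau. $\mathrm{Rect}(T)$ denotes the rectification of a skew semistandard tableau $T$ by jeu de taquin, i.e. the straight-shape semistandard tableau obtained by applying jeu de taquin slides into inner corners until none remain (independent of choices). Sign: for a semistandard tableau $Q$ of content $\lambda^2$, let $Q^{(i)}$ ($1\le i\le\ell$) be the skew subtableau of entries $2i-1$ and $2i$; $\mathrm{Rect}(Q^{(i)})$ has shape $(2\lambda_i-j_i,j_i)$ for some $0\le j_i\le\lambda_i$, and $\mathrm{sign}(Q)=\prod_{i=1}^\ell(-1)^{j_i}$. Conjugate sign: for a conjugate tableau $\widetilde Q$ of content $\lambda^2$, let $\widetilde{Q^{(i)}}$ be the skew sub-filling of entries $2i-1$ and $2i$; $\bigl(\mathrm{Rect}((\widetilde{Q^{(i)}})')\bigr)'$ has shape $(2^{\lambda_i-j_i},1^{2j_i})$ for some $0\le j_i\le\lambda_i$, and $\mathrm{sign}_c(\widetilde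 Q)=\prod_{i=1}^\ell(-1)^{j_i}$. $\Lambda$ is the ring of symmetric functions over $\mathbb{Q}$; $s_\nu,h_\lambda,e_\lambda,p_\lambda$ are the Schur, complete homogeneous, elementary and power sum symmetric functions; $h_\lambda=\prod_i h_{\lambda_i}$, $e_\lambda=\prod_i e_{\lambda_i}$; $s_2=s_{(2)}$, $s_{11}=s_{(1,1)}$. Plethysm $f[g]$ is determined by: $p_k[p_m]=p_{km}$; for each $k$, $g\mapsto p_k[g]$ is a $\mathbb{Q}$-algebra endomorphism of $\Lambda$; for each $g$, $f\mapsto f[g]$ is a $\mathbb{Q}$-algebra endomorphism of $\Lambda$. *)

theory Defs
  imports Complex_Main "HOL-Library.More_List" "HOL-Library.Poly_Mapping" "HOL-Combinatorics.Permutations"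
begin

section \<open>Partitions, diagrams and tableaux\<close>

definition is_partition :: "nat list \<Rightarrow> bool" where
  "is_partition \<nu> \<longleftrightarrow> sorted_wrt (\<ge>) \<nu> \<and> 0 \<notin> set \<nu>"

text \<open>Boxes are pairs (row, column), both counted from 0.\<close>

definition diagram :: "nat list \<Rightarrow> (nat \<times> nat) set" where
  "diagram \<nu> = {(i, j). i < length \<nu> \<and> j < \<nu> ! i}"

definition conj_partition :: "nat list \<Rightarrow> nat list" where
  "conj_partition \<nu> = map (\<lambda>j. length (filter (\<lambda>r. j < r) \<nu>)) [0..<(if \<nu> = [] then 0 else hd \<nu>)]"

definition partition_square :: "nat list \<Rightarrow> nat list" where
  "partition_square \<nu> = concat (map (\<lambda>r. [r, r]) \<nu>)"

type_synonym filling = "nat \<times> nat \<Rightarrow> nat option"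

definition is_skew_shape :: "nat list \<Rightarrow> nat list \<Rightarrow> (nat \<times> nat) set \<Rightarrow> bool" where
  "is_skew_shape \<nu> \<mu> D \<longleftrightarrow> is_partition \<nu> \<and> is_partition \<mu> \<and>
     diagram \<mu> \<subseteq> diagram \<nu> \<and> D = diagram \<nu> - diagram \<mu>"

definition semistandard :: "filling \<Rightarrow> bool" where
  "semistandard T \<longleftrightarrow> (\<exists>\<nu> \<mu>. is_skew_shape \<nu> \<mu> (dom T)) \<and> 0 \<notin> ran T \<and>
     (\<forall>i j j' a b. j < j' \<and> T (i, j) = Some a \<and> T (i, j') = Some b \<longrightarrow> a \<le> b) \<and>
     (\<forall>i i' j a b. i < i' \<and> T (i, j) = Some a \<and> T (i', j) = Some b \<longrightarrow> a < b)"

text \<open>The content is indexed from 0: its value at \<open>k\<close> counts the entries equal to \<open>k + 1\<close>.\<close>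

definition content :: "filling \<Rightarrow> nat \<Rightarrow> nat" where
  "content T k = card {b. T b = Some (Suc k)}"

definition SSYT :: "nat list \<Rightarrow> (nat \<Rightarrow> nat) \<Rightarrow> filling set" where
  "SSYT \<nu> \<alpha> = {T. semistandard T \<and> dom T = diagram \<nu> \<and> content T = \<alpha>}"

definition conj_filling :: "filling \<Rightarrow> filling" where
  "conj_filling T = (\<lambda>(i, j). T (j, i))"


section \<open>Jeu de taquin\<close>

text \<open>\<open>jdt_slide c T U\<close>: sliding into the empty box \<open>c\<close> turns \<open>T\<close> into \<open>U\<close>.  The empty box
  is filled by the smaller of its right and lower neighbours, by the lower one in case of a tie.\<close>

inductive jdt_slide :: "nat \<times> nat \<Rightarrow> filling \<Rightarrow> filling \<Rightarrow> bool" where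
  stop: "T (i, Suc j) = None \<Longrightarrow> T (Suc i, j) = None \<Longrightarrow> jdt_slide (i, j) T T"
| right: "T (i, Suc j) = Some a \<Longrightarrow> (\<And>b. T (Suc i, j) = Some b \<Longrightarrow> a < b) \<Longrightarrow>
    jdt_slide (i, Suc j) (T((i, j) := Some a, (i, Suc j) := None)) U \<Longrightarrow> jdt_slide (i, j) T U"
| down: "T (Suc i, j) = Some b \<Longrightarrow> (\<And>a. T (i, Suc j) = Some a \<Longrightarrow> b \<le> a) \<Longrightarrow>
    jdt_slide (Suc i, j) (T((i, j) := Some b, (Suc i, j) := None)) U \<Longrightarrow> jdt_slide (i, j) T U"

definition inner_corner :: "(nat \<times> nat) set \<Rightarrow> nat \<times> nat \<Rightarrow> bool" where
  "inner_corner D c \<longleftrightarrow> c \<in> D \<and> (Suc (fst c), snd c) \<notin> D \<and> (fst c, Suc (snd c)) \<notin> D"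

text \<open>The first argument is the inner shape still to be filled.\<close>

inductive rectifies :: "(nat \<times> nat) set \<Rightarrow> filling \<Rightarrow> filling \<Rightarrow> bool" where
  straight: "rectifies {} T T"
| slide: "inner_corner D c \<Longrightarrow> jdt_slide c T T' \<Longrightarrow> rectifies (D - {c}) T' U \<Longrightarrow> rectifies D T U"

text \<open>The result depends neither on the order of the slides nor on the way the set of boxes is
  written as a difference of two diagrams, so an arbitrary choice is harmless.\<close>

definition rect :: "filling \<Rightarrow> filling" where
  "rect T = (SOME U. \<exists>\<nu> \<mu>. is_skew_shape \<nu> \<mu> (dom T) \<and> rectifies (diagram \<mu>) T U)"


section \<open>Signs\<close>

definition sub_filling :: "filling \<Rightarrow> nat \<Rightarrow> filling" where
  "sub_filling Q i = Q |` {b. Q b = Some (2 * i - 1) \<or> Q b = Some (2 * i)}"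

text \<open>\<open>diagram\<close> ignores zero parts, so \<open>[2 * m, 0]\<close> stands for the one-row partition.\<close>

definition sign_index :: "nat \<Rightarrow> filling \<Rightarrow> nat" where
  "sign_index m T = (THE j. j \<le> m \<and> dom (rect T) = diagram [2 * m - j, j])"

definition tableau_sign :: "nat list \<Rightarrow> filling \<Rightarrow> int" where
  "tableau_sign lam Q = (\<Prod>i = 1..length lam. (- 1) ^ sign_index (lam ! (i - 1)) (sub_filling Q i))"

definition conj_sign_index :: "nat \<Rightarrow> filling \<Rightarrow> nat" where
  "conj_sign_index m T = (THE j. j \<le> m \<and>
     dom (conj_filling (rect (conj_filling T))) = diagram (replicate (m - j) 2 @ replicate (2 * j) 1))"

definition conj_tableau_sign :: "nat list \<Rightarrow> filling \<Rightarrow> int" where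
  "conj_tableau_sign lam Q =
     (\<Prod>i = 1..length lam. (- 1) ^ conj_sign_index (lam ! (i - 1)) (sub_filling Q i))"

definition K_plus :: "nat list \<Rightarrow> nat list \<Rightarrow> nat" where
  "K_plus lam \<nu> =
     card {Q \<in> SSYT \<nu> (nth_default 0 (partition_square lam)). tableau_sign lam Q = 1}"

definition K_minus :: "nat list \<Rightarrow> nat list \<Rightarrow> nat" where
  "K_minus lam \<nu> =
     card {Q \<in> SSYT \<nu> (nth_default 0 (partition_square lam)). tableau_sign lam Q = - 1}"

definition K_conj_plus :: "nat list \<Rightarrow> nat list \<Rightarrow> nat" where
  "K_conj_plus lam \<nu> = card {conj_filling Q |Q.
     conj_filling Q \<in> SSYT (conj_partition \<nu>) (nth_default 0 (partition_square lam)) \<and>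
     conj_tableau_sign lam Q = 1}"

definition K_conj_minus :: "nat list \<Rightarrow> nat list \<Rightarrow> nat" where
  "K_conj_minus lam \<nu> = card {conj_filling Q |Q.
     conj_filling Q \<in> SSYT (conj_partition \<nu>) (nth_default 0 (partition_square lam)) \<and>
     conj_tableau_sign lam Q = - 1}"


section \<open>Symmetric functions\<close>

text \<open>Formal power series over the rationals in variables \<open>x\<^sub>0, x\<^sub>1, \<dots>\<close>.  The monomial
  \<open>x\<^sub>i x\<^sub>j \<dots>\<close> is encoded by the multiset \<open>{#i, j, \<dots>#}\<close> of its variables.\<close>

typedef mseries = "UNIV :: (nat multiset \<Rightarrow> rat) set"
  morphisms coeff Mseries ..

setup_lifting type_definition_mseries

definition splits :: "nat multiset \<Rightarrow> (nat multiset \<times> nat multiset) set" where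
  "splits \<alpha> = {(\<beta>, \<gamma>). \<beta> + \<gamma> = \<alpha>}"

lemma splits_alt: "splits \<alpha> = (\<lambda>\<beta>. (\<beta>, \<alpha> - \<beta>)) ` {\<beta>. \<beta> \<subseteq># \<alpha>}"
  unfolding splits_def by (auto simp: image_iff)

lemma finite_splits [simp]: "finite (splits \<alpha>)"
proof -
  have "finite {\<beta>. \<beta> \<subseteq># \<alpha>}"
  proof (induction \<alpha>)
    case empty
    then show ?case by simp
  next
    case (add x \<alpha>)
    have "{\<beta>. \<beta> \<subseteq># add_mset x \<alpha>} \<subseteq> {\<beta>. \<beta> \<subseteq># \<alpha>} \<union> add_mset x ` {\<beta>. \<beta> \<subseteq># \<alpha>}"
    proof
      fix \<beta> assume "\<beta> \<in> {\<beta>. \<beta> \<subseteq># add_mset x \<alpha>}"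
      then have s: "\<beta> \<subseteq># add_mset x \<alpha>" by simp
      show "\<beta> \<in> {\<beta>. \<beta> \<subseteq># \<alpha>} \<union> add_mset x ` {\<beta>. \<beta> \<subseteq># \<alpha>}"
      proof (cases "x \<in># \<beta>")
        case True
        then obtain \<gamma> where "\<beta> = add_mset x \<gamma>" by (metis multi_member_split)
        with s show ?thesis by auto
      next
        case False
        with s have "\<beta> \<subseteq># \<alpha>"
          by (metis add_mset_remove_trivial diff_single_trivial subset_eq_diff_conv
              add_mset_add_single)
        then show ?thesis by simp
      qed
    qed
    with add show ?case by (meson finite_Un finite_imageI finite_subset)
  qed
  then show ?thesis unfolding splits_alt by simp
qed

instantiation mseries :: comm_ring_1
begin

lift_definition zero_mseries :: mseries is "\<lambda>_. 0" .
lift_definition one_mseries :: mseries is "\<lambda>\<alpha>. if \<alpha> = {#} then 1 else 0" .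
lift_definition plus_mseries :: "mseries \<Rightarrow> mseries \<Rightarrow> mseries" is "\<lambda>f g \<alpha>. f \<alpha> + g \<alpha>" .
lift_definition minus_mseries :: "mseries \<Rightarrow> mseries \<Rightarrow> mseries" is "\<lambda>f g \<alpha>. f \<alpha> - g \<alpha>" .
lift_definition uminus_mseries :: "mseries \<Rightarrow> mseries" is "\<lambda>f \<alpha>. - f \<alpha>" .
lift_definition times_mseries :: "mseries \<Rightarrow> mseries \<Rightarrow> mseries" is
  "\<lambda>f g \<alpha>. \<Sum>(\<beta>, \<gamma>)\<in>splits \<alpha>. f \<beta> * g \<gamma>" .

instance
proof
  fix a b c :: mseries
  show "a * b * c = a * (b * c)"
  proof transfer
    fix a b c :: "nat multiset \<Rightarrow> rat"
    show "(\<lambda>\<alpha>. \<Sum>(\<beta>, \<gamma>)\<in>splits \<alpha>. (\<Sum>(\<beta>, \<gamma>)\<in>splits \<beta>. a \<beta> * b \<gamma>) * c \<gamma>) =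
          (\<lambda>\<alpha>. \<Sum>(\<beta>, \<gamma>)\<in>splits \<alpha>. a \<beta> * (\<Sum>(\<beta>, \<gamma>)\<in>splits \<gamma>. b \<beta> * c \<gamma>))"
    proof
      fix \<alpha>
      have "(\<Sum>(\<beta>, \<gamma>)\<in>splits \<alpha>. (\<Sum>(\<beta>, \<gamma>)\<in>splits \<beta>. a \<beta> * b \<gamma>) * c \<gamma>) =
            (\<Sum>(x, y)\<in>Sigma (splits \<alpha>) (\<lambda>x. splits (fst x)). a (fst y) * b (snd y) * c (snd x))"
        by (subst sum.Sigma [symmetric]) (auto simp: sum_distrib_right case_prod_beta)
      also have "\<dots> =
            (\<Sum>(x, y)\<in>Sigma (splits \<alpha>) (\<lambda>x. splits (snd x)). a (fst x) * (b (fst y) * c (snd y)))"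
        by (rule sum.reindex_bij_witness
             [of _ "\<lambda>(x, y). ((fst x + fst y, snd y), (fst x, fst y))"
                   "\<lambda>(x, y). ((fst y, snd y + snd x), (snd y, snd x))"])
           (auto simp: splits_def add.assoc mult.assoc)
      also have "\<dots> = (\<Sum>(\<beta>, \<gamma>)\<in>splits \<alpha>. a \<beta> * (\<Sum>(\<beta>, \<gamma>)\<in>splits \<gamma>. b \<beta> * c \<gamma>))"
        by (subst sum.Sigma [symmetric]) (auto simp: sum_distrib_left case_prod_beta)
      finally show "(\<Sum>(\<beta>, \<gamma>)\<in>splits \<alpha>. (\<Sum>(\<beta>, \<gamma>)\<in>splits \<beta>. a \<beta> * b \<gamma>) * c \<gamma>) =
          (\<Sum>(\<beta>, \<gamma>)\<in>splits \<alpha>. a \<beta> * (\<Sum>(\<beta>, \<gamma>)\<in>splits \<gamma>. b \<beta> * c \<gamma>))" .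
    qed
  qed
  show "a * b = b * a"
  proof (transfer, rule ext)
    fix a b :: "nat multiset \<Rightarrow> rat" and \<alpha>
    show "(\<Sum>(\<beta>, \<gamma>)\<in>splits \<alpha>. a \<beta> * b \<gamma>) = (\<Sum>(\<beta>, \<gamma>)\<in>splits \<alpha>. b \<beta> * a \<gamma>)"
      by (rule sum.reindex_bij_witness [of _ "\<lambda>(x, y). (y, x)" "\<lambda>(x, y). (y, x)"])
         (auto simp: splits_def add.commute mult.commute)
  qed
  show "1 * a = a"
  proof (transfer, rule ext)
    fix a :: "nat multiset \<Rightarrow> rat" and \<alpha>
    have "(\<Sum>(\<beta>, \<gamma>)\<in>splits \<alpha>. (if \<beta> = {#} then 1 else 0) * a \<gamma>) =
          (\<Sum>x\<in>{({#} :: nat multiset, \<alpha>)}. a (snd x))"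
      by (rule sum.mono_neutral_cong_right [OF finite_splits]) (auto simp: splits_def split: if_splits)
    then show "(\<Sum>(\<beta>, \<gamma>)\<in>splits \<alpha>. (if \<beta> = {#} then 1 else 0) * a \<gamma>) = a \<alpha>" by simp
  qed
  show "(a + b) * c = a * c + b * c"
    by (transfer, rule ext) (simp add: distrib_right sum.distrib case_prod_beta)
  show "(0::mseries) \<noteq> 1"
    by transfer (metis zero_neq_one)
qed (transfer; simp add: fun_eq_iff)+

end

text \<open>Symmetric series of bounded degree; \<open>image_mset \<pi> \<alpha>\<close> is the monomial \<open>\<alpha>\<close> with its
  variables permuted by \<open>\<pi>\<close>.\<close>

definition Sym :: "mseries set" where
  "Sym = {f. (\<forall>\<pi> \<alpha>. bij \<pi> \<longrightarrow> coeff f (image_mset \<pi> \<alpha>) = coeff f \<alpha>) \<and>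
             (\<exists>d. \<forall>\<alpha>. coeff f \<alpha> \<noteq> 0 \<longrightarrow> size \<alpha> \<le> d)}"

lift_definition scale :: "rat \<Rightarrow> mseries \<Rightarrow> mseries" is "\<lambda>c f \<alpha>. c * f \<alpha>" .

lift_definition schur :: "nat list \<Rightarrow> mseries" is
  "\<lambda>\<nu> \<alpha>. of_nat (card (SSYT \<nu> (count \<alpha>)))" .

lift_definition complete :: "nat \<Rightarrow> mseries" is
  "\<lambda>n \<alpha>. if size \<alpha> = n then 1 else 0" .

lift_definition elementary :: "nat \<Rightarrow> mseries" is
  "\<lambda>n \<alpha>. if size \<alpha> = n \<and> (\<forall>i. count \<alpha> i \<le> 1) then 1 else 0" .

text \<open>The power sum is meaningful for \<open>k \<ge> 1\<close> only.\<close>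

lift_definition power_sum :: "nat \<Rightarrow> mseries" is
  "\<lambda>k \<alpha>. if \<exists>i. \<alpha> = replicate_mset k i then 1 else 0" .

definition complete_part :: "nat list \<Rightarrow> mseries" where
  "complete_part lam = prod_list (map complete lam)"

definition elementary_part :: "nat list \<Rightarrow> mseries" where
  "elementary_part lam = prod_list (map elementary lam)"


section \<open>Plethysm\<close>

definition Sym_endo :: "(mseries \<Rightarrow> mseries) \<Rightarrow> bool" where
  "Sym_endo \<phi> \<longleftrightarrow> (\<forall>f\<in>Sym. \<phi> f \<in> Sym) \<and> \<phi> 1 = 1 \<and>
     (\<forall>f\<in>Sym. \<forall>g\<in>Sym. \<phi> (f + g) = \<phi> f + \<phi> g \<and> \<phi> (f * g) = \<phi> f * \<phi> g) \<and>
     (\<forall>c. \<forall>f\<in>Sym. \<phi> (scale c f) = scale c (\<phi> f))"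

definition is_plethysm :: "(mseries \<Rightarrow> mseries \<Rightarrow> mseries) \<Rightarrow> bool" where
  "is_plethysm F \<longleftrightarrow>
     (\<forall>k\<ge>1. \<forall>m\<ge>1. F (power_sum k) (power_sum m) = power_sum (k * m)) \<and>
     (\<forall>k\<ge>1. Sym_endo (F (power_sum k))) \<and>
     (\<forall>g\<in>Sym. Sym_endo (\<lambda>f. F f g))"

lemma coeff_zero [simp]: "coeff 0 \<alpha> = 0" by transfer simp
lemma coeff_one: "coeff 1 \<alpha> = (if \<alpha> = {#} then 1 else 0)" by transfer simp
lemma coeff_add [simp]: "coeff (f + g) \<alpha> = coeff f \<alpha> + coeff g \<alpha>" by transfer simp
lemma coeff_diff [simp]: "coeff (f - g) \<alpha> = coeff f \<alpha> - coeff g \<alpha>" by transfer simp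
lemma coeff_scale [simp]: "coeff (scale c f) \<alpha> = c * coeff f \<alpha>" by transfer simp
lemma coeff_mult: "coeff (f * g) \<alpha> = (\<Sum>(\<beta>, \<gamma>)\<in>splits \<alpha>. coeff f \<beta> * coeff g \<gamma>)"
  by transfer simp
lemma coeff_sum [simp]: "coeff (sum f A) \<alpha> = (\<Sum>x\<in>A. coeff (f x) \<alpha>)"
  by (induction A rule: infinite_finite_induct) auto

lemma mseries_eqI: "(\<And>\<alpha>. coeff f \<alpha> = coeff g \<alpha>) \<Longrightarrow> f = g"
  by (metis coeff_inject ext)

lemma scale_mult_left: "scale c f * g = scale c (f * g)"
  by (rule mseries_eqI) (simp add: coeff_mult sum_distrib_left case_prod_beta mult.assoc)

lemma scale_mult_right: "f * scale c g = scale c (f * g)"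
  by (metis mult.commute scale_mult_left)

lemma scale_add_left: "scale (a + b) f = scale a f + scale b f"
  by (rule mseries_eqI) (simp add: distrib_right)

lemma scale_add_right: "scale c (f + g) = scale c f + scale c g"
  by (rule mseries_eqI) (simp add: distrib_left)

lemma scale_scale: "scale a (scale b f) = scale (a * b) f"
  by (rule mseries_eqI) simp

lemma scale_one [simp]: "scale 1 f = f"
  by (rule mseries_eqI) simp

lemma scale_zero [simp]: "scale 0 f = 0" "scale c 0 = 0"
  by (rule mseries_eqI; simp)+

lemma scale_sum: "scale c (sum f A) = (\<Sum>x\<in>A. scale c (f x))"
  by (rule mseries_eqI) (simp add: sum_distrib_left)

lemma image_mset_inv:
  assumes "bij \<pi>"
  shows "image_mset \<pi> (image_mset (inv \<pi>) \<beta>) = \<beta>" "image_mset (inv \<pi>) (image_mset \<pi> \<beta>) = \<beta>"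
proof -
  have "\<pi> \<circ> inv \<pi> = id" "inv \<pi> \<circ> \<pi> = id"
    using assms by (auto simp: bij_def fun_eq_iff surj_f_inv_f)
  then show "image_mset \<pi> (image_mset (inv \<pi>) \<beta>) = \<beta>" "image_mset (inv \<pi>) (image_mset \<pi> \<beta>) = \<beta>"
    by (simp_all add: multiset.map_comp)
qed

lemma SymI:
  assumes "\<And>\<pi> \<alpha>. bij \<pi> \<Longrightarrow> coeff f (image_mset \<pi> \<alpha>) = coeff f \<alpha>"
    and "\<And>\<alpha>. coeff f \<alpha> \<noteq> 0 \<Longrightarrow> size \<alpha> \<le> d"
  shows "f \<in> Sym"
  using assms unfolding Sym_def by blast

lemma Sym_perm: "f \<in> Sym \<Longrightarrow> bij \<pi> \<Longrightarrow> coeff f (image_mset \<pi> \<alpha>) = coeff f \<alpha>"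
  unfolding Sym_def by blast

lemma Sym_bound: "f \<in> Sym \<Longrightarrow> \<exists>d. \<forall>\<alpha>. coeff f \<alpha> \<noteq> 0 \<longrightarrow> size \<alpha> \<le> d"
  unfolding Sym_def by blast

lemma Sym_zero: "0 \<in> Sym" by (rule SymI) auto

lemma Sym_one: "1 \<in> Sym" by (rule SymI [of _ 0]) (auto simp: coeff_one split: if_splits)

lemma Sym_scale: "f \<in> Sym \<Longrightarrow> scale c f \<in> Sym"
  unfolding Sym_def by simp blast

lemma Sym_add: assumes f: "f \<in> Sym" and g: "g \<in> Sym" shows "f + g \<in> Sym"
proof -
  obtain d e where "\<And>\<alpha>. coeff f \<alpha> \<noteq> 0 \<Longrightarrow> size \<alpha> \<le> d" "\<And>\<alpha>. coeff g \<alpha> \<noteq> 0 \<Longrightarrow> size \<alpha> \<le> e"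
    using Sym_bound [OF f] Sym_bound [OF g] by blast
  note de = this
  have "size \<alpha> \<le> max d e" if "coeff (f + g) \<alpha> \<noteq> 0" for \<alpha>
  proof -
    have "coeff f \<alpha> \<noteq> 0 \<or> coeff g \<alpha> \<noteq> 0" using that by auto
    then show ?thesis using de [of \<alpha>] by (auto simp: le_max_iff_disj)
  qed
  then show ?thesis
    by (intro SymI [of _ "max d e"]) (auto simp: Sym_perm [OF f] Sym_perm [OF g])
qed

lemma Sym_diff: "f \<in> Sym \<Longrightarrow> g \<in> Sym \<Longrightarrow> f - g \<in> Sym"
proof -
  assume "f \<in> Sym" "g \<in> Sym"
  then have "f + scale (- 1) g \<in> Sym" by (intro Sym_add Sym_scale)
  moreover have "f + scale (- 1) g = f - g" by (rule mseries_eqI) simp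
  ultimately show ?thesis by simp
qed

lemma Sym_mult: assumes f: "f \<in> Sym" and g: "g \<in> Sym" shows "f * g \<in> Sym"
proof -
  obtain d e where de: "\<And>\<alpha>. coeff f \<alpha> \<noteq> 0 \<Longrightarrow> size \<alpha> \<le> d" "\<And>\<alpha>. coeff g \<alpha> \<noteq> 0 \<Longrightarrow> size \<alpha> \<le> e"
    using Sym_bound [OF f] Sym_bound [OF g] by blast
  show ?thesis
  proof (rule SymI [of _ "d + e"])
    fix \<pi> :: "nat \<Rightarrow> nat" and \<alpha> assume b: "bij \<pi>"
    note inv = image_mset_inv [OF b]
    show "coeff (f * g) (image_mset \<pi> \<alpha>) = coeff (f * g) \<alpha>"
      unfolding coeff_mult
      by (rule sum.reindex_bij_witness [of _ "\<lambda>(x, y). (image_mset \<pi> x, image_mset \<pi> y)"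
            "\<lambda>(x, y). (image_mset (inv \<pi>) x, image_mset (inv \<pi>) y)"])
         (auto simp: splits_def inv Sym_perm [OF f bij_imp_bij_inv [OF b]]
            Sym_perm [OF g bij_imp_bij_inv [OF b]] simp flip: image_mset_union)
  next
    fix \<alpha> assume "coeff (f * g) \<alpha> \<noteq> 0"
    then obtain \<beta> \<gamma> where "\<beta> + \<gamma> = \<alpha>" "coeff f \<beta> * coeff g \<gamma> \<noteq> 0"
      unfolding coeff_mult by (auto simp: splits_def elim!: sum.not_neutral_contains_not_neutral)
    then show "size \<alpha> \<le> d + e" using de [of \<beta>] de [of \<gamma>] by fastforce
  qed
qed

lemma Sym_sum: "(\<And>x. x \<in> A \<Longrightarrow> f x \<in> Sym) \<Longrightarrow> sum f A \<in> Sym"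
  by (induction A rule: infinite_finite_induct) (auto intro: Sym_zero Sym_add)

lemma Sym_prod_mset: "(\<And>k. k \<in># \<mu> \<Longrightarrow> v k \<in> Sym) \<Longrightarrow> (\<Prod>k\<in>#\<mu>. v k) \<in> Sym"
  by (induction \<mu>) (auto intro: Sym_one Sym_mult)

lemma coeff_power_sum: "coeff (power_sum k) \<alpha> = (if \<exists>i. \<alpha> = replicate_mset k i then 1 else 0)"
  by transfer simp

lemma Sym_power_sum: "power_sum k \<in> Sym"
proof (rule SymI [of _ k])
  fix \<pi> :: "nat \<Rightarrow> nat" and \<alpha> assume b: "bij \<pi>"
  have "(\<exists>i. image_mset \<pi> \<alpha> = replicate_mset k i) \<longleftrightarrow> (\<exists>i. \<alpha> = replicate_mset k i)"
  proof
    assume "\<exists>i. image_mset \<pi> \<alpha> = replicate_mset k i"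
    then obtain i where "image_mset \<pi> \<alpha> = replicate_mset k i" by blast
    then have "image_mset (inv \<pi>) (image_mset \<pi> \<alpha>) = replicate_mset k (inv \<pi> i)" by simp
    then show "\<exists>i. \<alpha> = replicate_mset k i"
      by (auto simp: image_mset_inv [OF b])
  qed auto
  then show "coeff (power_sum k) (image_mset \<pi> \<alpha>) = coeff (power_sum k) \<alpha>"
    by (simp add: coeff_power_sum)
qed (auto simp: coeff_power_sum split: if_splits)

text \<open>Evaluation of a polynomial in variables indexed by \<open>nat\<close>, whose monomials are multisets.\<close>

definition ev :: "(nat \<Rightarrow> mseries) \<Rightarrow> (nat multiset \<Rightarrow>\<^sub>0 rat) \<Rightarrow> mseries" where
  "ev v P = (\<Sum>\<mu>\<in>Poly_Mapping.keys P. scale (Poly_Mapping.lookup P \<mu>) (\<Prod>k\<in>#\<mu>. v k))"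

lemma ev_superset:
  assumes "finite A" "Poly_Mapping.keys P \<subseteq> A"
  shows "ev v P = (\<Sum>\<mu>\<in>A. scale (Poly_Mapping.lookup P \<mu>) (\<Prod>k\<in>#\<mu>. v k))"
  unfolding ev_def by (rule sum.mono_neutral_left) (use assms in \<open>auto simp: in_keys_iff\<close>)

lemma ev_add: "ev v (P + Q) = ev v P + ev v Q"
proof -
  let ?A = "Poly_Mapping.keys P \<union> Poly_Mapping.keys Q"
  have "Poly_Mapping.keys (P + Q) \<subseteq> ?A" by (rule Poly_Mapping.keys_add)
  then show ?thesis
    by (subst (1 2 3) ev_superset [of ?A]) (auto simp: lookup_add scale_add_left sum.distrib)
qed

lemma ev_zero: "ev v 0 = 0" by (simp add: ev_def)

lemma ev_single: "ev v (Poly_Mapping.single \<mu> c) = scale c (\<Prod>k\<in>#\<mu>. v k)"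
  by (subst ev_superset [of "{\<mu>}"]) auto

lemma ev_sum: "ev v (sum f A) = (\<Sum>x\<in>A. ev v (f x))"
  by (induction A rule: infinite_finite_induct) (auto simp: ev_add ev_zero)

lemma poly_decomp:
  "P = (\<Sum>\<mu>\<in>Poly_Mapping.keys P. Poly_Mapping.single \<mu> (Poly_Mapping.lookup P \<mu>))"
  by (rule poly_mapping_eqI)
     (auto simp: lookup_sum lookup_single when_def in_keys_iff sum.delta)

lemma ev_mult: "ev v (P * Q) = ev v P * ev v Q"
proof -
  have 1: "ev v (Poly_Mapping.single \<mu> c * Poly_Mapping.single \<nu> d) =
       ev v (Poly_Mapping.single \<mu> c) * ev v (Poly_Mapping.single \<nu> d)" for \<mu> \<nu> c d
    by (simp add: mult_single ev_single scale_mult_left scale_mult_right scale_scale mult.commute)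
  have "ev v ((\<Sum>\<mu>\<in>A. Poly_Mapping.single \<mu> (a \<mu>)) * (\<Sum>\<mu>\<in>B. Poly_Mapping.single \<mu> (b \<mu>))) =
      ev v (\<Sum>\<mu>\<in>A. Poly_Mapping.single \<mu> (a \<mu>)) * ev v (\<Sum>\<mu>\<in>B. Poly_Mapping.single \<mu> (b \<mu>))"
    for A B a b by (simp add: sum_product ev_sum 1)
  then show ?thesis using poly_decomp [of P] poly_decomp [of Q] by metis
qed

lemma ev_one: "ev v 1 = 1"
  using ev_single [of v "{#}" 1] by (simp flip: single_one)

lemma ev_scale: "ev v (Poly_Mapping.single {#} c * P) = scale c (ev v P)"
  by (simp add: ev_mult ev_single scale_mult_left)

lemma Sym_ev: "(\<And>k. v k \<in> Sym) \<Longrightarrow> ev v P \<in> Sym"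
  unfolding ev_def by (intro Sym_sum Sym_scale Sym_prod_mset)

subsection \<open>Power sums are algebraically independent and generate\<close>

abbreviation "pw k \<equiv> power_sum (Suc k)"

definition pbasis :: "nat multiset \<Rightarrow> mseries" where
  "pbasis \<mu> = (\<Prod>k\<in>#\<mu>. pw k)"

lemma coeff_pw_mult:
  "coeff (pw k * f) \<alpha> =
     (\<Sum>i\<in>{i. Suc k \<le> count \<alpha> i}. coeff f (\<alpha> - replicate_mset (Suc k) i))"
proof -
  define r :: "nat \<Rightarrow> nat multiset" where "r = replicate_mset (Suc k)"
  let ?I = "{i. Suc k \<le> count \<alpha> i}"
  have sub: "r i \<subseteq># \<alpha> \<longleftrightarrow> i \<in> ?I" for i
    unfolding r_def mem_Collect_eq count_le_replicate_mset_subset_eq ..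
  have set_r: "set_mset (r i) = {i}" for i by (simp add: r_def)
  have c: "coeff (pw k) \<beta> = (if \<exists>i. \<beta> = r i then 1 else 0)" for \<beta>
    unfolding coeff_power_sum r_def ..
  have inj: "inj_on (\<lambda>i. (r i, \<alpha> - r i)) ?I"
  proof (rule inj_onI)
    fix i j assume "(r i, \<alpha> - r i) = (r j, \<alpha> - r j)"
    then have "set_mset (r i) = set_mset (r j)" by simp
    then show "i = j" unfolding set_r by simp
  qed
  have "coeff (pw k * f) \<alpha> = (\<Sum>x\<in>(\<lambda>i. (r i, \<alpha> - r i)) ` ?I. coeff f (snd x))"
    unfolding coeff_mult
  proof (rule sum.mono_neutral_cong_right [OF finite_splits])
    show "(\<lambda>i. (r i, \<alpha> - r i)) ` ?I \<subseteq> splits \<alpha>"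
      unfolding splits_alt using sub by blast
    show "\<forall>x\<in>splits \<alpha> - (\<lambda>i. (r i, \<alpha> - r i)) ` ?I.
            (case x of (\<beta>, \<gamma>) \<Rightarrow> coeff (pw k) \<beta> * coeff f \<gamma>) = 0"
      unfolding splits_alt c using sub by auto
    show "(case x of (\<beta>, \<gamma>) \<Rightarrow> coeff (pw k) \<beta> * coeff f \<gamma>) = coeff f (snd x)"
      if "x \<in> (\<lambda>i. (r i, \<alpha> - r i)) ` ?I" for x
      using that by (auto simp: c)
  qed
  also have "\<dots> = (\<Sum>i\<in>?I. coeff f (\<alpha> - r i))" by (simp add: sum.reindex [OF inj])
  finally show ?thesis unfolding r_def .
qed

lemma finite_count_ge: "finite {i. Suc k \<le> count \<alpha> i}"
  by (rule finite_subset [of _ "set_mset \<alpha>"]) (auto intro!: count_inI)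

lemma pbasis_empty: "pbasis {#} = 1" by (simp add: pbasis_def)
lemma pbasis_add: "pbasis (add_mset k \<mu>) = pw k * pbasis \<mu>" by (simp add: pbasis_def)

lemma Sym_pbasis: "pbasis \<mu> \<in> Sym"
  unfolding pbasis_def by (intro Sym_prod_mset Sym_power_sum)

lemma pbasis_addE:
  assumes "coeff (pbasis (add_mset k \<mu>)) \<alpha> \<noteq> 0"
  obtains i \<gamma> where "\<alpha> = \<gamma> + replicate_mset (Suc k) i" "coeff (pbasis \<mu>) \<gamma> \<noteq> 0"
proof -
  obtain i where "Suc k \<le> count \<alpha> i" "coeff (pbasis \<mu>) (\<alpha> - replicate_mset (Suc k) i) \<noteq> 0"
    using assms unfolding pbasis_add coeff_pw_mult by (auto elim: sum.not_neutral_contains_not_neutral)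
  moreover have "\<alpha> = (\<alpha> - replicate_mset (Suc k) i) + replicate_mset (Suc k) i"
    using \<open>Suc k \<le> count \<alpha> i\<close>
    by (metis count_le_replicate_mset_subset_eq subset_mset.diff_add)
  ultimately show ?thesis using that by blast
qed

text \<open>The exponents of a monomial, each decreased by 1.\<close>

definition exps :: "nat multiset \<Rightarrow> nat multiset" where
  "exps \<alpha> = image_mset (\<lambda>i. count \<alpha> i - 1) (mset_set (set_mset \<alpha>))"

lemma size_exps: "size (exps \<alpha>) = card (set_mset \<alpha>)" by (simp add: exps_def)

lemma exps_add:
  assumes "i \<notin># \<gamma>"
  shows "exps (\<gamma> + replicate_mset (Suc k) i) = add_mset k (exps \<gamma>)"
proof -
  have s: "set_mset (\<gamma> + replicate_mset (Suc k) i) = insert i (set_mset \<gamma>)" by auto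
  have "image_mset (\<lambda>j. count (\<gamma> + replicate_mset (Suc k) i) j - 1) (mset_set (set_mset \<gamma>)) = exps \<gamma>"
    unfolding exps_def by (rule image_mset_cong) (use assms in auto)
  then show ?thesis
    using assms unfolding exps_def [of "\<gamma> + _"] s by (simp add: not_in_iff)
qed

lemma pbasis_card: "coeff (pbasis \<mu>) \<alpha> \<noteq> 0 \<Longrightarrow> card (set_mset \<alpha>) \<le> size \<mu>"
proof (induction \<mu> arbitrary: \<alpha>)
  case empty
  then show ?case by (auto simp: pbasis_empty coeff_one split: if_splits)
next
  case (add k \<mu>)
  obtain i \<gamma> where *: "\<alpha> = \<gamma> + replicate_mset (Suc k) i" "coeff (pbasis \<mu>) \<gamma> \<noteq> 0"
    using add.prems by (rule pbasis_addE)
  have "card (set_mset \<alpha>) \<le> card (insert i (set_mset \<gamma>))"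
    by (rule card_mono) (auto simp: *)
  also have "\<dots> \<le> Suc (card (set_mset \<gamma>))" by (simp add: card_insert_if)
  finally show ?case using add.IH [OF *(2)] by simp
qed

lemma pbasis_exps:
  "coeff (pbasis \<mu>) \<alpha> \<noteq> 0 \<Longrightarrow> card (set_mset \<alpha>) = size \<mu> \<Longrightarrow> exps \<alpha> = \<mu>"
proof (induction \<mu> arbitrary: \<alpha>)
  case empty
  then show ?case by (auto simp: exps_def)
next
  case (add k \<mu>)
  obtain i \<gamma> where *: "\<alpha> = \<gamma> + replicate_mset (Suc k) i" "coeff (pbasis \<mu>) \<gamma> \<noteq> 0"
    using add.prems(1) by (rule pbasis_addE)
  have s: "set_mset \<alpha> = insert i (set_mset \<gamma>)" by (auto simp: *)
  have le: "card (set_mset \<gamma>) \<le> size \<mu>" using *(2) by (rule pbasis_card)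
  have i: "i \<notin># \<gamma>"
    using add.prems(2) le unfolding s by (auto simp: insert_absorb)
  then have "card (set_mset \<gamma>) = size \<mu>" using add.prems(2) unfolding s by simp
  then show ?case using add.IH [OF *(2)] exps_add [OF i] *(1) by simp
qed

lemma pbasis_nonneg: "coeff (pbasis \<mu>) \<alpha> \<ge> 0"
  by (induction \<mu> arbitrary: \<alpha>)
     (auto simp: pbasis_empty pbasis_add coeff_one coeff_pw_mult intro!: sum_nonneg)

lemma pbasis_pos: "exps \<alpha> = \<mu> \<Longrightarrow> coeff (pbasis \<mu>) \<alpha> > 0"
proof (induction \<mu> arbitrary: \<alpha>)
  case empty
  then have "\<alpha> = {#}" by (simp add: exps_def mset_set_empty_iff)
  then show ?case by (simp add: pbasis_empty coeff_one)
next
  case (add k \<mu>)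
  have "k \<in># exps \<alpha>" by (simp add: add.prems)
  then obtain i where "i \<in># \<alpha>" "count \<alpha> i - 1 = k" by (auto simp: exps_def)
  then have "count \<alpha> i - 1 = k" "count \<alpha> i > 0" by (simp_all only: count_greater_zero_iff)
  then have c: "count \<alpha> i = Suc k" by linarith
  define \<gamma> where "\<gamma> = \<alpha> - replicate_mset (Suc k) i"
  have \<alpha>: "\<alpha> = \<gamma> + replicate_mset (Suc k) i"
    unfolding \<gamma>_def using c
    by (metis count_le_replicate_mset_subset_eq order_refl subset_mset.diff_add)
  have "i \<notin># \<gamma>" unfolding \<gamma>_def by (simp add: not_in_iff c del: replicate_mset_Suc)
  then have "exps \<gamma> = \<mu>" using add.prems exps_add [of i \<gamma> k] \<alpha> by simp
  then have "coeff (pbasis \<mu>) \<gamma> > 0" by (rule add.IH)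
  then show ?case
    unfolding pbasis_add coeff_pw_mult
    by (intro sum_pos2 [OF finite_count_ge, of i]) (use c in \<open>auto simp: \<gamma>_def pbasis_nonneg\<close>)
qed

lemma ex_exps: "\<exists>\<alpha>. exps \<alpha> = \<mu>"
proof (induction \<mu>)
  case empty
  then show ?case by (intro exI [of _ "{#}"]) (simp add: exps_def)
next
  case (add k \<mu>)
  then obtain \<alpha> where "exps \<alpha> = \<mu>" by blast
  moreover obtain i where "i \<notin># \<alpha>" using ex_new_if_finite [OF infinite_UNIV_nat finite_set_mset] by blast
  ultimately show ?case using exps_add [of i \<alpha> k] by blast
qed

lemma exps_image_count:
  assumes "finite A" "set_mset \<alpha> \<subseteq> A"
  shows "image_mset (count \<alpha>) (mset_set A) =
         image_mset Suc (exps \<alpha>) + replicate_mset (card A - card (set_mset \<alpha>)) 0"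
proof -
  have "mset_set A = mset_set (set_mset \<alpha>) + mset_set (A - set_mset \<alpha>)"
    using assms by (metis Diff_disjoint finite_Diff finite_set_mset mset_set_Union sup.absorb_iff1
        Un_Diff_cancel sup_commute)
  moreover have "image_mset (count \<alpha>) (mset_set (set_mset \<alpha>)) = image_mset Suc (exps \<alpha>)"
    unfolding exps_def multiset.map_comp by (rule image_mset_cong) (auto simp: Suc_diff_le count_greater_zero_iff)
  moreover have "image_mset (count \<alpha>) (mset_set (A - set_mset \<alpha>)) =
      image_mset (\<lambda>_. 0) (mset_set (A - set_mset \<alpha>))"
    by (rule image_mset_cong) (use assms in \<open>auto simp: not_in_iff\<close>)
  ultimately show ?thesis
    using assms by (simp add: image_mset_const_eq card_Diff_subset)
qed

lemma exps_eq_perm: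
  assumes "exps \<alpha> = exps \<beta>"
  obtains \<pi> where "bij \<pi>" "image_mset \<pi> \<alpha> = \<beta>"
proof -
  let ?A = "set_mset \<alpha> \<union> set_mset \<beta>"
  have "card (set_mset \<alpha>) = card (set_mset \<beta>)" using assms by (simp flip: size_exps)
  then have "image_mset (count \<alpha>) (mset_set ?A) = image_mset (count \<beta>) (mset_set ?A)"
    by (simp add: exps_image_count assms)
  then obtain p where p: "p permutes ?A" "\<And>x. x \<in> ?A \<Longrightarrow> count \<alpha> x = count \<beta> (p x)"
    by (rule image_mset_eq_implies_permutes [rotated]) auto
  have c: "count \<alpha> x = count \<beta> (p x)" for x
    using p(2) [of x] permutes_not_in [OF p(1), of x] by (cases "x \<in> ?A") (auto simp: not_in_iff)
  have "image_mset p \<alpha> = \<beta>"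
  proof (rule multiset_eqI)
    fix y
    obtain x where "y = p x" using permutes_surj [OF p(1)] by blast
    moreover have "p -` {p x} \<inter> set_mset \<alpha> = {x} \<inter> set_mset \<alpha>"
      using permutes_inj [OF p(1)] by (auto dest: injD)
    ultimately show "count (image_mset p \<alpha>) y = count \<beta> y"
      by (cases "x \<in># \<alpha>") (auto simp: count_image_mset simp flip: c dest: not_in_iff [THEN iffD1])
  qed
  then show ?thesis using that permutes_bij [OF p(1)] by blast
qed

lemma Sym_exps: "f \<in> Sym \<Longrightarrow> exps \<alpha> = exps \<beta> \<Longrightarrow> coeff f \<alpha> = coeff f \<beta>"
  by (metis exps_eq_perm Sym_perm)

lemma coeff_ev_pw:
  "coeff (ev (\<lambda>k. pw k) P) \<alpha> =
     (\<Sum>\<mu>\<in>Poly_Mapping.keys P. Poly_Mapping.lookup P \<mu> * coeff (pbasis \<mu>) \<alpha>)"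
  by (simp add: ev_def pbasis_def)

lemma ev_pw_eq_0:
  assumes "ev (\<lambda>k. pw k) P = 0"
  shows "P = 0"
proof (rule ccontr)
  assume "P \<noteq> 0"
  then have ne: "Poly_Mapping.keys P \<noteq> {}" by simp
  have "Max (size ` Poly_Mapping.keys P) \<in> size ` Poly_Mapping.keys P" using ne by (intro Max_in) auto
  then obtain \<mu> where \<mu>: "\<mu> \<in> Poly_Mapping.keys P" "size \<mu> = Max (size ` Poly_Mapping.keys P)" by auto
  then have max: "size \<nu> \<le> size \<mu>" if "\<nu> \<in> Poly_Mapping.keys P" for \<nu> using that by auto
  obtain \<alpha> where \<alpha>: "exps \<alpha> = \<mu>" using ex_exps by blast
  have "coeff (pbasis \<nu>) \<alpha> = 0" if "\<nu> \<in> Poly_Mapping.keys P" "\<nu> \<noteq> \<mu>" for \<nu>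
  proof (rule ccontr)
    assume n: "coeff (pbasis \<nu>) \<alpha> \<noteq> 0"
    then have "card (set_mset \<alpha>) \<le> size \<nu>" by (rule pbasis_card)
    then have "card (set_mset \<alpha>) = size \<nu>" using max [OF that(1)] \<alpha> size_exps [of \<alpha>] by simp
    then show False using pbasis_exps [OF n] \<alpha> that(2) by simp
  qed
  then have "coeff (ev (\<lambda>k. pw k) P) \<alpha> =
      (\<Sum>\<nu>\<in>{\<mu>}. Poly_Mapping.lookup P \<nu> * coeff (pbasis \<nu>) \<alpha>)"
    unfolding coeff_ev_pw by (intro sum.mono_neutral_right) (use \<mu> in auto)
  then show False using assms \<mu>(1) pbasis_pos [OF \<alpha>] by (simp add: in_keys_iff)
qed

lemma inj_ev_pw: "inj (ev (\<lambda>k. pw k))"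
proof (rule injI)
  fix P Q assume "ev (\<lambda>k. pw k) P = ev (\<lambda>k. pw k) Q"
  moreover have "ev (\<lambda>k. pw k) P = ev (\<lambda>k. pw k) (P - Q) + ev (\<lambda>k. pw k) Q"
    by (simp flip: ev_add)
  ultimately have "ev (\<lambda>k. pw k) (P - Q) = 0" by simp
  then show "P = Q" using ev_pw_eq_0 [of "P - Q"] by simp
qed

lemma pbasis_size: "coeff (pbasis \<mu>) \<alpha> \<noteq> 0 \<Longrightarrow> size \<alpha> = (\<Sum>k\<in>#\<mu>. Suc k)"
proof (induction \<mu> arbitrary: \<alpha>)
  case empty
  then show ?case by (auto simp: pbasis_empty coeff_one split: if_splits)
next
  case (add k \<mu>)
  obtain i \<gamma> where "\<alpha> = \<gamma> + replicate_mset (Suc k) i" "coeff (pbasis \<mu>) \<gamma> \<noteq> 0"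
    using add.prems by (rule pbasis_addE)
  with add.IH [of \<gamma>] show ?case by simp
qed

lemma Sym_span_aux:
  assumes "f \<in> Sym" "\<And>\<alpha>. coeff f \<alpha> \<noteq> 0 \<Longrightarrow> size \<alpha> \<le> d \<and> card (set_mset \<alpha>) < N"
  shows "f \<in> range (ev (\<lambda>k. pw k))"
  using assms
proof (induction N arbitrary: f)
  case 0
  then have "f = 0" by (intro mseries_eqI) auto
  then show ?case using ev_zero by (metis rangeI)
next
  case (Suc N)
  define M where "M = exps ` {\<alpha>. coeff f \<alpha> \<noteq> 0 \<and> card (set_mset \<alpha>) = N}"
  have count_le: "count \<alpha> i \<le> size \<alpha>" for \<alpha> :: "nat multiset" and i by (rule count_le_size)
  have "M \<subseteq> mset ` {xs. set xs \<subseteq> {..d} \<and> length xs = N}"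
  proof
    fix \<mu> assume "\<mu> \<in> M"
    then obtain \<alpha> where \<alpha>: "\<mu> = exps \<alpha>" "coeff f \<alpha> \<noteq> 0" "card (set_mset \<alpha>) = N" by (auto simp: M_def)
    obtain xs where xs: "mset xs = \<mu>" using ex_mset by blast
    have "set xs = set_mset \<mu>" using xs by auto
    also have "\<dots> \<subseteq> {..d}"
      using Suc.prems(2) [OF \<alpha>(2)] count_le [of \<alpha>] unfolding \<alpha>(1) exps_def
      by (auto intro: order_trans [OF diff_le_self] order_trans [OF count_le_size])
    finally have "set xs \<subseteq> {..d}" .
    moreover have "length xs = N" using xs \<alpha> by (metis size_exps size_mset)
    ultimately show "\<mu> \<in> mset ` {xs. set xs \<subseteq> {..d} \<and> length xs = N}" using xs by blast
  qed
  then have fin: "finite M" by (rule finite_subset) (simp add: finite_lists_length_eq)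
  have sizeM: "size \<mu> = N" if "\<mu> \<in> M" for \<mu> using that by (auto simp: M_def size_exps)
  obtain r where r: "\<And>\<mu>. exps (r \<mu>) = \<mu>" using ex_exps by metis
  define c where "c \<mu> = coeff f (r \<mu>) / coeff (pbasis \<mu>) (r \<mu>)" for \<mu>
  define P where "P = (\<Sum>\<mu>\<in>M. Poly_Mapping.single \<mu> (c \<mu>))"
  define g where "g = f - ev (\<lambda>k. pw k) P"
  have cP: "coeff (ev (\<lambda>k. pw k) P) \<alpha> = (\<Sum>\<mu>\<in>M. c \<mu> * coeff (pbasis \<mu>) \<alpha>)" for \<alpha>
    by (simp add: P_def ev_sum ev_single flip: pbasis_def)
  have "g \<in> Sym" unfolding g_def by (intro Sym_diff Suc.prems Sym_ev Sym_power_sum)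
  moreover have "size \<alpha> \<le> d \<and> card (set_mset \<alpha>) < N" if g: "coeff g \<alpha> \<noteq> 0" for \<alpha>
  proof -
    have "coeff f \<alpha> \<noteq> 0 \<or> (\<exists>\<mu>\<in>M. coeff (pbasis \<mu>) \<alpha> \<noteq> 0)"
    proof (rule ccontr)
      assume "\<not> ?thesis"
      then show False using g by (simp add: g_def cP)
    qed
    then have le: "size \<alpha> \<le> d \<and> card (set_mset \<alpha>) \<le> N"
    proof
      assume "\<exists>\<mu>\<in>M. coeff (pbasis \<mu>) \<alpha> \<noteq> 0"
      then obtain \<mu> where \<mu>: "\<mu> \<in> M" "coeff (pbasis \<mu>) \<alpha> \<noteq> 0" by blast
      obtain \<beta> where \<beta>: "\<mu> = exps \<beta>" "coeff f \<beta> \<noteq> 0" using \<mu>(1) by (auto simp: M_def)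
      have "coeff (pbasis \<mu>) \<beta> \<noteq> 0" using pbasis_pos [of \<beta> \<mu>] \<beta>(1) by simp
      then have "size \<alpha> = size \<beta>" using pbasis_size \<mu>(2) by metis
      then show ?thesis using pbasis_card [OF \<mu>(2)] sizeM [OF \<mu>(1)] Suc.prems(2) [OF \<beta>(2)] by simp
    qed (use Suc.prems(2) [of \<alpha>] in auto)
    moreover have "card (set_mset \<alpha>) \<noteq> N"
    proof
      assume N: "card (set_mset \<alpha>) = N"
      have z: "coeff (pbasis \<mu>) \<alpha> = 0" if "\<mu> \<in> M" "\<mu> \<noteq> exps \<alpha>" for \<mu>
        using pbasis_exps [of \<mu> \<alpha>] that sizeM N by auto
      have "coeff f \<alpha> = (\<Sum>\<mu>\<in>M. c \<mu> * coeff (pbasis \<mu>) \<alpha>)"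
      proof (cases "exps \<alpha> \<in> M")
        case True
        then have "(\<Sum>\<mu>\<in>M. c \<mu> * coeff (pbasis \<mu>) \<alpha>) = (\<Sum>\<mu>\<in>{exps \<alpha>}. c \<mu> * coeff (pbasis \<mu>) \<alpha>)"
          by (intro sum.mono_neutral_right fin) (auto simp: z)
        also have "\<dots> = coeff f \<alpha>"
          using pbasis_pos [OF r, of "exps \<alpha>"] Sym_exps [OF Suc.prems(1) r [of "exps \<alpha>"]]
            Sym_exps [OF Sym_pbasis r [of "exps \<alpha>"], of "exps \<alpha>"]
          by (simp add: c_def)
        finally show ?thesis by simp
      next
        case False
        then have "coeff f \<alpha> = 0" using N by (auto simp: M_def)
        moreover have "(\<Sum>\<mu>\<in>M. c \<mu> * coeff (pbasis \<mu>) \<alpha>) = 0"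
          by (rule sum.neutral) (use False z in auto)
        ultimately show ?thesis by simp
      qed
      then show False using g by (simp add: g_def cP)
    qed
    ultimately show ?thesis by simp
  qed
  ultimately have "g \<in> range (ev (\<lambda>k. pw k))" by (rule Suc.IH)
  then obtain Q where "g = ev (\<lambda>k. pw k) Q" by blast
  then have "f = ev (\<lambda>k. pw k) (Q + P)" by (simp add: g_def ev_add algebra_simps)
  then show ?case by blast
qed

lemma Sym_eq_range: "Sym = range (ev (\<lambda>k. pw k))"
proof
  show "Sym \<subseteq> range (ev (\<lambda>k. pw k))"
  proof
    fix f assume f: "f \<in> Sym"
    then obtain d where d: "\<And>\<alpha>. coeff f \<alpha> \<noteq> 0 \<Longrightarrow> size \<alpha> \<le> d" using Sym_bound by blast
    have "card (set_mset \<alpha>) \<le> size \<alpha>" for \<alpha> :: "nat multiset"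
      by (induction \<alpha>) (auto simp: card_insert_if)
    then show "f \<in> range (ev (\<lambda>k. pw k))"
      using d by (intro Sym_span_aux [OF f, of d "Suc d"]) (auto intro: le_imp_less_Suc order_trans)
  qed
qed (auto intro: Sym_ev Sym_power_sum)

subsection \<open>Existence and uniqueness\<close>

text \<open>The substitution \<open>x\<^sub>i \<mapsto> x\<^sub>i\<^sup>k\<close> (for \<open>k \<ge> 1\<close>).\<close>

lift_definition adams :: "nat \<Rightarrow> mseries \<Rightarrow> mseries" is
  "\<lambda>k f \<alpha>. if \<exists>\<beta>. \<alpha> = repeat_mset k \<beta> then f (THE \<beta>. \<alpha> = repeat_mset k \<beta>) else 0" .

lemma image_mset_repeat_mset: "image_mset f (repeat_mset k \<beta>) = repeat_mset k (image_mset f \<beta>)"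
  by (induction k) auto

lemma repeat_inj: "repeat_mset (Suc k) \<beta> = repeat_mset (Suc k) \<gamma> \<longleftrightarrow> \<beta> = \<gamma>"
  unfolding repeat_mset_cancel1 by simp

lemma coeff_adams: "coeff (adams (Suc k) f) (repeat_mset (Suc k) \<beta>) = coeff f \<beta>"
proof -
  have "(THE \<gamma>. repeat_mset (Suc k) \<beta> = repeat_mset (Suc k) \<gamma>) = \<beta>"
    by (rule the_equality) (auto simp only: repeat_inj)
  then show ?thesis by transfer auto
qed

lemma coeff_adams_0: "(\<And>\<beta>. \<alpha> \<noteq> repeat_mset k \<beta>) \<Longrightarrow> coeff (adams k f) \<alpha> = 0"
  by transfer auto

lemma adams_eqI:
  assumes "\<And>\<beta>. coeff g (repeat_mset (Suc k) \<beta>) = coeff f \<beta>"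
    and "\<And>\<alpha>. (\<And>\<beta>. \<alpha> \<noteq> repeat_mset (Suc k) \<beta>) \<Longrightarrow> coeff g \<alpha> = 0"
  shows "adams (Suc k) f = g"
  by (rule mseries_eqI) (metis assms coeff_adams coeff_adams_0)

lemma adams_power_sum: "adams (Suc k) (power_sum m) = power_sum (Suc k * m)"
proof (rule adams_eqI)
  have rr: "repeat_mset (Suc k) (replicate_mset m i) = replicate_mset (Suc k * m) i" for i :: nat
    by (simp add: multiset_eq_iff del: repeat_mset_Suc)
  show "coeff (power_sum (Suc k * m)) (repeat_mset (Suc k) \<beta>) = coeff (power_sum m) \<beta>" for \<beta>
    unfolding coeff_power_sum rr [symmetric] repeat_inj ..
  show "coeff (power_sum (Suc k * m)) \<alpha> = 0" if "\<And>\<beta>. \<alpha> \<noteq> repeat_mset (Suc k) \<beta>" for \<alpha>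
    unfolding coeff_power_sum rr [symmetric] using that by simp
qed

lemma Sym_endo_adams: "Sym_endo (adams (Suc k))"
proof -
  have mult: "adams (Suc k) (f * g) = adams (Suc k) f * adams (Suc k) g" for f g
  proof (rule adams_eqI)
    fix \<beta>
    have "coeff (adams (Suc k) f * adams (Suc k) g) (repeat_mset (Suc k) \<beta>) =
       (\<Sum>(x, y)\<in>(\<lambda>(x, y). (repeat_mset (Suc k) x, repeat_mset (Suc k) y)) ` splits \<beta>.
          coeff (adams (Suc k) f) x * coeff (adams (Suc k) g) y)"
      unfolding coeff_mult
    proof (rule sum.mono_neutral_right [OF finite_splits])
      show "(\<lambda>(x, y). (repeat_mset (Suc k) x, repeat_mset (Suc k) y)) ` splits \<beta>
          \<subseteq> splits (repeat_mset (Suc k) \<beta>)"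
        by (auto simp: splits_def simp flip: repeat_mset_distrib2 simp del: repeat_mset_Suc)
      show "\<forall>i\<in>splits (repeat_mset (Suc k) \<beta>) -
              (\<lambda>(x, y). (repeat_mset (Suc k) x, repeat_mset (Suc k) y)) ` splits \<beta>.
            (case i of (x, y) \<Rightarrow> coeff (adams (Suc k) f) x * coeff (adams (Suc k) g) y) = 0"
      proof (rule ballI, rule ccontr)
        fix i assume i: "i \<in> splits (repeat_mset (Suc k) \<beta>) -
              (\<lambda>(x, y). (repeat_mset (Suc k) x, repeat_mset (Suc k) y)) ` splits \<beta>"
          and n: "(case i of (x, y) \<Rightarrow> coeff (adams (Suc k) f) x * coeff (adams (Suc k) g) y) \<noteq> 0"
        obtain x y where "i = (x, y)" by (cases i)
        with n obtain x' y' where xy: "i = (repeat_mset (Suc k) x', repeat_mset (Suc k) y')"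
          by (auto simp del: repeat_mset_Suc) (metis coeff_adams_0)
        with i have "repeat_mset (Suc k) (x' + y') = repeat_mset (Suc k) \<beta>"
          by (simp add: splits_def repeat_mset_distrib2 del: repeat_mset_Suc)
        then have "(x', y') \<in> splits \<beta>" unfolding repeat_inj by (simp add: splits_def)
        then have "i \<in> (\<lambda>(x, y). (repeat_mset (Suc k) x, repeat_mset (Suc k) y)) ` splits \<beta>"
          unfolding xy by (rule rev_image_eqI) (simp only: prod.case)
        with i show False by simp
      qed
    qed
    also have "\<dots> = coeff (f * g) \<beta>"
      unfolding coeff_mult
      by (subst sum.reindex)
         (auto intro!: inj_onI simp: repeat_inj coeff_adams case_prod_beta simp del: repeat_mset_Suc)
    finally show "coeff (adams (Suc k) f * adams (Suc k) g) (repeat_mset (Suc k) \<beta>) = coeff (f * g) \<beta>" .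
  next
    fix \<alpha> :: "nat multiset" assume \<alpha>: "\<And>\<beta>. \<alpha> \<noteq> repeat_mset (Suc k) \<beta>"
    show "coeff (adams (Suc k) f * adams (Suc k) g) \<alpha> = 0"
      unfolding coeff_mult
    proof (rule sum.neutral, rule ballI, rule ccontr)
      fix i assume i: "i \<in> splits \<alpha>"
        and n: "(case i of (x, y) \<Rightarrow> coeff (adams (Suc k) f) x * coeff (adams (Suc k) g) y) \<noteq> 0"
      obtain x y where "i = (x, y)" by (cases i)
      with n obtain x' y' where "i = (repeat_mset (Suc k) x', repeat_mset (Suc k) y')"
        by (auto simp del: repeat_mset_Suc) (metis coeff_adams_0)
      with i have "\<alpha> = repeat_mset (Suc k) (x' + y')"
        by (simp add: splits_def repeat_mset_distrib2 del: repeat_mset_Suc)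
      with \<alpha> show False by blast
    qed
  qed
  have add: "adams (Suc k) (f + g) = adams (Suc k) f + adams (Suc k) g" for f g
    by (rule adams_eqI) (simp_all add: coeff_adams coeff_adams_0 del: repeat_mset_Suc)
  have scal: "adams (Suc k) (scale c f) = scale c (adams (Suc k) f)" for c f
    by (rule adams_eqI) (simp_all add: coeff_adams coeff_adams_0 del: repeat_mset_Suc)
  have one: "adams (Suc k) 1 = 1"
  proof (rule adams_eqI)
    show "coeff 1 (repeat_mset (Suc k) \<beta>) = coeff 1 \<beta>" for \<beta>
      unfolding coeff_one repeat_mset_eq_empty_iff by simp
    show "coeff 1 \<alpha> = 0" if "\<And>\<beta>. \<alpha> \<noteq> repeat_mset (Suc k) \<beta>" for \<alpha>
      using that [of "{#}"] by (simp add: coeff_one)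
  qed
  have sym: "adams (Suc k) f \<in> Sym" if f: "f \<in> Sym" for f
  proof -
    obtain d where d: "\<And>\<alpha>. coeff f \<alpha> \<noteq> 0 \<Longrightarrow> size \<alpha> \<le> d" using Sym_bound [OF f] by blast
    show ?thesis
    proof (rule SymI [of _ "Suc k * d"])
      fix \<pi> :: "nat \<Rightarrow> nat" and \<alpha> assume b: "bij \<pi>"
      show "coeff (adams (Suc k) f) (image_mset \<pi> \<alpha>) = coeff (adams (Suc k) f) \<alpha>"
      proof (cases "\<exists>\<beta>. \<alpha> = repeat_mset (Suc k) \<beta>")
        case True
        then obtain \<beta> where "\<alpha> = repeat_mset (Suc k) \<beta>" ..
        moreover have "image_mset \<pi> (repeat_mset (Suc k) \<beta>) = repeat_mset (Suc k) (image_mset \<pi> \<beta>)"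
          by (rule image_mset_repeat_mset)
        ultimately show ?thesis by (simp only: coeff_adams Sym_perm [OF f b])
      next
        case False
        have "image_mset \<pi> \<alpha> \<noteq> repeat_mset (Suc k) \<beta>" for \<beta>
        proof
          assume "image_mset \<pi> \<alpha> = repeat_mset (Suc k) \<beta>"
          then have "\<alpha> = repeat_mset (Suc k) (image_mset (inv \<pi>) \<beta>)"
            by (metis image_mset_inv(2) [OF b] image_mset_repeat_mset)
          with False show False by blast
        qed
        with False show ?thesis by (metis coeff_adams_0)
      qed
    next
      fix \<alpha> assume n: "coeff (adams (Suc k) f) \<alpha> \<noteq> 0"
      then obtain \<beta> where \<beta>: "\<alpha> = repeat_mset (Suc k) \<beta>" by (metis coeff_adams_0)
      then have "size \<beta> \<le> d" using n d by (simp only: coeff_adams)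
      then show "size \<alpha> \<le> Suc k * d" unfolding \<beta> size_repeat_mset by (rule mult_le_mono2)
    qed
  qed
  show ?thesis unfolding Sym_endo_def using sym one mult add scal by blast
qed

lemma Sym_endo_sum:
  assumes \<phi>: "Sym_endo \<phi>" and f: "\<And>x. x \<in> A \<Longrightarrow> f x \<in> Sym"
  shows "\<phi> (sum f A) = (\<Sum>x\<in>A. \<phi> (f x))"
proof -
  have "\<phi> (scale 0 0) = scale 0 (\<phi> 0)" using \<phi> Sym_zero unfolding Sym_endo_def by blast
  then have z: "\<phi> 0 = 0" by simp
  show ?thesis using f
  proof (induction A rule: infinite_finite_induct)
    case (insert x A)
    then have "\<phi> (f x + sum f A) = \<phi> (f x) + \<phi> (sum f A)"
      using \<phi> unfolding Sym_endo_def by (meson Sym_sum insertCI)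
    then show ?case using insert by simp
  qed (auto simp: z)
qed

lemma Sym_endo_prod:
  assumes \<phi>: "Sym_endo \<phi>" and v: "\<And>k. v k \<in> Sym"
  shows "\<phi> (\<Prod>k\<in>#\<mu>. v k) = (\<Prod>k\<in>#\<mu>. \<phi> (v k))"
proof (induction \<mu>)
  case empty
  then show ?case using \<phi> by (simp add: Sym_endo_def)
next
  case (add k \<mu>)
  have "(\<Prod>k\<in>#\<mu>. v k) \<in> Sym" by (rule Sym_prod_mset) (rule v)
  then have "\<phi> (v k * (\<Prod>k\<in>#\<mu>. v k)) = \<phi> (v k) * \<phi> (\<Prod>k\<in>#\<mu>. v k)"
    using \<phi> v unfolding Sym_endo_def by blast
  then show ?case using add by simp
qed

lemma Sym_endo_ev:
  assumes \<phi>: "Sym_endo \<phi>" and v: "\<And>k. v k \<in> Sym"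
  shows "\<phi> (ev v P) = ev (\<lambda>k. \<phi> (v k)) P"
proof -
  have "\<phi> (ev v P) = (\<Sum>\<mu>\<in>Poly_Mapping.keys P. \<phi> (scale (Poly_Mapping.lookup P \<mu>) (\<Prod>k\<in>#\<mu>. v k)))"
    unfolding ev_def by (intro Sym_endo_sum \<phi> Sym_scale Sym_prod_mset v)
  also have "\<dots> = ev (\<lambda>k. \<phi> (v k)) P"
    unfolding ev_def
  proof (rule sum.cong)
    fix \<mu>
    have "(\<Prod>k\<in>#\<mu>. v k) \<in> Sym" by (rule Sym_prod_mset) (rule v)
    then show "\<phi> (scale (Poly_Mapping.lookup P \<mu>) (\<Prod>k\<in>#\<mu>. v k)) =
        scale (Poly_Mapping.lookup P \<mu>) (\<Prod>k\<in>#\<mu>. \<phi> (v k))"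
      using \<phi> Sym_endo_prod [where v = v, OF \<phi> v] unfolding Sym_endo_def by simp
  qed simp
  finally show ?thesis .
qed

lemma is_plethysm_unique:
  assumes F: "is_plethysm F" and G: "is_plethysm G" and "f \<in> Sym" "g \<in> Sym"
  shows "F f g = G f g"
proof -
  obtain P Q where PQ: "f = ev (\<lambda>k. pw k) P" "g = ev (\<lambda>k. pw k) Q"
    using assms Sym_eq_range by blast
  have E: "E f g = ev (\<lambda>k. ev (\<lambda>m. power_sum (Suc k * Suc m)) Q) P" if E: "is_plethysm E" for E
  proof -
    have k: "E (pw k) g = ev (\<lambda>m. power_sum (Suc k * Suc m)) Q" for k
    proof -
      have "Sym_endo (E (pw k))" using E unfolding is_plethysm_def by simp
      then have "E (pw k) g = ev (\<lambda>m. E (pw k) (pw m)) Q"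
        unfolding PQ(2) by (rule Sym_endo_ev) (rule Sym_power_sum)
      moreover have "E (pw k) (pw m) = power_sum (Suc k * Suc m)" for m
        using E unfolding is_plethysm_def by (metis One_nat_def Suc_le_mono le0)
      ultimately show ?thesis by simp
    qed
    have "Sym_endo (\<lambda>f. E f g)" using E \<open>g \<in> Sym\<close> unfolding is_plethysm_def by simp
    from Sym_endo_ev [OF this Sym_power_sum, of Suc P] show ?thesis unfolding k PQ(1) .
  qed
  show ?thesis using E [OF F] E [OF G] by simp
qed

lemma ex_plethysm: "\<exists>F. is_plethysm F"
proof -
  let ?e = "ev (\<lambda>k. pw k)"
  define r where "r = inv ?e"
  have r1: "r (?e P) = P" for P unfolding r_def by (rule inv_f_f [OF inj_ev_pw])
  have r2: "?e (r f) = f" if "f \<in> Sym" for f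
    unfolding r_def by (rule f_inv_into_f) (use that Sym_eq_range in auto)
  define F where "F f g = ev (\<lambda>k. adams (Suc k) g) (r f)" for f g
  have Fp: "F (pw k) g = adams (Suc k) g" for k g
  proof -
    have "?e (Poly_Mapping.single {#k#} 1) = pw k" by (simp add: ev_single)
    then have "r (pw k) = Poly_Mapping.single {#k#} 1" using r1 by metis
    then show ?thesis by (simp add: F_def ev_single)
  qed
  have endo: "Sym_endo (\<lambda>f. F f g)" if g: "g \<in> Sym" for g
  proof -
    have "r 1 = 1" using r1 [of 1] by (simp add: ev_one)
    moreover have "r (f + h) = r f + r h" if "f \<in> Sym" "h \<in> Sym" for f h
      using r1 [of "r f + r h"] that by (simp add: ev_add r2)
    moreover have "r (f * h) = r f * r h" if "f \<in> Sym" "h \<in> Sym" for f h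
      using r1 [of "r f * r h"] that by (simp add: ev_mult r2)
    moreover have "r (scale c f) = Poly_Mapping.single {#} c * r f" if "f \<in> Sym" for c f
      using r1 [of "Poly_Mapping.single {#} c * r f"] that by (simp add: ev_scale r2)
    moreover have "ev (\<lambda>k. adams (Suc k) g) P \<in> Sym" for P
      by (rule Sym_ev) (use Sym_endo_adams g in \<open>auto simp: Sym_endo_def\<close>)
    ultimately show ?thesis
      by (auto simp: Sym_endo_def F_def ev_add ev_mult ev_one ev_single scale_mult_left)
  qed
  have "is_plethysm F"
    unfolding is_plethysm_def
  proof (intro conjI allI impI ballI endo)
    fix k m :: nat assume "1 \<le> k" "1 \<le> m"
    then show "F (power_sum k) (power_sum m) = power_sum (k * m)"
      by (cases k) (auto simp: Fp adams_power_sum)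
  next
    fix k :: nat assume "1 \<le> k"
    then obtain j where "k = Suc j" by (cases k) auto
    moreover have "F (pw j) = adams (Suc j)" by (rule ext) (rule Fp)
    ultimately show "Sym_endo (F (power_sum k))" using Sym_endo_adams by simp
  qed
  then show ?thesis by (rule exI [of is_plethysm F])
qed

text \<open>On \<open>Sym\<close> the choice is unique, by \<open>is_plethysm_unique\<close>; the values elsewhere are irrelevant.\<close>

definition plethysm :: "mseries \<Rightarrow> mseries \<Rightarrow> mseries" where
  "plethysm = (SOME F. is_plethysm F)"

lemma is_plethysm_plethysm: "is_plethysm plethysm"
  unfolding plethysm_def using ex_plethysm by (rule someI_ex)

lemma finite_partitions: "finite {\<nu>. is_partition \<nu> \<and> sum_list \<nu> = n}"
proof (rule finite_subset)
  have "length \<nu> \<le> sum_list \<nu>" if "0 \<notin> set \<nu>" for \<nu> :: "nat list"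
    using that by (induction \<nu>) auto
  then show "{\<nu>. is_partition \<nu> \<and> sum_list \<nu> = n} \<subseteq> {\<nu>. set \<nu> \<subseteq> {..n} \<and> length \<nu> \<le> n}"
    by (auto simp: is_partition_def member_le_sum_list)
  show "finite {\<nu>. set \<nu> \<subseteq> {..n} \<and> length \<nu> \<le> n}"
    by (simp add: finite_lists_length_le)
qed

end

theory Submission
  imports Defs
begin

text \<open>Since \<open>s\<^sub>2 = h\<^sub>2 = (p\<^sub>1\<^sup>2 + p\<^sub>2) / 2\<close> and \<open>s\<^sub>1\<^sub>1 = e\<^sub>2 = (p\<^sub>1\<^sup>2 - p\<^sub>2) / 2\<close>, the claim amounts to
  Schur expansions of \<open>h\<^sub>\<lambda>\<^sup>2\<close> and \<open>p\<^sub>2[h\<^sub>\<lambda>]\<close>, and likewise for \<open>e\<^sub>\<lambda>\<close>.  Both are multiplicative in the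
  parts of \<open>\<lambda>\<close>, and \<open>p\<^sub>2[h\<^sub>m]\<close> is the alternating sum of the products \<open>h\<^sub>k h\<^sub>2\<^sub>m\<^sub>-\<^sub>k\<close>.  By the Pieri rule,
  multiplication by \<open>h\<^sub>m\<^sup>2\<close> adds two horizontal strips of size \<open>m\<close>, that is, two letters of a tableau of
  content \<open>\<lambda>\<^sup>2\<close>.  In the alternating sum the two strips have sizes \<open>k\<close> and \<open>2 m - k\<close>; counting the
  weights of the \<open>sl\<^sub>2\<close>-representation on two-letter words turns it into the sum of \<open>(- 1)\<^sup>j\<close> over
  pairs of strips of size \<open>m\<close>, where \<open>j\<close> is the number of matched pairs in the reading word.  This
  number is invariant under jeu de taquin, so it is the length of the second row of the
  rectification.  For \<open>e\<^sub>\<lambda>\<close> all shapes are conjugated and each part contributes an extra \<open>(- 1)\<^sup>m\<close>.\<close>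

section \<open>Shapes as row-length functions\<close>

text \<open>The sign identity rests on strings. Words with the same matched pairs form a string
  along which the unmatched letters turn one by one from opening into closing. If their number is
  even, the alternating sum over the string is a single sign (-1)^j, and exactly one word, the
  middle one, uses both letters equally often. A chain of two strips is such a word only up to its
  columns of height two, where both letters are forced; these add the same number of pairs to every
  chain between two given shapes, hence a constant sign. Two obstacles shape the rest. The signs are
  defined through an arbitrary run of jeu de taquin, so the shape of its result is read off from
  quantities that every slide preserves: the letter counts and \<open>pairs\<close>. And
  \<open>complete\<close> and \<open>elementary\<close> are to share one argument, although their
  strips differ; so the expansions are proved for any family \<open>B\<close> with a Pieri rule over
  \<open>up\<close>, to be applied to Schur functions and to Schur functions of conjugate shapes.
  Row lengths are padded by zeros so that strips become pointwise inequalities.\<close>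

definition shapes :: "(nat \<Rightarrow> nat) set" where
  "shapes = {f. (\<forall>i. f (Suc i) \<le> f i) \<and> finite {i. f i \<noteq> 0}}"

definition diag :: "(nat \<Rightarrow> nat) \<Rightarrow> (nat \<times> nat) set" where
  "diag f = {(i, j). j < f i}"

definition wt :: "(nat \<Rightarrow> nat) \<Rightarrow> nat" where
  "wt f = (\<Sum>i | f i \<noteq> 0. f i)"

definition shape_list :: "(nat \<Rightarrow> nat) \<Rightarrow> nat list" where
  "shape_list f = map f [0..<card {i. f i \<noteq> 0}]"

text \<open>Slides remove boxes one at a time, which is easier to express for sets closed towards
  the origin than for row lengths; \<open>ideal_shape\<close> leads back to shapes.\<close>

definition ideal :: "(nat \<times> nat) set \<Rightarrow> bool" where
  "ideal D \<longleftrightarrow> (\<forall>i j i' j'. (i, j) \<in> D \<longrightarrow> i' \<le> i \<longrightarrow> j' \<le> j \<longrightarrow> (i', j') \<in> D)"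

lemma idealD: "ideal D \<Longrightarrow> (i, j) \<in> D \<Longrightarrow> i' \<le> i \<Longrightarrow> j' \<le> j \<Longrightarrow> (i', j') \<in> D"
  unfolding ideal_def by blast

lemma mem_diag [simp]: "(i, j) \<in> diag f \<longleftrightarrow> j < f i"
  by (simp add: diag_def)

lemma shapes_antimono: "f \<in> shapes \<Longrightarrow> i \<le> j \<Longrightarrow> f j \<le> f i"
  unfolding shapes_def by (blast intro: lift_Suc_antimono_le [of f])

lemma shapes_finite: "f \<in> shapes \<Longrightarrow> finite {i. f i \<noteq> 0}"
  by (simp add: shapes_def)

lemma wt_bound:
  assumes "\<And>i. N \<le> i \<Longrightarrow> f i = 0"
  shows "wt f = sum f {..<N}"
  unfolding wt_def
proof (rule sum.mono_neutral_left)
  show "{i. f i \<noteq> 0} \<subseteq> {..<N}" using assms by (metis (mono_tags) lessThan_iff mem_Collect_eq not_le subsetI)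
qed auto

lemma finite_support_bound:
  fixes f :: "nat \<Rightarrow> nat"
  assumes "finite {i. f i \<noteq> 0}"
  obtains N where "\<And>i. N \<le> i \<Longrightarrow> f i = 0"
proof -
  obtain N where "\<forall>i\<in>{i. f i \<noteq> 0}. i < N"
    using finite_nat_set_iff_bounded [THEN iffD1, OF assms] by blast
  then have "f i = 0" if "N \<le> i" for i using that by (metis (mono_tags) mem_Collect_eq not_le)
  then show ?thesis by (rule that)
qed

lemma finite_diag: "finite {i. f i \<noteq> 0} \<Longrightarrow> finite (diag f)"
proof -
  assume "finite {i. f i \<noteq> 0}"
  then have "finite (SIGMA i : {i. f i \<noteq> 0}. {..<f i})" by auto
  then show ?thesis by (rule rev_finite_subset) (auto simp: diag_def)
qed

lemma card_diag: "finite {i. f i \<noteq> 0} \<Longrightarrow> card (diag f) = wt f"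
proof -
  assume "finite {i. f i \<noteq> 0}"
  moreover have "diag f = (SIGMA i : {i. f i \<noteq> 0}. {..<f i})" by (auto simp: diag_def)
  ultimately show ?thesis by (simp add: wt_def)
qed

lemma finite_diag_shapes [simp]: "f \<in> shapes \<Longrightarrow> finite (diag f)"
  by (rule finite_diag [OF shapes_finite])

lemma ideal_diag: "f \<in> shapes \<Longrightarrow> ideal (diag f)"
  unfolding ideal_def mem_diag by (meson shapes_antimono le_less_trans less_le_trans)

lemma diag_inject: "diag f = diag g \<longleftrightarrow> f = g"
proof
  assume "diag f = diag g"
  then have "j < f i \<longleftrightarrow> j < g i" for i j by (metis mem_diag)
  then show "f = g" by (metis ext linorder_neqE_nat less_irrefl)
qed simp

lemma ideal_shape:
  assumes D: "ideal D" "finite D"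
  obtains f where "f \<in> shapes" "D = diag f"
proof
  define f where "f i = card {j. (i, j) \<in> D}" for i
  have fin: "finite {j. (i, j) \<in> D}" for i
    by (rule finite_subset [OF _ finite_imageI [OF D(2), of snd]]) force
  have eq: "{j. (i, j) \<in> D} = {..<f i}" for i
  proof -
    have down: "j' \<in> {j. (i, j) \<in> D}" if "j \<in> {j. (i, j) \<in> D}" "j' \<le> j" for j j'
      using that idealD [OF D(1)] by auto
    show ?thesis
    proof (cases "{j. (i, j) \<in> D} = {}")
      case False
      let ?m = "Max {j. (i, j) \<in> D}"
      have "{j. (i, j) \<in> D} = {..?m}"
        using down [OF Max_in [OF fin False]] Max_ge [OF fin] by blast
      then have "{j. (i, j) \<in> D} = {..<Suc ?m}" by (simp add: lessThan_Suc_atMost)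
      then show ?thesis unfolding f_def by (metis card_lessThan)
    qed (simp add: f_def)
  qed
  then show "D = diag f" by (auto simp: diag_def)
  have "{i. f i \<noteq> 0} \<subseteq> fst ` D"
  proof
    fix i assume "i \<in> {i. f i \<noteq> 0}"
    then have "0 \<in> {j. (i, j) \<in> D}" unfolding eq by simp
    then show "i \<in> fst ` D" by force
  qed
  moreover have "f (Suc i) \<le> f i" for i
  proof -
    have "{..<f (Suc i)} \<subseteq> {..<f i}"
      unfolding eq [symmetric] using idealD [OF D(1), of "Suc i" _ i] by auto
    then show ?thesis by simp
  qed
  ultimately show "f \<in> shapes" unfolding shapes_def using D(2) finite_surj by blast
qed

lemma shape_support: "f \<in> shapes \<Longrightarrow> {i. f i \<noteq> 0} = {..<card {i. f i \<noteq> 0}}"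
proof -
  assume f: "f \<in> shapes"
  show ?thesis
  proof (cases "{i. f i \<noteq> 0} = {}")
    case False
    let ?m = "Max {i. f i \<noteq> 0}"
    have "f ?m \<noteq> 0" using Max_in [OF shapes_finite [OF f] False] by simp
    then have "{i. f i \<noteq> 0} = {..?m}"
      using Max_ge [OF shapes_finite [OF f]] shapes_antimono [OF f, of _ ?m] by fastforce
    then have "{i. f i \<noteq> 0} = {..<Suc ?m}" by (simp add: lessThan_Suc_atMost)
    then show ?thesis by (metis card_lessThan)
  qed simp
qed

lemma nth_default_shape_list: "f \<in> shapes \<Longrightarrow> nth_default 0 (shape_list f) = f"
proof
  fix i assume f: "f \<in> shapes"
  have "f i = 0" if "\<not> i < card {i. f i \<noteq> 0}"
    using shape_support [OF f] that by blast
  then show "nth_default 0 (shape_list f) i = f i" by (auto simp: nth_default_def shape_list_def)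
qed

lemma partition_shape_list: "f \<in> shapes \<Longrightarrow> is_partition (shape_list f)"
proof -
  assume f: "f \<in> shapes"
  have "f i \<noteq> 0" if "i < card {i. f i \<noteq> 0}" for i
    using that shape_support [OF f] by blast
  then show ?thesis
    unfolding is_partition_def shape_list_def sorted_wrt_iff_nth_less
    using shapes_antimono [OF f less_imp_le] by (auto simp only: length_map length_upt nth_map_upt
        set_map set_upt image_iff atLeastLessThan_iff diff_zero add_0) metis
qed

lemma diagram_eq: "diagram \<nu> = diag (nth_default 0 \<nu>)"
  by (auto simp: diagram_def diag_def nth_default_def split: if_splits)

lemma partition_shapes: "is_partition \<nu> \<Longrightarrow> nth_default 0 \<nu> \<in> shapes"
proof -
  assume "is_partition \<nu>"
  then have "nth_default 0 \<nu> (Suc i) \<le> nth_default 0 \<nu> i" for i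
    by (auto simp: is_partition_def nth_default_def sorted_wrt_iff_nth_less)
  moreover have "finite {i. nth_default 0 \<nu> i \<noteq> 0}"
    by (rule finite_subset [of _ "{..<length \<nu>}"]) (auto simp: nth_default_def split: if_splits)
  ultimately show ?thesis by (simp add: shapes_def)
qed

lemma shape_list_nth_default: "is_partition \<nu> \<Longrightarrow> shape_list (nth_default 0 \<nu>) = \<nu>"
proof -
  assume \<nu>: "is_partition \<nu>"
  have "{i. nth_default 0 \<nu> i \<noteq> 0} = {..<length \<nu>}"
    using \<nu> by (auto simp: nth_default_def is_partition_def in_set_conv_nth split: if_splits)
  then show ?thesis unfolding shape_list_def by (intro nth_equalityI) (auto simp: nth_default_def)
qed

lemma wt_nth_default: "wt (nth_default 0 \<nu>) = sum_list \<nu>"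
  by (subst wt_bound [of "length \<nu>"]) (auto simp: nth_default_def sum_list_sum_nth atLeast0LessThan)

lemma bij_partitions_shapes:
  "bij_betw (nth_default 0) {\<nu>. is_partition \<nu> \<and> sum_list \<nu> = n} {f \<in> shapes. wt f = n}"
  by (rule bij_betw_byWitness [of _ shape_list])
     (auto simp: shape_list_nth_default nth_default_shape_list partition_shapes wt_nth_default
        partition_shape_list simp flip: wt_nth_default)

lemma finite_shapes: "finite {f \<in> shapes. wt f = n}"
  using bij_betw_finite [OF bij_partitions_shapes] finite_partitions by blast

lemma is_skew_shape_ideal:
  "(\<exists>\<nu> \<mu>. is_skew_shape \<nu> \<mu> D) \<longleftrightarrow> (\<exists>R M. ideal R \<and> finite R \<and> ideal M \<and> M \<subseteq> R \<and> D = R - M)"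
proof
  assume "\<exists>\<nu> \<mu>. is_skew_shape \<nu> \<mu> D"
  then show "\<exists>R M. ideal R \<and> finite R \<and> ideal M \<and> M \<subseteq> R \<and> D = R - M"
    unfolding is_skew_shape_def diagram_eq
    by (metis ideal_diag finite_diag partition_shapes shapes_finite)
next
  assume "\<exists>R M. ideal R \<and> finite R \<and> ideal M \<and> M \<subseteq> R \<and> D = R - M"
  then obtain R M where *: "ideal R" "finite R" "ideal M" "M \<subseteq> R" "D = R - M" by blast
  obtain f g where "f \<in> shapes" "R = diag f" "g \<in> shapes" "M = diag g"
    using ideal_shape [OF *(1,2)] ideal_shape [OF *(3) finite_subset [OF *(4,2)]] by metis
  then have "is_skew_shape (shape_list f) (shape_list g) D"
    using * by (simp add: is_skew_shape_def diagram_eq nth_default_shape_list partition_shape_list)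
  then show "\<exists>\<nu> \<mu>. is_skew_shape \<nu> \<mu> D" by blast
qed

section \<open>Horizontal strips\<close>

text \<open>Interlacing, f 0 >= g 0 >= f 1 >= g 1 and so on: no column holds two boxes of the
  difference. The inequalities force both functions to be weakly decreasing, so that only finite
  support decides about being a shape (\<open>hstrip_shapes\<close>).\<close>

definition hstrip :: "(nat \<Rightarrow> nat) \<Rightarrow> (nat \<Rightarrow> nat) \<Rightarrow> bool" where
  "hstrip f g \<longleftrightarrow> (\<forall>i. g i \<le> f i \<and> f (Suc i) \<le> g i)"

lemma hstrip_shapes:
  assumes "hstrip f g"
  shows "f \<in> shapes \<longleftrightarrow> finite {i. f i \<noteq> 0}" "g \<in> shapes \<longleftrightarrow> finite {i. f i \<noteq> 0}"
proof -
  have le: "g i \<le> f i" "f (Suc i) \<le> g i" for i using assms by (simp_all add: hstrip_def)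
  have "f (Suc i) \<le> f i" "g (Suc i) \<le> g i" for i
    by (rule le_trans [OF le(2) le(1)], rule le_trans [OF le(1) le(2)])
  moreover have "finite {i. f i \<noteq> 0} \<longleftrightarrow> finite {i. g i \<noteq> 0}"
  proof
    assume g: "finite {i. g i \<noteq> 0}"
    have "{i. f i \<noteq> 0} \<subseteq> insert 0 (Suc ` {i. g i \<noteq> 0})"
    proof
      fix i assume "i \<in> {i. f i \<noteq> 0}"
      then show "i \<in> insert 0 (Suc ` {i. g i \<noteq> 0})" using le(2) [of "i - 1"] by (cases i) auto
    qed
    then show "finite {i. f i \<noteq> 0}" by (rule finite_subset) (simp add: g del: neq0_conv)
  next
    assume "finite {i. f i \<noteq> 0}"
    moreover have "{i. g i \<noteq> 0} \<subseteq> {i. f i \<noteq> 0}" 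
      using le(1) by (auto intro: less_le_trans)
    ultimately show "finite {i. g i \<noteq> 0}" by (rule rev_finite_subset)
  qed
  ultimately show "f \<in> shapes \<longleftrightarrow> finite {i. f i \<noteq> 0}" "g \<in> shapes \<longleftrightarrow> finite {i. f i \<noteq> 0}"
    by (auto simp: shapes_def)
qed

lemma hstrip_shapes_iff: "hstrip f g \<Longrightarrow> f \<in> shapes \<longleftrightarrow> g \<in> shapes"
  using hstrip_shapes by blast

lemma wt_mono: "f \<in> shapes \<Longrightarrow> (\<And>i. g i \<le> f i) \<Longrightarrow> wt g \<le> wt f"
proof -
  assume f: "f \<in> shapes" and le: "\<And>i. g i \<le> f i"
  obtain N where N: "\<And>i. N \<le> i \<Longrightarrow> f i = 0" using finite_support_bound [OF shapes_finite [OF f]] by blast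
  have "g i = 0" if "N \<le> i" for i using le [of i] N [OF that] by simp
  then show ?thesis using N by (simp add: wt_bound [of N] sum_mono le)
qed

definition up :: "(nat \<Rightarrow> nat) \<Rightarrow> nat \<Rightarrow> (nat \<Rightarrow> nat) set" where
  "up g m = {f \<in> shapes. hstrip f g \<and> wt f = wt g + m}"

definition down :: "(nat \<Rightarrow> nat) \<Rightarrow> nat \<Rightarrow> (nat \<Rightarrow> nat) set" where
  "down f m = {g \<in> shapes. hstrip f g \<and> wt f = wt g + m}"

lemma finite_up [simp]: "finite (up g m)"
  by (rule finite_subset [OF _ finite_shapes [of "wt g + m"]]) (auto simp: up_def)

lemma finite_down [simp]: "finite (down f m)"
  by (rule finite_subset [OF _ finite_shapes [of "wt f - m"]]) (auto simp: down_def)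

lemma zero_shapes [simp]: "(\<lambda>_. 0) \<in> shapes" by (simp add: shapes_def)

lemma wt_zero [simp]: "wt (\<lambda>_. 0) = 0" by (simp add: wt_def)

lemma wt_eq_0: "f \<in> shapes \<Longrightarrow> wt f = 0 \<longleftrightarrow> f = (\<lambda>_. 0)"
  using shapes_finite [of f] by (auto simp: wt_def fun_eq_iff)

section \<open>Jeu de taquin on two-letter tableaux\<close>

text \<open>An infimum of naturals is attained even over infinitely many indices. Infima are
  compared below through the numbers that bound them.\<close>

lemma nat_INF_le_iff: "(INF k. f k :: nat) \<le> n \<longleftrightarrow> (\<exists>k. f k \<le> n)"
proof
  have "(INF k. f k) \<in> range f" by (rule Inf_nat_def1) auto
  then show "(INF k. f k) \<le> n \<Longrightarrow> \<exists>k. f k \<le> n" by auto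
  show "\<exists>k. f k \<le> n \<Longrightarrow> (INF k. f k) \<le> n"
    by (meson bdd_below_bot cINF_lower2 UNIV_I)
qed

text \<open>Lowering the value at one index leaves the infimum alone if another index already does
  at least as well. A vertical slide changes the cuts in just this way.\<close>

lemma nat_INF_eqI:
  fixes f g :: "nat \<Rightarrow> nat"
  assumes "\<And>k. k \<noteq> k0 \<Longrightarrow> f k = g k" "f k0 \<le> g k0" "f l \<le> f k0" "l \<noteq> k0"
  shows "(INF k. f k) = (INF k. g k)"
proof -
  have "(\<exists>k. f k \<le> n) \<longleftrightarrow> (\<exists>k. g k \<le> n)" for n
  proof
    assume "\<exists>k. f k \<le> n"
    then obtain k where k: "f k \<le> n" ..
    show "\<exists>k. g k \<le> n"
    proof (cases "k = k0")
      case True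
      then show ?thesis using k assms(1) [OF assms(4)] assms(3) by (intro exI [of _ l]) simp
    qed (use k assms(1) in metis)
  next
    assume "\<exists>k. g k \<le> n"
    then obtain k where k: "g k \<le> n" ..
    then show "\<exists>k. f k \<le> n" using assms(1,2) by (metis le_trans)
  qed
  then show ?thesis by (metis nat_INF_le_iff order_antisym order_refl)
qed

section \<open>Two-letter fillings and their cuts\<close>

definition entries_mono :: "filling \<Rightarrow> bool" where
  "entries_mono T \<longleftrightarrow>
     (\<forall>i j j' a b. j < j' \<and> T (i, j) = Some a \<and> T (i, j') = Some b \<longrightarrow> a \<le> b) \<and>
     (\<forall>i i' j a b. i < i' \<and> T (i, j) = Some a \<and> T (i', j) = Some b \<longrightarrow> a < b)"

lemma entries_rowD: "entries_mono T \<Longrightarrow> T (i, j) = Some a \<Longrightarrow> T (i, j') = Some b \<Longrightarrow> j \<le> j' \<Longrightarrow> a \<le> b"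
  unfolding entries_mono_def by (metis le_neq_implies_less option.inject order_refl)

lemma entries_colD: "entries_mono T \<Longrightarrow> T (i, j) = Some a \<Longrightarrow> T (i', j) = Some b \<Longrightarrow> i < i' \<Longrightarrow> a < b"
  unfolding entries_mono_def by metis

definition skew_tab :: "(nat \<times> nat) set \<Rightarrow> (nat \<times> nat) set \<Rightarrow> filling \<Rightarrow> bool" where
  "skew_tab R M T \<longleftrightarrow>
     ideal R \<and> finite R \<and> ideal M \<and> M \<subseteq> R \<and> dom T = R - M \<and> entries_mono T"

text \<open>The state during a slide: \<open>R\<close> still contains the hole and \<open>M\<close>
  stays fixed; when the hole reaches the outer border it is dropped from \<open>R\<close>.\<close>

definition hole_tab :: "(nat \<times> nat) set \<Rightarrow> (nat \<times> nat) set \<Rightarrow> nat \<times> nat \<Rightarrow> filling \<Rightarrow> bool" where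
  "hole_tab R M c T \<longleftrightarrow>
     ideal R \<and> finite R \<and> ideal M \<and> M \<subseteq> R \<and> c \<in> R - M \<and> dom T = R - M - {c} \<and> entries_mono T"

lemma hole_tab_Some: "hole_tab R M c T \<Longrightarrow> b \<in> R - M \<Longrightarrow> b \<noteq> c \<Longrightarrow> \<exists>x. T b = Some x"
  unfolding hole_tab_def by blast

text \<open>For a tableau with letters \<open>p < q\<close>, the minimum of the cuts is the number of matched pairs in
  its reading word (\<open>q\<close> as opening, \<open>p\<close> as closing parenthesis).\<close>

definition letter_cut :: "nat \<Rightarrow> nat \<Rightarrow> filling \<Rightarrow> nat \<Rightarrow> nat" where
  "letter_cut p q T k = card {b. T b = Some p \<and> fst b < k} + card {b. T b = Some q \<and> k < fst b}"

definition pairs :: "nat \<Rightarrow> nat \<Rightarrow> filling \<Rightarrow> nat" where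
  "pairs p q T = (INF k. letter_cut p q T k)"

lemma finite_entries: "finite (dom T) \<Longrightarrow> finite {b. T b = Some x \<and> P b}"
  by (rule rev_finite_subset) auto

lemma finite_row: "finite (dom T) \<Longrightarrow> finite {c. T (r, c) = Some x}"
proof -
  assume "finite (dom T)"
  moreover have "{c. T (r, c) = Some x} \<subseteq> snd ` dom T" by force
  ultimately show ?thesis by (meson finite_imageI finite_subset)
qed

text \<open>Comparing the \<open>p\<close>s of row \<open>k\<close> with the \<open>q\<close>s of
  the next row decides which of two neighbouring cuts is smaller.\<close>

lemma letter_cut_Suc:
  assumes "finite (dom T)"
  shows "letter_cut p q T (Suc k) + card {c. T (Suc k, c) = Some q} = letter_cut p q T k + card {c. T (k, c) = Some p}"
proof -
  have row: "card {b. T b = Some x \<and> fst b = r} = card {c. T (r, c) = Some x}" for x r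
    by (rule bij_betw_same_card [of snd], rule bij_betw_byWitness [of _ "\<lambda>c. (r, c)"]) auto
  have "card {b. T b = Some p \<and> fst b < Suc k} =
      card ({b. T b = Some p \<and> fst b < k} \<union> {b. T b = Some p \<and> fst b = k})"
    by (rule arg_cong [of _ _ card]) auto
  also have "\<dots> = card {b. T b = Some p \<and> fst b < k} + card {b. T b = Some p \<and> fst b = k}"
    by (rule card_Un_disjoint) (auto intro: finite_entries assms)
  finally have 1: "card {b. T b = Some p \<and> fst b < Suc k} =
      card {b. T b = Some p \<and> fst b < k} + card {b. T b = Some p \<and> fst b = k}" .
  have "card {b. T b = Some q \<and> k < fst b} =
      card ({b. T b = Some q \<and> Suc k < fst b} \<union> {b. T b = Some q \<and> fst b = Suc k})"
    by (rule arg_cong [of _ _ card]) auto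
  also have "\<dots> = card {b. T b = Some q \<and> Suc k < fst b} + card {b. T b = Some q \<and> fst b = Suc k}"
    by (rule card_Un_disjoint) (auto intro: finite_entries assms)
  finally have 2: "card {b. T b = Some q \<and> k < fst b} =
      card {b. T b = Some q \<and> Suc k < fst b} + card {b. T b = Some q \<and> fst b = Suc k}" .
  show ?thesis using 1 2 by (simp add: letter_cut_def row)
qed

text \<open>Corrections are added on both sides, so that comparisons of cuts stay linear over the
  naturals.\<close>

lemma card_entries_move:
  assumes "finite (dom T)" "T d = Some a" "T c = None"
  shows "card {b. (T(c := Some a, d := None)) b = Some x \<and> P b} + (if x = a \<and> P d then 1 else 0) =
         card {b. T b = Some x \<and> P b} + (if x = a \<and> P c then 1 else 0)"
    (is "card {b. ?T b = _ \<and> _} + _ = _")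
proof (cases "x = a")
  case False
  then have "{b. ?T b = Some x \<and> P b} = {b. T b = Some x \<and> P b}"
    using assms by auto
  then show ?thesis using False by simp
next
  case True
  let ?E = "{b. T b = Some a \<and> P b \<and> b \<noteq> d}"
  have cd: "c \<noteq> d" using assms by auto
  have fin: "finite ?E" using finite_entries [OF assms(1), of a "\<lambda>b. P b \<and> b \<noteq> d"] .
  have "{b. ?T b = Some a \<and> P b} = (if P c then insert c ?E else ?E)"
    using assms cd by auto
  then have 1: "card {b. ?T b = Some a \<and> P b} =
      card ?E + (if P c then 1 else 0)"
    using fin assms by (simp add: card_insert_if)
  have "{b. T b = Some a \<and> P b} = (if P d then insert d ?E else ?E)" using assms by auto
  then have "card {b. T b = Some a \<and> P b} = card ?E + (if P d then 1 else 0)"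
    using fin by (simp add: card_insert_if)
  then show ?thesis using True 1 by simp
qed

section \<open>A single move of the hole\<close>

text \<open>Away from the filled box \<open>U\<close> has no entries except those of
  \<open>T\<close>, so every new comparison involves the box (i, j).\<close>

lemma entries_mono_fill:
  assumes mono: "entries_mono T" and other: "\<And>z u. U z = Some u \<Longrightarrow> z \<noteq> (i, j) \<Longrightarrow> T z = Some u"
    and a: "U (i, j) = Some a"
    and row: "\<And>y b. y < j \<Longrightarrow> U (i, y) = Some b \<Longrightarrow> b \<le> a" "\<And>y b. j < y \<Longrightarrow> U (i, y) = Some b \<Longrightarrow> a \<le> b"
    and col: "\<And>x b. x < i \<Longrightarrow> U (x, j) = Some b \<Longrightarrow> b < a" "\<And>x b. i < x \<Longrightarrow> U (x, j) = Some b \<Longrightarrow> a < b"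
  shows "entries_mono U"
  unfolding entries_mono_def
proof (intro conjI allI impI)
  fix x y y' u v assume *: "y < y' \<and> U (x, y) = Some u \<and> U (x, y') = Some v"
  show "u \<le> v"
  proof (cases "x = i \<and> (y = j \<or> y' = j)")
    case True
    then show ?thesis using * a row(1) [of y u] row(2) [of y' v] by auto
  next
    case False
    then have "T (x, y) = Some u" "T (x, y') = Some v" using * other by blast+
    then show ?thesis using entries_rowD [OF mono, of x y u y' v] * by simp
  qed
next
  fix x x' y u v assume *: "x < x' \<and> U (x, y) = Some u \<and> U (x', y) = Some v"
  show "u < v"
  proof (cases "y = j \<and> (x = i \<or> x' = i)")
    case True
    then show ?thesis using * a col(1) [of x u] col(2) [of x' v] by auto
  next
    case False
    then have "T (x, y) = Some u" "T (x', y) = Some v" using * other by blast+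
    then show ?thesis using entries_colD [OF mono, of x y u x' v] * by simp
  qed
qed

lemma hole_tab_right:
  assumes H: "hole_tab R M (i, j) T" and a: "T (i, Suc j) = Some a"
    and lt: "\<And>b. T (Suc i, j) = Some b \<Longrightarrow> a < b"
  shows "hole_tab R M (i, Suc j) (T((i, j) := Some a, (i, Suc j) := None))"
proof -
  let ?T = "T((i, j) := Some a, (i, Suc j) := None)"
  have R: "ideal R" and M: "ideal M" and c: "(i, j) \<in> R - M" and d: "dom T = R - M - {(i, j)}"
    and mono: "entries_mono T" using H by (auto simp: hole_tab_def)
  have d': "(i, Suc j) \<in> R - M" using d a by blast
  have left: "b \<le> a" if "y < j" "T (i, y) = Some b" for y b
    by (rule entries_rowD [OF mono that(2) a]) (use that in simp)
  have rght: "a \<le> b" if "j < y" "T (i, y) = Some b" for y b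
    by (rule entries_rowD [OF mono a that(2)]) (use that in simp)
  \<comment> \<open>The box to the right of (x, j) is filled because it lies above (i, Suc j); the
    comparison goes through it, first right and then down to \<open>a\<close>.\<close>
  have above: "b < a" if "x < i" "T (x, j) = Some b" for x b
  proof -
    have "(x, j) \<in> R - M" using that(2) d by blast
    then have "(x, Suc j) \<in> R - M"
      using idealD [OF M, of x "Suc j" x j] idealD [OF R, of i "Suc j" x "Suc j"] d' that(1) by auto
    then obtain b' where b': "T (x, Suc j) = Some b'"
      using hole_tab_Some [OF H, of "(x, Suc j)"] that by auto
    have "b \<le> b'" by (rule entries_rowD [OF mono that(2) b']) simp
    also have "b' < a" by (rule entries_colD [OF mono b' a that(1)])
    finally show ?thesis .
  qed
  have below: "a < b" if "i < x" "T (x, j) = Some b" for x b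
  proof -
    have "(x, j) \<in> R" using that(2) d by blast
    then have "(Suc i, j) \<in> R - M"
      using idealD [OF M, of "Suc i" j i j] idealD [OF R, of x j "Suc i" j] c that(1) by auto
    then obtain b' where b': "T (Suc i, j) = Some b'"
      using hole_tab_Some [OF H, of "(Suc i, j)"] that by auto
    have "b' \<le> b"
      using entries_colD [OF mono b' that(2)] b' that by (cases "x = Suc i") auto
    then show ?thesis using lt [OF b'] by simp
  qed
  have other: "T z = Some u" if "?T z = Some u" "z \<noteq> (i, j)" for z u
    using that by (simp split: if_splits)
  have "entries_mono ?T"
    by (rule entries_mono_fill [where i = i and j = j and a = a, OF mono other]) (use left rght above below in \<open>auto split: if_splits\<close>)
  moreover have "dom ?T = R - M - {(i, Suc j)}"
    unfolding dom_fun_upd d using c d' by (simp, blast)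
  ultimately show ?thesis using H d' by (simp add: hole_tab_def)
qed

lemma hole_tab_down:
  assumes H: "hole_tab R M (i, j) T" and b: "T (Suc i, j) = Some b"
    and le: "\<And>a. T (i, Suc j) = Some a \<Longrightarrow> b \<le> a"
  shows "hole_tab R M (Suc i, j) (T((i, j) := Some b, (Suc i, j) := None))"
    (is "hole_tab R M _ ?T")
    and "\<And>y a. j < y \<Longrightarrow> T (i, y) = Some a \<Longrightarrow> b \<le> a"
proof -
  have R: "ideal R" and M: "ideal M" and c: "(i, j) \<in> R - M" and d: "dom T = R - M - {(i, j)}"
    and mono: "entries_mono T" using H by (auto simp: hole_tab_def)
  have d': "(Suc i, j) \<in> R - M" using d b by blast
  have above: "a < b" if "x < i" "T (x, j) = Some a" for x a
    by (rule entries_colD [OF mono that(2) b]) (use that in simp)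
  have below: "b < a" if "i < x" "?T (x, j) = Some a" for x a
    using entries_colD [OF mono b, of x a] that by (auto split: if_splits)
  have left: "a \<le> b" if "y < j" "T (i, y) = Some a" for y a
  proof -
    have "(i, y) \<in> R - M" using that(2) d by blast
    then have "(Suc i, y) \<in> R - M"
      using idealD [OF M, of "Suc i" y i y] idealD [OF R, of "Suc i" j "Suc i" y] d' that(1) by auto
    then obtain a' where a': "T (Suc i, y) = Some a'"
      using hole_tab_Some [OF H, of "(Suc i, y)"] that by auto
    have "a < a'" by (rule entries_colD [OF mono that(2) a']) simp
    also have "a' \<le> b" by (rule entries_rowD [OF mono a' b]) (use that in simp)
    finally show ?thesis by simp
  qed
  show rght: "b \<le> a" if "j < y" "T (i, y) = Some a" for y a
  proof -
    have "(i, y) \<in> R" using that(2) d by blast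
    then have "(i, Suc j) \<in> R - M"
      using idealD [OF M, of i "Suc j" i j] idealD [OF R, of i y i "Suc j"] c that(1) by auto
    then obtain a' where a': "T (i, Suc j) = Some a'"
      using hole_tab_Some [OF H, of "(i, Suc j)"] that by auto
    have "a' \<le> a" by (rule entries_rowD [OF mono a' that(2)]) (use that in simp)
    then show ?thesis using le [OF a'] by simp
  qed
  have other: "T z = Some u" if "?T z = Some u" "z \<noteq> (i, j)" for z u
    using that by (simp split: if_splits)
  have "entries_mono ?T"
    by (rule entries_mono_fill [where i = i and j = j and a = b, OF mono other]) (use left rght above below in \<open>auto split: if_splits\<close>)
  moreover have "dom ?T = R - M - {(Suc i, j)}"
    unfolding dom_fun_upd d using c d' by (simp, blast)
  ultimately show "hole_tab R M (Suc i, j) ?T" using H d' by (simp add: hole_tab_def)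
qed

lemma ran_fun_upd_subset: "ran T \<subseteq> A \<Longrightarrow> a \<in> A \<Longrightarrow> ran (T(c := Some a, d := None)) \<subseteq> A"
  by (auto simp: ran_def)

text \<open>A vertical move changes a single cut by one, and a neighbouring cut does not exceed its
  smaller value: every \<open>q\<close> of the lower row has a \<open>p\<close> above it (if the
  moving letter is \<open>p\<close>), or every \<open>p\<close> of the upper row has a
  \<open>q\<close> below it (if it is \<open>q\<close>).\<close>

lemma pairs_down:
  assumes H: "hole_tab R M (i, j) T" and b: "T (Suc i, j) = Some b"
    and le: "\<And>a. T (i, Suc j) = Some a \<Longrightarrow> b \<le> a"
    and ran: "ran T \<subseteq> {p, q}" and pq: "p < q"
  shows "pairs p q (T((i, j) := Some b, (Suc i, j) := None)) = pairs p q T"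
    (is "pairs p q ?T = _")
proof -
  have R: "ideal R" and M: "ideal M" and c: "(i, j) \<in> R - M" and d: "dom T = R - M - {(i, j)}"
    and mono: "entries_mono T" and fin: "finite (dom T)" using H by (auto simp: hole_tab_def)
  have d': "(Suc i, j) \<in> R - M" using d b by blast
  have letters: "x = p \<or> x = q" if "T y = Some x" for x y using ran ranI [of T y x] that by auto
  have none: "T (i, j) = None" using d by blast
  note move = card_entries_move [OF fin b none]
  have cnt: "letter_cut p q ?T k + (if b = p \<and> Suc i < k then 1 else 0) + (if b = q \<and> k < Suc i then 1 else 0)
      = letter_cut p q T k + (if b = p \<and> i < k then 1 else 0) + (if b = q \<and> k < i then 1 else 0)" for k
    using move [of p "\<lambda>b. fst b < k"] move [of q "\<lambda>b. k < fst b"] unfolding letter_cut_def fst_conv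
    by (simp only: eq_commute [of b])
  have fin': "finite (dom ?T)" by (rule finite_subset [of _ "insert (i, j) (dom T)"]) (use fin in auto)
  show ?thesis
  proof (cases "b = p")
    case True
    \<comment> \<open>The lower row has \<open>p\<close> in column \<open>j\<close>, so its
      \<open>q\<close>s lie further right, where the box above is filled and must hold a smaller
      letter.\<close>
    have "{c. T (Suc i, c) = Some q} \<subseteq> {c. T (i, c) = Some p}"
    proof
      fix c' assume "c' \<in> {c. T (Suc i, c) = Some q}"
      then have q: "T (Suc i, c') = Some q" by simp
      have "\<not> c' \<le> j" using entries_rowD [OF mono q b] True pq by auto
      then have "(i, c') \<in> R - M"
        using idealD [OF M, of i c' i j] idealD [OF R, of "Suc i" c' i c'] c q d by auto
    then obtain x where x: "T (i, c') = Some x"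
      using hole_tab_Some [OF H, of "(i, c')"] \<open>\<not> c' \<le> j\<close> by auto
      have "x < q" by (rule entries_colD [OF mono x q]) simp
      then have "x = p" using letters [OF x] by auto
      then show "c' \<in> {c. T (i, c) = Some p}" using x by simp
    qed
    moreover have "finite {c. T (i, c) = Some p}" by (rule finite_row [OF fin])
    ultimately have "card {c. T (Suc i, c) = Some q} \<le> card {c. T (i, c) = Some p}"
      by (rule card_mono [rotated])
    then have "letter_cut p q T i \<le> letter_cut p q T (Suc i)" using letter_cut_Suc [OF fin, of p q i] by linarith
    moreover have "letter_cut p q T k = letter_cut p q ?T k" if "k \<noteq> Suc i" for k
      using cnt [of k] that True pq by (auto split: if_splits)
    moreover have "letter_cut p q T (Suc i) \<le> letter_cut p q ?T (Suc i)"
      using cnt [of "Suc i"] True pq by simp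
    ultimately show ?thesis unfolding pairs_def by (intro nat_INF_eqI [of "Suc i" _ _ i, symmetric]) auto
  next
    case False
    then have bq: "b = q" using letters [OF b] by simp
    \<comment> \<open>After the move the upper row has \<open>q\<close> from column \<open>j\<close>
      on, so its \<open>p\<close>s lie further left, where the box below is filled and must hold a
      larger letter.\<close>
    have "{c. ?T (i, c) = Some p} \<subseteq> {c. ?T (Suc i, c) = Some q}"
    proof
      fix c' assume "c' \<in> {c. ?T (i, c) = Some p}"
      then have p: "T (i, c') = Some p" and ne: "c' \<noteq> j" using bq pq by (auto split: if_splits)
      have "\<not> j < c'" using hole_tab_down(2) [OF H b le, of c' p] p bq pq by auto
      then have "(Suc i, c') \<in> R - M"
        using idealD [OF M, of "Suc i" c' i c'] idealD [OF R, of "Suc i" j "Suc i" c'] p d d' by auto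
    then obtain x where x: "T (Suc i, c') = Some x"
      using hole_tab_Some [OF H, of "(Suc i, c')"] by auto
      have "p < x" by (rule entries_colD [OF mono p x]) simp
      then have "x = q" using letters [OF x] by auto
      then show "c' \<in> {c. ?T (Suc i, c) = Some q}" using x ne by simp
    qed
    moreover have "finite {c. ?T (Suc i, c) = Some q}" by (rule finite_row [OF fin'])
    ultimately have "card {c. ?T (i, c) = Some p} \<le> card {c. ?T (Suc i, c) = Some q}"
      by (rule card_mono [rotated])
    then have "letter_cut p q ?T (Suc i) \<le> letter_cut p q ?T i" using letter_cut_Suc [OF fin', of p q i] by linarith
    moreover have "letter_cut p q ?T k = letter_cut p q T k" if "k \<noteq> i" for k
      using cnt [of k] that bq pq by (auto split: if_splits)
    moreover have "letter_cut p q ?T i \<le> letter_cut p q T i"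
      using cnt [of i] bq pq by simp
    ultimately show ?thesis unfolding pairs_def by (intro nat_INF_eqI [of i _ _ "Suc i"]) auto
  qed
qed

text \<open>A cut sees only the row of an entry, and a horizontal move stays in its row.\<close>

lemma pairs_right:
  assumes H: "hole_tab R M (i, j) T" and a: "T (i, Suc j) = Some a"
  shows "pairs p q (T((i, j) := Some a, (i, Suc j) := None)) = pairs p q T"
    (is "pairs p q ?T = _")
proof -
  have "finite (dom T)" "T (i, j) = None" using H by (auto simp: hole_tab_def)
  note move = card_entries_move [OF this(1) a this(2)]
  have "letter_cut p q ?T = letter_cut p q T"
  proof
    fix k show "letter_cut p q ?T k = letter_cut p q T k"
      using move [of p "\<lambda>b. fst b < k"] move [of q "\<lambda>b. k < fst b"] unfolding letter_cut_def fst_conv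
      by linarith
  qed
  then show ?thesis by (simp add: pairs_def)
qed

section \<open>Invariants and existence of slides and rectifications\<close>

lemma ideal_remove_corner:
  assumes "ideal R" "(Suc i, j) \<notin> R" "(i, Suc j) \<notin> R"
  shows "ideal (R - {(i, j)})"
  unfolding ideal_def
proof (intro allI impI)
  fix x y x' y' assume *: "(x, y) \<in> R - {(i, j)}" "x' \<le> x" "y' \<le> y"
  have "(x', y') \<noteq> (i, j)"
  proof
    assume eq: "(x', y') = (i, j)"
    then have "Suc i \<le> x \<or> Suc j \<le> y" using * by (auto simp: Suc_le_eq)
    then show False
      using idealD [OF assms(1), of x y "Suc i" j] idealD [OF assms(1), of x y i "Suc j"] * assms eq by auto
  qed
  then show "(x', y') \<in> R - {(i, j)}" using idealD [OF assms(1)] * by blast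
qed

lemma jdt_slide_invariant:
  assumes "jdt_slide c T U" "hole_tab R M c T"
  shows "(\<exists>R'. skew_tab R' M U) \<and> (\<forall>x. card {b. U b = Some x} = card {b. T b = Some x}) \<and>
    (ran T \<subseteq> {p, q} \<longrightarrow> p < q \<longrightarrow> pairs p q U = pairs p q T)"
  using assms
proof (induction rule: jdt_slide.induct)
  case (stop T i j)
  then have H: "ideal R" "finite R" "ideal M" "M \<subseteq> R" "(i, j) \<in> R - M" "dom T = R - M - {(i, j)}"
    "entries_mono T" by (auto simp: hole_tab_def)
  have "(Suc i, j) \<notin> M" "(i, Suc j) \<notin> M"
    using H(5) idealD [OF H(3), of "Suc i" j i j] idealD [OF H(3), of i "Suc j" i j] by auto
  then have "(Suc i, j) \<notin> R" "(i, Suc j) \<notin> R" using H(6) stop.hyps by (auto simp: dom_def set_eq_iff) (metis Suc_n_not_n option.distinct(1))+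
  from ideal_remove_corner [OF H(1) this] have "skew_tab (R - {(i, j)}) M T"
    unfolding skew_tab_def using H by auto
  then show ?case by auto
next
  case (right T i j a U)
  let ?T = "T((i, j) := Some a, (i, Suc j) := None)"
  have fin: "finite (dom T)" and none: "T (i, j) = None" using right.prems by (auto simp: hole_tab_def)
  have "hole_tab R M (i, Suc j) ?T" by (rule hole_tab_right [OF right.prems right.hyps(1,2)])
  note IH = right.IH [OF this]
  have cnt: "card {b. ?T b = Some x} = card {b. T b = Some x}" for x
    using card_entries_move [OF fin right.hyps(1) none, of x "\<lambda>_. True"] by simp
  have mem: "a \<in> ran T" using right.hyps(1) by (rule ranI)
  have pr: "pairs p q ?T = pairs p q T" if "ran T \<subseteq> {p, q}" "p < q" by (rule pairs_right [OF right.prems right.hyps(1)])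
  have rn: "ran ?T \<subseteq> {p, q}" if "ran T \<subseteq> {p, q}"
    by (rule ran_fun_upd_subset [OF that]) (use that mem in blast)
  show ?case
  proof (intro conjI allI impI)
    show "\<exists>R'. skew_tab R' M U" using IH by blast
    show "card {b. U b = Some x} = card {b. T b = Some x}" for x
      using conjunct1 [OF conjunct2 [OF IH], THEN spec, of x] cnt [of x] by (rule trans)
    assume *: "ran T \<subseteq> {p, q}" "p < q"
    show "pairs p q U = pairs p q T"
      by (rule trans [OF conjunct2 [OF conjunct2 [OF IH], THEN mp, THEN mp, OF rn [OF *(1)] *(2)] pr [OF *]])
  qed
next
  case (down T i j b U)
  let ?T = "T((i, j) := Some b, (Suc i, j) := None)"
  have fin: "finite (dom T)" and none: "T (i, j) = None" using down.prems by (auto simp: hole_tab_def)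
  have "hole_tab R M (Suc i, j) ?T" by (rule hole_tab_down(1) [OF down.prems down.hyps(1,2)])
  note IH = down.IH [OF this]
  have cnt: "card {c. ?T c = Some x} = card {c. T c = Some x}" for x
    using card_entries_move [OF fin down.hyps(1) none, of x "\<lambda>_. True"] by simp
  have mem: "b \<in> ran T" using down.hyps(1) by (rule ranI)
  have pr: "pairs p q ?T = pairs p q T" if "ran T \<subseteq> {p, q}" "p < q"
    using pairs_down [OF down.prems down.hyps(1,2)] that by blast
  have rn: "ran ?T \<subseteq> {p, q}" if "ran T \<subseteq> {p, q}"
    by (rule ran_fun_upd_subset [OF that]) (use that mem in blast)
  show ?case
  proof (intro conjI allI impI)
    show "\<exists>R'. skew_tab R' M U" using IH by blast
    show "card {b. U b = Some x} = card {b. T b = Some x}" for x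
      using conjunct1 [OF conjunct2 [OF IH], THEN spec, of x] cnt [of x] by (rule trans)
    assume *: "ran T \<subseteq> {p, q}" "p < q"
    show "pairs p q U = pairs p q T"
      by (rule trans [OF conjunct2 [OF conjunct2 [OF IH], THEN mp, THEN mp, OF rn [OF *(1)] *(2)] pr [OF *]])
  qed
qed

text \<open>Termination: each move takes the hole to the next antidiagonal, so that fewer boxes of
  \<open>R\<close> lie beyond it.\<close>

lemma jdt_slide_exists:
  assumes "hole_tab R M c T"
  shows "\<exists>U. jdt_slide c T U"
  using assms
proof (induction "card {b \<in> R. fst c + snd c < fst b + snd b}" arbitrary: c T rule: less_induct)
  case less
  obtain i j where c: "c = (i, j)" by (cases c)
  have H: "hole_tab R M (i, j) T" using less.prems c by simp
  have fin: "finite R" and dom: "dom T \<subseteq> R" using H by (auto simp: hole_tab_def)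
  have card: "card {b \<in> R. fst d + snd d < fst b + snd b} < card {b \<in> R. fst c + snd c < fst b + snd b}"
    if "d \<in> R" "fst c + snd c < fst d + snd d" for d
  proof (rule psubset_card_mono)
    let ?S = "\<lambda>c. {b \<in> R. fst c + snd c < fst b + snd b}"
    have "?S d \<subseteq> ?S c" using that(2) by (auto intro: less_trans [of "fst c + snd c"])
    moreover have "d \<in> ?S c" "d \<notin> ?S d" using that by simp_all
    ultimately show "?S d \<subset> ?S c" by blast
  qed (use fin in simp)
  show ?case
  proof (cases "\<exists>a. T (i, Suc j) = Some a \<and> (\<forall>b. T (Suc i, j) = Some b \<longrightarrow> a < b)")
    case True
    then obtain a where a: "T (i, Suc j) = Some a" "\<And>b. T (Suc i, j) = Some b \<Longrightarrow> a < b" by blast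
    then have "(i, Suc j) \<in> R" using dom by blast
    then have "\<exists>U. jdt_slide (i, Suc j) (T((i, j) := Some a, (i, Suc j) := None)) U"
      by (intro less.hyps card hole_tab_right H a) (auto simp: c)
    then show ?thesis unfolding c using jdt_slide.right [of T i j a] a by blast
  next
    case False
    show ?thesis
    proof (cases "T (Suc i, j)")
      case None
      then have "T (i, Suc j) = None" using False by (cases "T (i, Suc j)") auto
      then show ?thesis unfolding c using jdt_slide.stop None by blast
    next
      case (Some b)
      have le: "b \<le> a" if "T (i, Suc j) = Some a" for a using False Some that by (auto simp: not_less)
      have "(Suc i, j) \<in> R" using Some dom by blast
      then have "\<exists>U. jdt_slide (Suc i, j) (T((i, j) := Some b, (Suc i, j) := None)) U"
        by (intro less.hyps card hole_tab_down(1) H Some le) (auto simp: c)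
      then show ?thesis unfolding c using jdt_slide.down [of T i j b] Some le by blast
    qed
  qed
qed

lemma skew_tab_hole:
  assumes "skew_tab R D T" "inner_corner D c"
  shows "hole_tab R (D - {c}) c T"
proof -
  obtain i j where "c = (i, j)" by (cases c)
  then have "ideal (D - {c})"
    using assms ideal_remove_corner [of D i j] by (simp add: skew_tab_def inner_corner_def)
  then show ?thesis using assms by (auto simp: skew_tab_def hole_tab_def inner_corner_def)
qed

lemma ran_subset_of_counts:
  assumes fin: "finite (dom U)" and eq: "\<forall>x. card {b. U b = Some x} = card {b. T b = Some x}"
  shows "ran U \<subseteq> ran T"
proof
  fix x assume "x \<in> ran U"
  then have "{b. U b = Some x} \<noteq> {}" by (auto simp: ran_def)
  then have "card {b. T b = Some x} \<noteq> 0"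
    using finite_entries [OF fin, of x "\<lambda>_. True"] eq by (metis (no_types, lifting) Collect_cong card_0_eq)
  then have "{b. T b = Some x} \<noteq> {}" by (metis card.empty)
  then show "x \<in> ran T" by (auto simp: ran_def)
qed

lemma rectifies_invariant:
  assumes "rectifies D T U" "skew_tab R D T"
  shows "(\<exists>R'. skew_tab R' {} U) \<and> (\<forall>x. card {b. U b = Some x} = card {b. T b = Some x}) \<and>
    (ran T \<subseteq> {p, q} \<longrightarrow> p < q \<longrightarrow> pairs p q U = pairs p q T)"
  using assms
proof (induction arbitrary: R rule: rectifies.induct)
  case (straight T)
  then show ?case by auto
next
  case (slide D c T T' U)
  note H = skew_tab_hole [OF slide.prems slide.hyps(1)]
  note inv = jdt_slide_invariant [OF slide.hyps(2) H, of p q]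
  then obtain R' where R': "skew_tab R' (D - {c}) T'" by blast
  have "finite (dom T')" using R' by (simp add: skew_tab_def)
  then have "ran T' \<subseteq> {p, q}" if "ran T \<subseteq> {p, q}" using ran_subset_of_counts inv that by blast
  then show ?case using inv slide.IH [OF R'] by auto
qed

lemma rectifies_exists:
  assumes "skew_tab R D T"
  shows "\<exists>U. rectifies D T U"
  using assms
proof (induction "card D" arbitrary: D T R)
  case 0
  then have "D = {}" by (auto simp: skew_tab_def finite_subset)
  then show ?case using rectifies.straight by blast
next
  case (Suc n)
  have fin: "finite D" using Suc.prems by (auto simp: skew_tab_def intro: finite_subset)
  have ne: "D \<noteq> {}" using Suc.hyps(2) by auto
  \<comment> \<open>A box of \<open>D\<close> on the last antidiagonal that meets \<open>D\<close>
    has no neighbour in \<open>D\<close> to the right or below, hence is an inner corner.\<close>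
  let ?m = "Max ((\<lambda>b. fst b + snd b) ` D)"
  have "?m \<in> (\<lambda>b. fst b + snd b) ` D" using fin ne by (intro Max_in) auto
  then obtain c where c: "c \<in> D" "fst c + snd c = ?m" by auto
  have "b \<notin> D" if "fst c + snd c < fst b + snd b" for b
    using Max_ge [OF finite_imageI [OF fin, of "\<lambda>b. fst b + snd b"], of "fst b + snd b"] that c(2) by auto
  then have corner: "inner_corner D c" using c(1) by (simp add: inner_corner_def)
  note H = skew_tab_hole [OF Suc.prems corner]
  obtain T' where T': "jdt_slide c T T'" using jdt_slide_exists [OF H] by blast
  obtain R' where R': "skew_tab R' (D - {c}) T'" using jdt_slide_invariant [OF T' H] by blast
  have "n = card (D - {c})" using Suc.hyps(2) c(1) by simp
  then obtain U where "rectifies (D - {c}) T' U" using Suc.hyps(1) [OF _ R'] by blast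
  then show ?case using rectifies.slide [OF corner T'] by blast
qed

text \<open>The choice in \<open>rect\<close> concerns the presentation of the domain as a
  difference of diagrams as well as the slides. Any presentation of \<open>dom T\<close> turns
  \<open>T\<close> into a \<open>skew_tab\<close>, so the invariants apply to the chosen
  one.\<close>

lemma rect_invariant:
  assumes T: "skew_tab R M T"
  shows "(\<exists>f\<in>shapes. dom (rect T) = diag f) \<and> entries_mono (rect T) \<and>
    (\<forall>x. card {b. rect T b = Some x} = card {b. T b = Some x}) \<and>
    (ran T \<subseteq> {p, q} \<longrightarrow> p < q \<longrightarrow> pairs p q (rect T) = pairs p q T)"
proof -
  have "\<exists>\<nu> \<mu>. is_skew_shape \<nu> \<mu> (dom T)"
    unfolding is_skew_shape_ideal using T by (auto simp: skew_tab_def)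
  then obtain \<nu> \<mu> where sk: "is_skew_shape \<nu> \<mu> (dom T)" by blast
  have tab: "skew_tab (diagram \<nu>) (diagram \<mu>) T" if "is_skew_shape \<nu> \<mu> (dom T)" for \<nu> \<mu>
    using that T partition_shapes
    by (auto simp: skew_tab_def is_skew_shape_def diagram_eq ideal_diag)
  have "\<exists>U. rectifies (diagram \<mu>) T U" using rectifies_exists [OF tab [OF sk]] .
  then have "\<exists>U \<nu> \<mu>. is_skew_shape \<nu> \<mu> (dom T) \<and> rectifies (diagram \<mu>) T U" using sk by blast
  from someI_ex [OF this] obtain \<nu> \<mu>
    where *: "is_skew_shape \<nu> \<mu> (dom T)" "rectifies (diagram \<mu>) T (rect T)"
    unfolding rect_def by blast
  note inv = rectifies_invariant [OF *(2) tab [OF *(1)], of p q]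
  then obtain R' where R': "skew_tab R' {} (rect T)" by blast
  then have "ideal R'" "finite R'" by (auto simp: skew_tab_def)
  then obtain f where "f \<in> shapes" "R' = diag f" by (rule ideal_shape)
  then show ?thesis using inv R' by (auto simp: skew_tab_def)
qed

section \<open>The rectified shape and the two sign indices\<close>

text \<open>A straight tableau with letters \<open>p < q\<close> has all its \<open>p\<close>s in the first row, so its cut below the
  first row is the length of the second row.\<close>

lemma rect_two_letters:
  assumes T: "skew_tab R M T" and ran: "ran T \<subseteq> {p, q}" and pq: "p < q"
    and cp: "card {b. T b = Some p} = m" and cq: "card {b. T b = Some q} = m"
  shows "pairs p q T \<le> m \<and>
    dom (rect T) = diag (\<lambda>i. if i = 0 then 2 * m - pairs p q T else if i = 1 then pairs p q T else 0)"
proof -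
  define U where "U = rect T"
  note inv = rect_invariant [OF T, of p q, folded U_def]
  then obtain f where f: "f \<in> shapes" "dom U = diag f" by blast
  have mono: "entries_mono U" using inv by blast
  have fin: "finite (dom U)" using f by simp
  have "ran U \<subseteq> {p, q}" using ran_subset_of_counts [OF fin] inv ran by blast
  then have letters: "x = p \<or> x = q" if "U b = Some x" for b x using ranI [of U b x, OF that] by blast
  have inside: "\<exists>x. U (r, c) = Some x" if "c < f r" for r c
  proof -
    have "(r, c) \<in> dom U" using f(2) that by simp
    then show ?thesis by blast
  qed
  have row1: "U (Suc 0, c) = Some q" if lt: "c < f 1" for c
  proof -
    have "c < f 0" using lt shapes_antimono [OF f(1), of 0 1] by simp
    then obtain x where x: "U (0, c) = Some x" using inside by blast
    obtain y where y: "U (Suc 0, c) = Some y" using inside [of c "Suc 0"] lt by auto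
    show ?thesis using entries_colD [OF mono x y] letters [OF x] letters [OF y] pq y by auto
  qed
  \<comment> \<open>The second row consists of the larger letter, so a third row would need a third
    letter.\<close>
  have f2: "f 2 = 0"
  proof (rule ccontr)
    assume "f 2 \<noteq> 0"
    then have "0 < f 1" using shapes_antimono [OF f(1), of 1 2] by simp
    obtain y where y: "U (2, 0) = Some y" using inside [of 0 2] \<open>f 2 \<noteq> 0\<close> by auto
    show False using entries_colD [OF mono row1 [OF \<open>0 < f 1\<close>] y] letters [OF y] pq by auto
  qed
  have f_ge2: "f i = 0" if "2 \<le> i" for i using shapes_antimono [OF f(1) that] f2 by simp
  have inrow: "c < f r" if "U (r, c) = Some x" for r c x
  proof -
    have "(r, c) \<in> dom U" using that by blast
    then show ?thesis unfolding f(2) by simp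
  qed
  have p_row0: "r = 0" if "U (r, c) = Some p" for r c
  proof (rule ccontr)
    assume "r \<noteq> 0"
    moreover have "r < 2" using inrow [OF that] f_ge2 [of r] by (cases "r < 2") (auto simp: not_less)
    ultimately have "r = 1" by simp
    then show False using row1 [of c] inrow [OF that] that pq by simp
  qed
  have cards: "card {b. U b = Some p} = m" "card {b. U b = Some q} = m" using inv cp cq by auto
  have cut0: "letter_cut p q U 0 = f 1"
  proof -
    have "{b. U b = Some q \<and> 0 < fst b} = {1} \<times> {..<f 1}"
    proof (intro equalityI subsetI)
      fix b assume b: "b \<in> {b. U b = Some q \<and> 0 < fst b}"
      obtain r c where rc: "b = (r, c)" by (cases b)
      then have "c < f r" "r \<noteq> 0" using b inrow [of r c q] by auto
      moreover have "r < 2" using \<open>c < f r\<close> f_ge2 [of r] by (cases "r < 2") (auto simp: not_less)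
      ultimately show "b \<in> {1} \<times> {..<f 1}" using rc by (cases "r = 1") auto
    qed (use row1 in auto)
    then show ?thesis by (simp add: letter_cut_def)
  qed
  \<comment> \<open>For \<open>k > 0\<close> no \<open>q\<close> lies below row \<open>k\<close>,
    while all \<open>m\<close> letters \<open>p\<close> lie above it. Since
    \<open>f 1 \<le> m\<close>, the minimum is the cut at row 0.\<close>
  have cut1: "letter_cut p q U k = m" if "k \<noteq> 0" for k
  proof -
    have "{b. U b = Some p \<and> fst b < k} = {b. U b = Some p}" using p_row0 that by fastforce
    moreover have "{b. U b = Some q \<and> k < fst b} = {}"
    proof -
      have False if "U (r, c) = Some q" "k < r" for r c
        using inrow [OF that(1)] f_ge2 [of r] that(2) \<open>k \<noteq> 0\<close> by simp
      then show ?thesis by auto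
    qed
    ultimately show ?thesis using cards unfolding letter_cut_def by (simp only: card.empty add_0_right)
  qed
  have "card {b. U b = Some q \<and> 0 < fst b} \<le> card {b. U b = Some q}"
    using finite_entries [OF fin, of q "\<lambda>_. True"] by (intro card_mono) auto
  then have le: "f 1 \<le> m" using cut0 cards by (simp add: letter_cut_def)
  have pr: "pairs p q U = f 1"
  proof (rule antisym)
    show "pairs p q U \<le> f 1" unfolding pairs_def nat_INF_le_iff using cut0 by (metis order_refl)
    obtain k where k: "letter_cut p q U k \<le> pairs p q U"
      using nat_INF_le_iff [of "letter_cut p q U" "pairs p q U"] unfolding pairs_def by blast
    then show "f 1 \<le> pairs p q U" using cut0 cut1 [of k] le by (cases "k = 0") auto
  qed
  have "diag f = {b. U b = Some p} \<union> {b. U b = Some q}"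
    unfolding f(2) [symmetric] using letters by auto
  moreover have "card ({b. U b = Some p} \<union> {b. U b = Some q}) = card {b. U b = Some p} + card {b. U b = Some q}"
    using finite_entries [OF fin, of _ "\<lambda>_. True"] pq by (intro card_Un_disjoint) auto
  ultimately have "wt f = 2 * m" using cards card_diag [OF shapes_finite [OF f(1)]] by simp
  moreover have "wt f = f 0 + f 1"
    using wt_bound [of 2 f] f_ge2 by (simp add: numeral_2_eq_2)
  ultimately have "f 0 = 2 * m - f 1" by simp
  moreover have J: "pairs p q T = f 1" using pr inv ran pq by simp
  ultimately have feq: "(\<lambda>i. if i = 0 then 2 * m - pairs p q T else if i = 1 then pairs p q T else 0) = f"
    using f_ge2 by (auto simp: fun_eq_iff)
  show ?thesis unfolding feq using f(2) le J unfolding U_def by simp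
qed

lemma nth_default_pair: "nth_default 0 [a, b] = (\<lambda>i. if i = 0 then a else if i = 1 then b else (0::nat))"
  by (rule ext) (auto simp: nth_default_def nth_Cons' numeral_2_eq_2)

lemma sign_index_eq:
  assumes T: "skew_tab R M T" and ran: "ran T \<subseteq> {p, q}" and pq: "p < q"
    and cp: "card {b. T b = Some p} = m" and cq: "card {b. T b = Some q} = m"
  shows "sign_index m T = pairs p q T"
proof -
  note two = rect_two_letters [OF assms]
  show ?thesis
    unfolding sign_index_def
  proof (rule the_equality)
    show "pairs p q T \<le> m \<and> dom (rect T) = diagram [2 * m - pairs p q T, pairs p q T]"
      unfolding diagram_eq nth_default_pair by (rule two)
  next
    fix j assume j: "j \<le> m \<and> dom (rect T) = diagram [2 * m - j, j]"
    have "(\<lambda>i::nat. if i = 0 then 2 * m - j else if i = 1 then j else 0) =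
      (\<lambda>i. if i = 0 then 2 * m - pairs p q T else if i = 1 then pairs p q T else (0::nat))"
      by (rule diag_inject [THEN iffD1], rule trans [OF sym [OF conjunct2 [OF j [unfolded diagram_eq nth_default_pair]]]
            conjunct2 [OF two]])
    from fun_cong [OF this, of 1] show "j = pairs p q T" by simp
  qed
qed

lemma conj_filling_conj [simp]: "conj_filling (conj_filling T) = T"
  by (auto simp: conj_filling_def)

text \<open>With J matched pairs the rectification has rows 2 m - J and J; its conjugate has J rows
  of length 2 and 2 m - 2 J of length 1, so the index j satisfies m - j = J.\<close>

lemma conj_sign_index_eq:
  assumes T: "skew_tab R M T" and ran: "ran T \<subseteq> {p, q}" and pq: "p < q"
    and cp: "card {b. T b = Some p} = m" and cq: "card {b. T b = Some q} = m"
  shows "conj_sign_index m (conj_filling T) = m - pairs p q T"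
proof -
  note two = rect_two_letters [OF assms]
  let ?J = "pairs p q T"
  have dom: "dom (conj_filling (rect T)) = {(i, j). (j, i) \<in> dom (rect T)}"
    by (auto simp: conj_filling_def)
  have rep: "(i, k) \<in> diagram (replicate (m - j) 2 @ replicate (2 * j) 1) \<longleftrightarrow>
      k = 0 \<and> i < m + j \<or> k = 1 \<and> i < m - j" if "j \<le> m" for i j k
    using that by (auto simp: diagram_def nth_append split: if_splits)
  show ?thesis
    unfolding conj_sign_index_def conj_filling_conj
  proof (rule the_equality)
    have "(i, k) \<in> dom (conj_filling (rect T)) \<longleftrightarrow>
      (i, k) \<in> diagram (replicate (m - (m - ?J)) 2 @ replicate (2 * (m - ?J)) 1)" for i k
      using two by (subst rep) (auto simp: dom split: if_splits)
    then show "m - ?J \<le> m \<and> dom (conj_filling (rect T)) =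
        diagram (replicate (m - (m - ?J)) 2 @ replicate (2 * (m - ?J)) 1)"
      by auto
  next
    fix j assume j: "j \<le> m \<and> dom (conj_filling (rect T)) =
        diagram (replicate (m - j) 2 @ replicate (2 * j) 1)"
    then have "(i, 0) \<in> diagram (replicate (m - j) 2 @ replicate (2 * j) 1) \<longleftrightarrow> (0, i) \<in> dom (rect T)" for i
      by (metis dom mem_Collect_eq prod.case)
    then have "i < m + j \<longleftrightarrow> i < 2 * m - ?J" for i
      using j rep [of j i 0] two by simp
    then have "m + j = 2 * m - ?J" by (metis linorder_neqE_nat less_irrefl)
    then show "j = m - ?J" using two by simp
  qed
qed

section \<open>Removing the largest letter\<close>

definition SYT :: "(nat \<Rightarrow> nat) \<Rightarrow> (nat \<Rightarrow> nat) \<Rightarrow> filling set" where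
  "SYT f \<alpha> = {T. dom T = diag f \<and> 0 \<notin> ran T \<and> entries_mono T \<and> content T = \<alpha>}"

lemma SSYT_eq: "is_partition \<nu> \<Longrightarrow> SSYT \<nu> \<alpha> = SYT (nth_default 0 \<nu>) \<alpha>"
proof -
  assume \<nu>: "is_partition \<nu>"
  have "\<exists>\<nu> \<mu>. is_skew_shape \<nu> \<mu> (diagram \<nu>')" if "is_partition \<nu>'" for \<nu>'
    by (rule exI [of _ \<nu>'], rule exI [of _ "[]"]) (use that in \<open>auto simp: is_skew_shape_def is_partition_def diagram_def\<close>)
  then have "semistandard T \<longleftrightarrow> 0 \<notin> ran T \<and> entries_mono T" if "dom T = diagram \<nu>" for T
    unfolding semistandard_def entries_mono_def that using \<nu> by blast
  then show ?thesis unfolding SSYT_def SYT_def by (auto simp flip: diagram_eq)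
qed

definition restr :: "nat \<Rightarrow> filling \<Rightarrow> filling" where
  "restr n T = T |` {b. \<exists>x. T b = Some x \<and> x \<le> n}"

definition add_strip :: "(nat \<Rightarrow> nat) \<Rightarrow> nat \<Rightarrow> filling \<Rightarrow> filling" where
  "add_strip f a T = (\<lambda>b. if T b = None \<and> b \<in> diag f then Some a else T b)"

lemma restr_Some: "restr n T b = Some x \<longleftrightarrow> T b = Some x \<and> x \<le> n"
  by (auto simp: restr_def restrict_map_def)

lemma SYT_finite_dom: "f \<in> shapes \<Longrightarrow> T \<in> SYT f \<alpha> \<Longrightarrow> finite (dom T)"
  by (simp add: SYT_def)

text \<open>Index \<open>k\<close> of a content stands for the letter \<open>k + 1\<close>, so a
  content vanishing from \<open>n\<close> on still allows the letter \<open>n\<close>.\<close>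

lemma SYT_le:
  assumes f: "f \<in> shapes" and T: "T \<in> SYT f \<alpha>" and \<alpha>: "\<And>k. n \<le> k \<Longrightarrow> \<alpha> k = 0" and x: "T b = Some x"
  shows "0 < x" "x \<le> n"
proof -
  have "x \<in> ran T" using x by (rule ranI)
  then show pos: "0 < x" using T by (metis (no_types, lifting) SYT_def mem_Collect_eq gr0I)
  show "x \<le> n"
  proof (rule ccontr)
    assume "\<not> x \<le> n"
    then have "content T (x - 1) = 0" using \<alpha> T by (auto simp: SYT_def)
    moreover have "finite {b. T b = Some x}"
      using finite_entries [OF SYT_finite_dom [OF f T], of x "\<lambda>_. True"] by simp
    ultimately show False using x pos by (cases b) (auto simp: content_def)
  qed
qed

text \<open>Tableaux of equal content use the same letters, so all of them are maps from the finite
  diagram into the finite range of one of them, \<open>T0\<close>.\<close>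

lemma finite_SYT: "f \<in> shapes \<Longrightarrow> finite (SYT f \<alpha>)"
proof (cases "SYT f \<alpha> = {}")
  case False
  assume f: "f \<in> shapes"
  obtain T0 where T0: "T0 \<in> SYT f \<alpha>" using False by blast
  have fin: "finite (ran T0)" by (rule finite_ran [OF SYT_finite_dom [OF f T0]])
  have "SYT f \<alpha> \<subseteq> {T. dom T = diag f \<and> ran T \<subseteq> ran T0}"
  proof
    fix T assume T: "T \<in> SYT f \<alpha>"
    have "x \<in> ran T0" if x: "x \<in> ran T" for x
    proof -
      obtain b where b: "T b = Some x" using x by (auto simp: ran_def)
      have "0 \<notin> ran T" using T by (simp add: SYT_def)
      then have "x \<noteq> 0" using x by metis
      then have Sx: "Suc (x - 1) = x" by simp
      have "content T (x - 1) = content T0 (x - 1)" using T T0 by (simp add: SYT_def)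
      moreover have "finite {b. T b = Some x}"
        using finite_entries [OF SYT_finite_dom [OF f T], of x "\<lambda>_. True"] by simp
      then have "content T (x - 1) \<noteq> 0" unfolding content_def Sx using b by (cases b) auto
      ultimately have "{b. T0 b = Some x} \<noteq> {}" unfolding content_def Sx by (metis card.empty)
      then show ?thesis by (auto simp: ran_def)
    qed
    then show "T \<in> {T. dom T = diag f \<and> ran T \<subseteq> ran T0}" using T by (auto simp: SYT_def)
  qed
  then show ?thesis
    using finite_set_of_finite_maps [OF finite_diag_shapes [OF f] fin] by (rule finite_subset)
qed simp

lemma entries_mono_restr: "entries_mono T \<Longrightarrow> entries_mono (restr n T)"
  unfolding entries_mono_def restr_Some by blast

lemma ideal_restr:
  assumes f: "f \<in> shapes" and T: "dom T = diag f" "entries_mono T"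
  shows "ideal (dom (restr n T))"
  unfolding ideal_def
proof (intro allI impI)
  fix i j i' j' assume *: "(i, j) \<in> dom (restr n T)" "i' \<le> i" "j' \<le> j"
  then obtain x where x: "T (i, j) = Some x" "x \<le> n" by (auto simp: restr_Some)
  have "(i, j) \<in> diag f" using T(1) x(1) by blast
  then have "(i', j) \<in> diag f" "(i', j') \<in> diag f" using idealD [OF ideal_diag [OF f]] * by blast+
  then obtain y z where y: "T (i', j) = Some y" and z: "T (i', j') = Some z" unfolding T(1) [symmetric] by blast
  have "z \<le> y" by (rule entries_rowD [OF T(2) z y *(3)])
  moreover have "y \<le> x" using entries_colD [OF T(2) y x(1)] * x(1) y by (cases "i' = i") auto
  ultimately have "restr n T (i', j') = Some z" using x z by (simp add: restr_Some)
  then show "(i', j') \<in> dom (restr n T)" by blast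
qed

lemma hstrip_diag_subset: "hstrip f g \<Longrightarrow> diag g \<subseteq> diag f"
  by (auto simp: hstrip_def subset_eq) (metis less_le_trans)

lemma card_diag_diff:
  "f \<in> shapes \<Longrightarrow> g \<in> shapes \<Longrightarrow> hstrip f g \<Longrightarrow> wt f = wt g + card (diag f - diag g)"
  using card_Diff_subset [of "diag g" "diag f"] hstrip_diag_subset [of f g]
    card_diag [OF shapes_finite, of f] card_diag [OF shapes_finite, of g]
    card_mono [of "diag f" "diag g"] by simp

lemma add_strip_mem:
  assumes f: "f \<in> shapes" and g: "g \<in> down f (\<alpha> n)" and T: "T \<in> SYT g (\<alpha>(n := 0))"
    and \<alpha>: "\<And>k. n < k \<Longrightarrow> \<alpha> k = 0"
  shows "add_strip f (Suc n) T \<in> SYT f \<alpha>" "restr n (add_strip f (Suc n) T) = T"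
proof -
  have gs: "g \<in> shapes" and h: "hstrip f g" and w: "wt f = wt g + \<alpha> n" using g by (auto simp: down_def)
  have dT: "dom T = diag g" and mono: "entries_mono T" using T by (auto simp: SYT_def)
  have le: "0 < x \<and> x \<le> n" if "T b = Some x" for b x
    using SYT_le [OF gs T _ that, of n] \<alpha> by auto
  let ?U = "add_strip f (Suc n) T"
  have old: "T (i, j) \<noteq> None \<longleftrightarrow> j < g i" for i j
  proof -
    have "(i, j) \<in> dom T \<longleftrightarrow> (i, j) \<in> diag g" using dT by simp
    then show ?thesis by auto
  qed
  have U: "?U (i, j) = Some x \<longleftrightarrow> j < g i \<and> T (i, j) = Some x \<or> g i \<le> j \<and> j < f i \<and> x = Suc n" for i j x
    using old [of i j] by (auto simp: add_strip_def)
  have "dom ?U = diag f"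
    using dT hstrip_diag_subset [OF h] by (auto simp: add_strip_def split: if_splits)
  moreover have "0 \<notin> ran ?U"
  proof
    assume "0 \<in> ran ?U"
    then obtain i j where "?U (i, j) = Some 0" by (auto simp: ran_def)
    then have "T (i, j) = Some 0" unfolding U by simp
    then show False using le by blast
  qed
  moreover have "entries_mono ?U"
    unfolding entries_mono_def U
  proof (intro conjI allI impI)
    fix i j j' a b
    assume *: "j < j' \<and> (j < g i \<and> T (i, j) = Some a \<or> g i \<le> j \<and> j < f i \<and> a = Suc n) \<and>
       (j' < g i \<and> T (i, j') = Some b \<or> g i \<le> j' \<and> j' < f i \<and> b = Suc n)"
    then show "a \<le> b" using entries_rowD [OF mono, of i j a j' b] le [of "(i, j)" a] by auto
  next
    fix i i' j a b
    assume *: "i < i' \<and> (j < g i \<and> T (i, j) = Some a \<or> g i \<le> j \<and> j < f i \<and> a = Suc n) \<and>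
       (j < g i' \<and> T (i', j) = Some b \<or> g i' \<le> j \<and> j < f i' \<and> b = Suc n)"
    have "g i' \<le> g i" using shapes_antimono [OF gs, of i i'] * by simp
    \<comment> \<open>Interlacing makes columns strict: a new box in row \<open>i'\<close> ends
      within \<open>g i\<close>, so the entry above it is an old one and at most
      \<open>n\<close>.\<close>
    moreover have "f i' \<le> g i"
      using shapes_antimono [OF f, of "Suc i" i'] h * by (auto simp: hstrip_def intro: le_trans)
    ultimately show "a < b" using * entries_colD [OF mono, of i j a i' b] le [of "(i, j)" a] by auto
  qed
  moreover have "content ?U = \<alpha>"
  proof
    fix k
    show "content ?U k = \<alpha> k"
    proof (cases "k = n")
      case True
      have no: "T b \<noteq> Some (Suc n)" for b using le [of b "Suc n"] by auto
      have "?U (i, j) = Some (Suc k) \<longleftrightarrow> (i, j) \<in> diag f - diag g" for i j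
        unfolding U True using no by (auto simp: not_less)
      then have "{b. ?U b = Some (Suc k)} = diag f - diag g" by auto
      then show ?thesis using card_diag_diff [OF f gs h] w True by (simp add: content_def)
    next
      case False
      have "?U (i, j) = Some (Suc k) \<longleftrightarrow> T (i, j) = Some (Suc k)" for i j
        unfolding U using False old [of i j] by auto
      then have "{b. ?U b = Some (Suc k)} = {b. T b = Some (Suc k)}" by auto
      then have "content ?U k = content T k" by (simp add: content_def)
      then show ?thesis using T False by (simp add: SYT_def)
    qed
  qed
  ultimately show "?U \<in> SYT f \<alpha>" by (simp add: SYT_def)
  show "restr n ?U = T"
  proof
    fix b :: "nat \<times> nat"
    obtain i j where b: "b = (i, j)" by (cases b)
    have "restr n ?U b = Some x \<longleftrightarrow> T b = Some x" for x
      unfolding restr_Some b U using le [of "(i, j)" x] old [of i j] by auto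
    then show "restr n ?U b = T b" by (metis not_Some_eq)
  qed
qed

lemma restr_mem:
  assumes f: "f \<in> shapes" and T: "T \<in> SYT f \<alpha>" and \<alpha>: "\<And>k. n < k \<Longrightarrow> \<alpha> k = 0"
  obtains g where "g \<in> down f (\<alpha> n)" "restr n T \<in> SYT g (\<alpha>(n := 0))"
    "add_strip f (Suc n) (restr n T) = T"
proof -
  have dT: "dom T = diag f" and mono: "entries_mono T" and zero: "0 \<notin> ran T" and c: "content T = \<alpha>"
    using T by (auto simp: SYT_def)
  have le: "0 < x \<and> x \<le> Suc n" if "T b = Some x" for b x
    using SYT_le [OF f T _ that, of "Suc n"] \<alpha> by auto
  have sub: "dom (restr n T) \<subseteq> diag f" using dT by (auto simp: restr_Some)
  obtain g where g: "g \<in> shapes" and dg: "dom (restr n T) = diag g"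
    using ideal_shape [OF ideal_restr [OF f dT mono] finite_subset [OF sub finite_diag_shapes [OF f]]] by blast
  have some: "\<exists>x. T (i, j) = Some x" if "j < f i" for i j
  proof -
    have "(i, j) \<in> dom T" using that dT by simp
    then show ?thesis by blast
  qed
  have mem_g: "j < g i \<longleftrightarrow> (\<exists>x. T (i, j) = Some x \<and> x \<le> n)" for i j
  proof -
    have "j < g i \<longleftrightarrow> (i, j) \<in> dom (restr n T)" using dg by simp
    then show ?thesis by (auto simp: restr_Some)
  qed
  have h: "hstrip f g"
    unfolding hstrip_def
  proof (intro allI conjI)
    fix i
    show "g i \<le> f i"
    proof (rule ccontr)
      assume "\<not> g i \<le> f i"
      then have "(i, f i) \<in> diag g" by simp
      then have "(i, f i) \<in> diag f" using sub unfolding dg by blast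
      then show False by simp
    qed
    \<comment> \<open>Otherwise column \<open>g i\<close> has boxes outside \<open>g\<close> in rows
      \<open>i\<close> and \<open>Suc i\<close>; by strictness the upper entry is at most
      \<open>n\<close>, which would put its box into \<open>g\<close>.\<close>
    show "f (Suc i) \<le> g i"
    proof (rule ccontr)
      assume "\<not> f (Suc i) \<le> g i"
      then have "g i < f (Suc i)" by simp
      moreover then have "g i < f i" using shapes_antimono [OF f, of i "Suc i"] by simp
      ultimately obtain x y where x: "T (Suc i, g i) = Some x" and y: "T (i, g i) = Some y"
        using some by blast
      have "y < x" by (rule entries_colD [OF mono y x]) simp
      then have "y \<le> n" using le [OF x] by simp
      then have "g i < g i" using mem_g y by blast
      then show False by simp
    qed
  qed
  have "diag f - diag g = {b. T b = Some (Suc n)}"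
  proof (intro equalityI subsetI)
    fix b assume b: "b \<in> diag f - diag g"
    obtain i j where ij: "b = (i, j)" by (cases b)
    obtain x where x: "T (i, j) = Some x" using b some [of j i] ij by auto
    have "\<not> x \<le> n" using b mem_g [of j i] x ij by auto
    then show "b \<in> {b. T b = Some (Suc n)}" using le [OF x] x ij by (simp add: le_antisym not_le Suc_le_eq)
  next
    fix b assume b: "b \<in> {b. T b = Some (Suc n)}"
    obtain i j where ij: "b = (i, j)" by (cases b)
    have "b \<in> dom T" using b by blast
    then show "b \<in> diag f - diag g" using b ij mem_g [of j i] unfolding dT by auto
  qed
  then have "card (diag f - diag g) = \<alpha> n" using c by (auto simp: content_def)
  then have "g \<in> down f (\<alpha> n)" using g h card_diag_diff [OF f g h] by (simp add: down_def)
  moreover have "restr n T \<in> SYT g (\<alpha>(n := 0))"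
  proof -
    have "0 \<notin> ran (restr n T)" using zero by (auto simp: ran_def restr_Some)
    moreover have "content (restr n T) = \<alpha>(n := 0)"
    proof
      fix k
      show "content (restr n T) k = (\<alpha>(n := 0)) k"
      proof (cases "k < n")
        case True
        then have "content (restr n T) k = content T k" by (simp add: content_def restr_Some Suc_le_eq)
        then show ?thesis using True c by simp
      next
        case False
        then have "content (restr n T) k = 0" by (simp add: content_def restr_Some Suc_le_eq)
        then show ?thesis using False \<alpha>[of k] by (cases "k = n") auto
      qed
    qed
    ultimately show ?thesis using dg entries_mono_restr [OF mono] by (simp add: SYT_def)
  qed
  moreover have "add_strip f (Suc n) (restr n T) = T"
  proof
    fix b :: "nat \<times> nat"
    show "add_strip f (Suc n) (restr n T) b = T b"
    proof (cases "T b")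
      case None
      then have "b \<notin> diag f" "restr n T b = None" using dT by (auto simp: restr_def restrict_map_def)
      then show ?thesis using None by (simp add: add_strip_def)
    next
      case (Some x)
      then have "b \<in> diag f" unfolding dT [symmetric] by blast
      then show ?thesis
        using Some le [OF Some] by (auto simp: add_strip_def restr_def restrict_map_def le_Suc_eq)
    qed
  qed
  ultimately show ?thesis using that by blast
qed

text \<open>Stated for an arbitrary weight: the constant 1 yields the branching rule for Schur
  coefficients, while signed weights drive the recursion for content \<lambda>^2.\<close>

lemma SYT_strip_sum:
  fixes F :: "filling \<Rightarrow> 'a :: comm_monoid_add"
  assumes f: "f \<in> shapes" and \<alpha>: "\<And>k. n < k \<Longrightarrow> \<alpha> k = 0"
  shows "sum F (SYT f \<alpha>) =
    (\<Sum>g\<in>down f (\<alpha> n). \<Sum>T\<in>SYT g (\<alpha>(n := 0)). F (add_strip f (Suc n) T))"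
proof -
  let ?S = "SIGMA g : down f (\<alpha> n). SYT g (\<alpha>(n := 0))"
  have "inj_on (\<lambda>(g, T). add_strip f (Suc n) T) ?S"
  proof (rule inj_onI)
    fix x y assume x: "x \<in> ?S" and y: "y \<in> ?S"
      and eq: "(case x of (g, T) \<Rightarrow> add_strip f (Suc n) T) = (case y of (g, T) \<Rightarrow> add_strip f (Suc n) T)"
    have T: "snd x = snd y"
    proof -
      have "restr n (add_strip f (Suc n) (snd z)) = snd z" if "z \<in> ?S" for z
        by (rule add_strip_mem(2) [OF f _ _ \<alpha>, of "fst z"]) (use that in auto)
      then show ?thesis using x y eq by (metis case_prod_beta)
    qed
    then have "diag (fst x) = diag (fst y)" using x y by (auto simp: SYT_def)
    then show "x = y" using T by (simp add: diag_inject prod_eq_iff)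
  qed
  moreover have "(\<lambda>(g, T). add_strip f (Suc n) T) ` ?S = SYT f \<alpha>"
  proof (intro equalityI subsetI)
    fix U assume "U \<in> (\<lambda>(g, T). add_strip f (Suc n) T) ` ?S"
    then show "U \<in> SYT f \<alpha>" using add_strip_mem(1) [OF f _ _ \<alpha>] by auto
  next
    fix U assume U: "U \<in> SYT f \<alpha>"
    obtain g where "g \<in> down f (\<alpha> n)" "restr n U \<in> SYT g (\<alpha>(n := 0))" "add_strip f (Suc n) (restr n U) = U"
      by (rule restr_mem [OF f U \<alpha>])
    then show "U \<in> (\<lambda>(g, T). add_strip f (Suc n) T) ` ?S"
      by (intro image_eqI [of _ _ "(g, restr n U)"]) auto
  qed
  ultimately have "bij_betw (\<lambda>(g, T). add_strip f (Suc n) T) ?S (SYT f \<alpha>)" by (simp add: bij_betw_def)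
  from sum.reindex_bij_betw [OF this, of F]
  have "sum F (SYT f \<alpha>) = (\<Sum>(g, T)\<in>?S. F (add_strip f (Suc n) T))"
    by (simp add: case_prod_beta)
  also have "\<dots> = (\<Sum>g\<in>down f (\<alpha> n). \<Sum>T\<in>SYT g (\<alpha>(n := 0)). F (add_strip f (Suc n) T))"
    by (subst sum.Sigma) (auto simp: down_def [of f] intro!: finite_SYT finite_down [unfolded down_def])
  finally show ?thesis .
qed

lemma SYT_zero_content:
  assumes "f \<in> shapes"
  shows "SYT f (\<lambda>_. 0) = (if f = (\<lambda>_. 0) then {Map.empty} else {})"
proof -
  have 1: "T = Map.empty" if "T \<in> SYT f (\<lambda>_. 0)" for T
  proof
    fix b show "T b = None" using SYT_le [OF assms that, of 0 b] by (cases "T b") auto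
  qed
  have 2: "f = (\<lambda>_. 0)" if "T \<in> SYT f (\<lambda>_. 0)" for T
  proof -
    have "diag f = {}" using 1 [OF that] that by (simp add: SYT_def)
    then have "diag f = diag (\<lambda>_. 0)" by (auto simp: diag_def)
    then show ?thesis by (simp add: diag_inject)
  qed
  have 3: "Map.empty \<in> SYT (\<lambda>_. 0) (\<lambda>_. 0)"
    by (auto simp: SYT_def diag_def entries_mono_def content_def)
  show ?thesis
  proof (cases "f = (\<lambda>_. 0)")
    case True
    have "SYT f (\<lambda>_. 0) = {Map.empty}" using 1 3 unfolding True by blast
    then show ?thesis using True by simp
  next
    case False
    then have "SYT f (\<lambda>_. 0) = {}" using 2 by blast
    then show ?thesis using False by simp
  qed
qed

section \<open>Multiplicative coefficient functions\<close>

lemma filter_add_replicate: "filter_mset (\<lambda>y. y \<noteq> x) B + replicate_mset (count B x) x = B"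
  by (rule multiset_eqI) auto

text \<open>Variables enter in increasing order, all copies at once, so that the new variable always
  corresponds to the largest letter of a tableau.\<close>

lemma letter_induct:
  assumes empty: "P {#}"
    and add: "\<And>n \<alpha> a. (\<And>x. x \<in># \<alpha> \<Longrightarrow> x < n) \<Longrightarrow> P \<alpha> \<Longrightarrow> P (\<alpha> + replicate_mset a n)"
  shows "P (\<alpha> :: nat multiset)"
proof -
  have "\<forall>\<alpha>. (\<forall>x\<in>#\<alpha>. x < n) \<longrightarrow> P \<alpha>" for n
  proof (induction n)
    case 0
    show ?case
    proof (intro allI impI)
      fix \<alpha> :: "nat multiset" assume "\<forall>x\<in>#\<alpha>. x < 0"
      then have "\<alpha> = {#}" by (metis multiset_nonemptyE not_less_zero)
      then show "P \<alpha>" using empty by simp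
    qed
  next
    case (Suc n)
    show ?case
    proof (intro allI impI)
      fix \<alpha> :: "nat multiset" assume \<alpha>: "\<forall>x\<in>#\<alpha>. x < Suc n"
      let ?\<beta> = "filter_mset (\<lambda>y. y \<noteq> n) \<alpha>"
      have lt: "x < n" if "x \<in># ?\<beta>" for x using that \<alpha> by (auto simp: less_Suc_eq)
      then have "P ?\<beta>" using Suc.IH by blast
      then have "P (?\<beta> + replicate_mset (count \<alpha> n) n)" by (rule add [rotated]) (rule lt)
      then show "P \<alpha>" by (simp only: filter_add_replicate)
    qed
  qed
  moreover have "\<forall>x\<in>#\<alpha>. x < Suc (Max (set_mset \<alpha>))" by (simp add: le_imp_less_Suc)
  ultimately show ?thesis by blast
qed

lemma filter_add_replicate_other:
  "x \<notin># \<beta> \<Longrightarrow> filter_mset (\<lambda>y. y \<noteq> x) (\<beta> + replicate_mset a x) = \<beta>"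
  by (rule multiset_eqI) (auto simp: not_in_iff)

text \<open>Here \<open>d\<close> is the number of copies of \<open>x\<close> that go to the second
  factor.\<close>

lemma sum_splits_add:
  fixes F :: "nat multiset \<Rightarrow> nat multiset \<Rightarrow> rat"
  assumes x: "x \<notin># \<alpha>"
  shows "(\<Sum>(\<beta>, \<gamma>)\<in>splits (\<alpha> + replicate_mset a x). F \<beta> \<gamma>) =
    (\<Sum>d\<le>a. \<Sum>(\<beta>, \<gamma>)\<in>splits \<alpha>. F (\<beta> + replicate_mset (a - d) x) (\<gamma> + replicate_mset d x))"
proof -
  let ?S = "{..a} \<times> splits \<alpha>"
  let ?j = "\<lambda>(d, \<beta>, \<gamma>). (\<beta> + replicate_mset (a - d) x, \<gamma> + replicate_mset d x)"
  let ?i = "\<lambda>(\<beta>, \<gamma>). (count \<gamma> x, filter_mset (\<lambda>y. y \<noteq> x) \<beta>, filter_mset (\<lambda>y. y \<noteq> x) \<gamma>)"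
  have x0: "x \<notin># \<beta>" "x \<notin># \<gamma>" "count \<gamma> x = 0" if "(\<beta>, \<gamma>) \<in> splits \<alpha>" for \<beta> \<gamma>
    using that x by (auto simp: splits_def not_in_iff)
  have cnt: "count \<beta> x + count \<gamma> x = a" if "(\<beta>, \<gamma>) \<in> splits (\<alpha> + replicate_mset a x)" for \<beta> \<gamma>
  proof -
    have "\<beta> + \<gamma> = \<alpha> + replicate_mset a x" using that by (simp add: splits_def)
    then have "count (\<beta> + \<gamma>) x = count (\<alpha> + replicate_mset a x) x" by simp
    then show ?thesis using x by (simp add: not_in_iff)
  qed
  have flt: "filter_mset (\<lambda>y. y \<noteq> x) \<beta> + filter_mset (\<lambda>y. y \<noteq> x) \<gamma> = \<alpha>"
    if "(\<beta>, \<gamma>) \<in> splits (\<alpha> + replicate_mset a x)" for \<beta> \<gamma>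
  proof -
    have "filter_mset (\<lambda>y. y \<noteq> x) \<beta> + filter_mset (\<lambda>y. y \<noteq> x) \<gamma> =
        filter_mset (\<lambda>y. y \<noteq> x) (\<alpha> + replicate_mset a x)"
      using that by (simp add: splits_def flip: filter_union_mset)
    then show ?thesis using filter_add_replicate_other [OF x] by simp
  qed
  have "(\<Sum>(d, \<beta>, \<gamma>)\<in>?S. F (\<beta> + replicate_mset (a - d) x) (\<gamma> + replicate_mset d x)) =
      (\<Sum>(\<beta>, \<gamma>)\<in>splits (\<alpha> + replicate_mset a x). F \<beta> \<gamma>)"
  proof (rule sum.reindex_bij_witness [of _ ?i ?j])
    fix z assume z: "z \<in> ?S"
    obtain d \<beta> \<gamma> where [simp]: "z = (d, \<beta>, \<gamma>)" by (cases z)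
    have s: "d \<le> a" "(\<beta>, \<gamma>) \<in> splits \<alpha>" using z by auto
    show "?i (?j z) = z"
      using x0 [OF s(2)] by (simp add: filter_add_replicate_other del: filter_union_mset)
    have "\<beta> + \<gamma> = \<alpha>" using s(2) by (simp add: splits_def)
    then show "?j z \<in> splits (\<alpha> + replicate_mset a x)"
      using s(1) by (auto simp: splits_def multiset_eq_iff)
    show "(case ?j z of (\<beta>, \<gamma>) \<Rightarrow> F \<beta> \<gamma>) =
      (case z of (d, \<beta>, \<gamma>) \<Rightarrow> F (\<beta> + replicate_mset (a - d) x) (\<gamma> + replicate_mset d x))" by simp
  next
    fix z assume z: "z \<in> splits (\<alpha> + replicate_mset a x)"
    obtain \<beta> \<gamma> where [simp]: "z = (\<beta>, \<gamma>)" by (cases z)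
    have s: "(\<beta>, \<gamma>) \<in> splits (\<alpha> + replicate_mset a x)" using z by simp
    have c: "a - count \<gamma> x = count \<beta> x" "count \<gamma> x \<le> a" using cnt [OF s] by auto
    show "?j (?i z) = z" by (simp add: c filter_add_replicate)
    show "?i z \<in> ?S" using c flt [OF s] by (simp add: splits_def)
  qed
  then show ?thesis by (simp add: sum.cartesian_product)
qed

text \<open>If \<phi> 0 = 1, this is the coefficient of \<alpha> in the product, over all variables,
  of the one-variable series with coefficients \<phi>. Identities between such products reduce to a
  single variable.\<close>

definition multiplicative :: "(nat \<Rightarrow> rat) \<Rightarrow> nat multiset \<Rightarrow> rat" where
  "multiplicative \<phi> \<alpha> = (\<Prod>i\<in>set_mset \<alpha>. \<phi> (count \<alpha> i))"

lemma multiplicative_empty [simp]: "multiplicative \<phi> {#} = 1"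
  by (simp add: multiplicative_def)

lemma multiplicative_add:
  assumes "\<phi> 0 = 1" "x \<notin># \<alpha>"
  shows "multiplicative \<phi> (\<alpha> + replicate_mset a x) = multiplicative \<phi> \<alpha> * \<phi> a"
proof (cases "a = 0")
  case False
  have "multiplicative \<phi> (\<alpha> + replicate_mset a x) =
      (\<Prod>i\<in>insert x (set_mset \<alpha>). \<phi> (count (\<alpha> + replicate_mset a x) i))"
    using False by (simp add: multiplicative_def)
  also have "\<dots> = \<phi> a * (\<Prod>i\<in>set_mset \<alpha>. \<phi> (count (\<alpha> + replicate_mset a x) i))"
    using assms(2) by (subst prod.insert) (auto simp: not_in_iff)
  also have "(\<Prod>i\<in>set_mset \<alpha>. \<phi> (count (\<alpha> + replicate_mset a x) i)) = multiplicative \<phi> \<alpha>"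
    unfolding multiplicative_def by (rule prod.cong) (use assms(2) in auto)
  finally show ?thesis by simp
qed (use assms in simp)

text \<open>Products over the variables multiply factor by factor, which is a convolution in each
  variable.\<close>

lemma multiplicative_mult:
  assumes "\<phi> 0 = 1" "\<psi> 0 = 1"
  shows "(\<Sum>(\<beta>, \<gamma>)\<in>splits \<alpha>. multiplicative \<phi> \<beta> * multiplicative \<psi> \<gamma>) =
    multiplicative (\<lambda>a. \<Sum>d\<le>a. \<phi> (a - d) * \<psi> d) \<alpha>"
proof (induction \<alpha> rule: letter_induct)
  case 1
  have "splits {#} = {({#}, {#})}" by (auto simp: splits_def)
  then show ?case by simp
next
  case (2 n \<alpha> a)
  have n: "n \<notin># \<alpha>" using 2(1) by blast
  have "(\<Sum>(\<beta>, \<gamma>)\<in>splits \<alpha>. multiplicative \<phi> (\<beta> + replicate_mset b n) * multiplicative \<psi> (\<gamma> + replicate_mset d n)) =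
      (\<Sum>(\<beta>, \<gamma>)\<in>splits \<alpha>. multiplicative \<phi> \<beta> * multiplicative \<psi> \<gamma>) * (\<phi> b * \<psi> d)" for b d
    unfolding sum_distrib_right
  proof (rule sum.cong)
    fix z assume "z \<in> splits \<alpha>"
    moreover obtain \<beta> \<gamma> where z: "z = (\<beta>, \<gamma>)" by (cases z)
    ultimately have "n \<notin># \<beta>" "n \<notin># \<gamma>" using n by (auto simp: splits_def)
    then show "(case z of (\<beta>, \<gamma>) \<Rightarrow>
        multiplicative \<phi> (\<beta> + replicate_mset b n) * multiplicative \<psi> (\<gamma> + replicate_mset d n)) =
      (case z of (\<beta>, \<gamma>) \<Rightarrow> multiplicative \<phi> \<beta> * multiplicative \<psi> \<gamma>) * (\<phi> b * \<psi> d)"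
      by (simp add: z multiplicative_add assms)
  qed simp
  then show ?case
    unfolding sum_splits_add [OF n] using n
    by (simp add: 2 multiplicative_add assms sum_distrib_left)
qed

lemma multiplicative_sign: "multiplicative (\<lambda>d. (- 1) ^ d * \<phi> d) \<alpha> = (- 1) ^ size \<alpha> * multiplicative \<phi> \<alpha>"
  unfolding multiplicative_def prod.distrib by (simp add: power_sum size_multiset_overloaded_eq)

text \<open>The sign (-1)^k on degree k is the substitution of -x for x in the first factor, which
  again acts on each variable separately.\<close>

lemma coeff_alternating_sum:
  assumes Z: "\<And>k \<alpha>. coeff (Z k) \<alpha> = (if size \<alpha> = k then multiplicative \<phi> \<alpha> else 0)"
    and Y: "\<And>k \<alpha>. coeff (Y k) \<alpha> = (if size \<alpha> = k then multiplicative \<psi> \<alpha> else 0)"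
    and "\<phi> 0 = 1" "\<psi> 0 = 1"
  shows "coeff (\<Sum>k\<le>n. scale ((- 1) ^ k) (Z k * Y (n - k))) \<alpha> =
    (if size \<alpha> = n then multiplicative (\<lambda>a. \<Sum>d\<le>a. (- 1) ^ (a - d) * \<phi> (a - d) * \<psi> d) \<alpha> else 0)"
proof -
  have "coeff (\<Sum>k\<le>n. scale ((- 1) ^ k) (Z k * Y (n - k))) \<alpha> =
      (\<Sum>k\<le>n. \<Sum>z\<in>splits \<alpha>. (- 1) ^ k * (coeff (Z k) (fst z) * coeff (Y (n - k)) (snd z)))"
    by (simp add: coeff_mult sum_distrib_left case_prod_beta)
  also have "\<dots> = (\<Sum>z\<in>splits \<alpha>. \<Sum>k\<le>n. (- 1) ^ k * (coeff (Z k) (fst z) * coeff (Y (n - k)) (snd z)))"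
    by (rule sum.swap)
  also have "\<dots> = (\<Sum>z\<in>splits \<alpha>. if size \<alpha> = n then
      multiplicative (\<lambda>d. (- 1) ^ d * \<phi> d) (fst z) * multiplicative \<psi> (snd z) else 0)"
  proof (rule sum.cong)
    fix z assume z: "z \<in> splits \<alpha>"
    let ?b = "size (fst z)"
    have sz: "size \<alpha> = ?b + size (snd z)" using z by (auto simp: splits_def)
    have "(\<Sum>k\<le>n. (- 1) ^ k * (coeff (Z k) (fst z) * coeff (Y (n - k)) (snd z))) =
      (\<Sum>k\<le>n. if k = ?b then (- 1) ^ k * (multiplicative \<phi> (fst z) * coeff (Y (n - k)) (snd z)) else 0)"
      by (rule sum.cong) (auto simp: Z)
    also have "\<dots> = (if size \<alpha> = n then
      multiplicative (\<lambda>d. (- 1) ^ d * \<phi> d) (fst z) * multiplicative \<psi> (snd z) else 0)"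
      unfolding multiplicative_sign by (auto simp: sz Y)
    finally show "(\<Sum>k\<le>n. (- 1) ^ k * (coeff (Z k) (fst z) * coeff (Y (n - k)) (snd z))) =
      (if size \<alpha> = n then multiplicative (\<lambda>d. (- 1) ^ d * \<phi> d) (fst z) * multiplicative \<psi> (snd z) else 0)" .
  qed simp
  also have "\<dots> = (if size \<alpha> = n then
      \<Sum>(\<beta>, \<gamma>)\<in>splits \<alpha>. multiplicative (\<lambda>d. (- 1) ^ d * \<phi> d) \<beta> * multiplicative \<psi> \<gamma> else 0)"
    by (simp add: case_prod_beta)
  also have "(\<Sum>(\<beta>, \<gamma>)\<in>splits \<alpha>. multiplicative (\<lambda>d. (- 1) ^ d * \<phi> d) \<beta> * multiplicative \<psi> \<gamma>) =
      multiplicative (\<lambda>a. \<Sum>d\<le>a. (- 1) ^ (a - d) * \<phi> (a - d) * \<psi> d) \<alpha>"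
    by (rule multiplicative_mult) (simp_all add: assms)
  finally show ?thesis .
qed

section \<open>Complete and elementary symmetric functions\<close>

abbreviation at_most_one :: "nat \<Rightarrow> rat" where
  "at_most_one d \<equiv> (if d \<le> 1 then 1 else 0)"

lemma coeff_complete: "coeff (complete m) \<alpha> = (if size \<alpha> = m then multiplicative (\<lambda>_. 1) \<alpha> else 0)"
  by (simp add: complete.rep_eq multiplicative_def)

lemma multiplicative_at_most_one:
  "multiplicative at_most_one \<alpha> = (if \<forall>i. count \<alpha> i \<le> 1 then 1 else 0)"
proof (cases "\<forall>i. count \<alpha> i \<le> 1")
  case False
  then obtain i where i: "\<not> count \<alpha> i \<le> 1" by blast
  then have "i \<in># \<alpha>" by (metis not_in_iff zero_le)
  then have "multiplicative at_most_one \<alpha> = 0"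
    unfolding multiplicative_def using i by (intro prod_zero) auto
  then show ?thesis using False by simp
qed (simp add: multiplicative_def)

lemma coeff_elementary:
  "coeff (elementary m) \<alpha> = (if size \<alpha> = m then multiplicative at_most_one \<alpha> else 0)"
  unfolding multiplicative_at_most_one by (simp add: elementary.rep_eq)

lemma alternating_complete_elementary:
  assumes "0 < n"
  shows "(\<Sum>k\<le>n. scale ((- 1) ^ k) (complete k * elementary (n - k))) = 0"
proof (rule mseries_eqI)
  fix \<alpha>
  \<comment> \<open>In one variable: the series of 1/(1 + x) times 1 + x is 1.\<close>
  have conv: "(\<Sum>d\<le>a. (- 1) ^ (a - d) * 1 * at_most_one d) = (if a = 0 then 1 else 0)" for a
  proof (cases a)
    case (Suc b)
    have "(\<Sum>d\<le>a. (- 1) ^ (a - d) * 1 * at_most_one d) =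
        (\<Sum>d\<in>{0, 1}. (- 1) ^ (a - d) * 1 * at_most_one d)"
      by (rule sum.mono_neutral_right) (auto simp: Suc)
    then show ?thesis by (simp add: Suc)
  qed simp
  have "multiplicative (\<lambda>a. if a = 0 then 1 else 0) \<alpha> = 0" if "size \<alpha> = n"
  proof -
    have "\<alpha> \<noteq> {#}" using that assms by auto
    then obtain x where x: "x \<in># \<alpha>" by (rule multiset_nonemptyE)
    then have "count \<alpha> x \<noteq> 0" by simp
    then show ?thesis unfolding multiplicative_def using x by (intro prod_zero) auto
  qed
  then show "coeff (\<Sum>k\<le>n. scale ((- 1) ^ k) (complete k * elementary (n - k))) \<alpha> = coeff 0 \<alpha>"
    using coeff_alternating_sum [OF coeff_complete coeff_elementary, of n \<alpha>] unfolding conv by auto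
qed

lemma multiplicative_repeat:
  "multiplicative \<phi> (repeat_mset (Suc k) \<delta>) = multiplicative (\<lambda>d. \<phi> (Suc k * d)) \<delta>"
proof -
  have "set_mset (repeat_mset (Suc k) \<delta>) = set_mset \<delta>" by (induction k) auto
  moreover have "count (repeat_mset (Suc k) \<delta>) i = Suc k * count \<delta> i" for i by simp
  ultimately show ?thesis unfolding multiplicative_def by (simp only:)
qed

text \<open>A monomial that is not a square contains a variable with odd exponent, and the factor of
  that variable vanishes.\<close>

lemma multiplicative_not_double:
  assumes "\<And>\<delta>. \<alpha> \<noteq> repeat_mset (Suc 1) \<delta>" "\<And>a. odd a \<Longrightarrow> \<phi> a = 0"
  shows "multiplicative \<phi> \<alpha> = 0"
proof -
  have "\<exists>i. odd (count \<alpha> i)"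
  proof (rule ccontr)
    assume "\<nexists>i. odd (count \<alpha> i)"
    then have ev: "even (count \<alpha> i)" for i by blast
    have "{i. 0 < count \<alpha> i div 2} \<subseteq> set_mset \<alpha>" by (auto simp: not_in_iff intro: ccontr)
    then have "finite {i. 0 < count \<alpha> i div 2}" by (rule finite_subset) simp
    then have "count (Abs_multiset (\<lambda>i. count \<alpha> i div 2)) i = count \<alpha> i div 2" for i
      by (simp add: Abs_multiset_inverse)
    then have "\<alpha> = repeat_mset (Suc 1) (Abs_multiset (\<lambda>i. count \<alpha> i div 2))"
      using ev by (intro multiset_eqI) (simp add: mult_2 [symmetric])
    then show False using assms(1) by blast
  qed
  then obtain i where i: "odd (count \<alpha> i)" ..
  then have "i \<in># \<alpha>" by (metis even_zero not_in_iff)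
  then show ?thesis unfolding multiplicative_def using i assms(2) by (intro prod_zero) auto
qed

lemma adams_complete:
  "adams 2 (complete m) = (\<Sum>k\<le>2 * m. scale ((- 1) ^ k) (complete k * complete (2 * m - k)))"
proof -
  \<comment> \<open>In one variable: 1/(1 + x) times 1/(1 - x) is 1/(1 - x^2), the series of the
    complete functions in the squared variable.\<close>
  have conv: "(\<Sum>d\<le>a. (- 1) ^ (a - d) * 1 * (1::rat)) = (if even a then 1 else 0)" for a
  proof (induction a)
    case (Suc a)
    have "(\<Sum>d\<le>a. (- 1) ^ (Suc a - d) * 1 * (1::rat)) = - (\<Sum>d\<le>a. (- 1) ^ (a - d) * 1 * (1::rat))"
      unfolding sum_negf [symmetric] by (rule sum.cong) (auto simp: Suc_diff_le)
    then show ?case using Suc.IH by simp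
  qed simp
  have coef: "coeff (\<Sum>k\<le>n. scale ((- 1) ^ k) (complete k * complete (n - k))) \<alpha> =
      (if size \<alpha> = n then multiplicative (\<lambda>a. if even a then 1 else 0) \<alpha> else 0)" for n \<alpha>
    using coeff_alternating_sum [OF coeff_complete coeff_complete, of n \<alpha>] unfolding conv by simp
  let ?g = "\<Sum>k\<le>2 * m. scale ((- 1) ^ k) (complete k * complete (2 * m - k))"
  have "adams (Suc 1) (complete m) = ?g"
  proof (rule adams_eqI)
    fix \<beta> :: "nat multiset"
    have "multiplicative (\<lambda>a. if even a then 1 else 0) (repeat_mset (Suc 1) \<beta>) = multiplicative (\<lambda>_. 1) \<beta>"
      by (simp only: multiplicative_repeat) simp
    moreover have "size (repeat_mset (Suc 1) \<beta>) = 2 * m \<longleftrightarrow> size \<beta> = m"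
      by (simp, arith)
    ultimately show "coeff ?g (repeat_mset (Suc 1) \<beta>) = coeff (complete m) \<beta>"
      unfolding coef coeff_complete by presburger
  next
    fix \<alpha> :: "nat multiset" assume "\<And>\<beta>. \<alpha> \<noteq> repeat_mset (Suc 1) \<beta>"
    then have "multiplicative (\<lambda>a. if even a then 1 else 0) \<alpha> = 0"
      by (rule multiplicative_not_double) simp
    then show "coeff ?g \<alpha> = 0" unfolding coef by simp
  qed
  then show ?thesis by (simp add: numeral_2_eq_2)
qed

text \<open>In one variable (1 - x)(1 + x) = 1 - x^2, whereas squaring the variable in 1 + x gives 1
  + x^2. The two differ by a sign for each variable that is used, and a monomial of degree 2 m uses
  m of them.\<close>

lemma adams_elementary:
  "adams 2 (elementary m) =
     scale ((- 1) ^ m) (\<Sum>k\<le>2 * m. scale ((- 1) ^ k) (elementary k * elementary (2 * m - k)))"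
proof -
  let ?\<chi> = "\<lambda>a. if a = 0 then 1 else if a = 2 then - 1 else (0::rat)"
  have conv: "(\<Sum>d\<le>a. (- 1) ^ (a - d) * at_most_one (a - d) * at_most_one d) = ?\<chi> a" for a
  proof -
    consider "a = 0" | "a = 1" | "a = 2" | "2 < a" by linarith
    then show ?thesis
    proof cases
      case 4
      then have "(\<Sum>d\<le>a. (- 1) ^ (a - d) * at_most_one (a - d) * at_most_one d) = 0"
        by (intro sum.neutral) auto
      then show ?thesis using 4 by simp
    qed (auto simp: numeral_2_eq_2)
  qed
  have coef: "coeff (\<Sum>k\<le>n. scale ((- 1) ^ k) (elementary k * elementary (n - k))) \<alpha> =
      (if size \<alpha> = n then multiplicative ?\<chi> \<alpha> else 0)" for n \<alpha>
    using coeff_alternating_sum [OF coeff_elementary coeff_elementary, of n \<alpha>] unfolding conv by simp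
  let ?g = "scale ((- 1) ^ m) (\<Sum>k\<le>2 * m. scale ((- 1) ^ k) (elementary k * elementary (2 * m - k)))"
  have *: "coeff ?g \<alpha> = (- 1) ^ m * (if size \<alpha> = 2 * m then multiplicative ?\<chi> \<alpha> else 0)" for \<alpha>
    unfolding coeff_scale coef ..
  have "adams (Suc 1) (elementary m) = ?g"
  proof (rule adams_eqI)
    fix \<beta> :: "nat multiset"
    have "multiplicative ?\<chi> (repeat_mset (Suc 1) \<beta>) = multiplicative (\<lambda>d. (- 1) ^ d * at_most_one d) \<beta>"
    proof -
      have "?\<chi> (Suc 1 * d) = (- 1) ^ d * at_most_one d" for d
      proof -
        consider "d = 0" | "d = 1" | "2 \<le> d" by linarith
        then show ?thesis by cases auto
      qed
      then show ?thesis unfolding multiplicative_repeat by presburger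
    qed
    also have "\<dots> = (- 1) ^ size \<beta> * multiplicative at_most_one \<beta>" by (rule multiplicative_sign)
    finally have 1: "multiplicative ?\<chi> (repeat_mset (Suc 1) \<beta>) = (- 1) ^ size \<beta> * multiplicative at_most_one \<beta>" .
    have 2: "size (repeat_mset (Suc 1) \<beta>) = 2 * m \<longleftrightarrow> size \<beta> = m"
      by (simp, arith)
    have 3: "(- 1) ^ m * ((- 1) ^ m * x) = (x :: rat)" for x
      by (simp flip: mult.assoc power_mult_distrib)
    show "coeff ?g (repeat_mset (Suc 1) \<beta>) = coeff (elementary m) \<beta>"
      unfolding * coeff_elementary 1 2 by (cases "size \<beta> = m") (simp_all only: simp_thms if_True if_False 3 mult_zero_right)
  next
    fix \<alpha> :: "nat multiset" assume "\<And>\<beta>. \<alpha> \<noteq> repeat_mset (Suc 1) \<beta>"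
    then have "multiplicative ?\<chi> \<alpha> = 0"
      by (rule multiplicative_not_double) (auto elim!: oddE)
    then show "coeff ?g \<alpha> = 0" unfolding * by simp
  qed
  then show ?thesis by (simp add: numeral_2_eq_2)
qed

lemma Sym_complete: "complete m \<in> Sym"
  by (rule SymI [of _ m]) (auto simp: complete.rep_eq split: if_splits)

lemma Sym_elementary: "elementary m \<in> Sym"
proof (rule SymI [of _ m])
  fix \<pi> :: "nat \<Rightarrow> nat" and \<alpha> assume b: "bij \<pi>"
  have c: "count (image_mset \<pi> \<alpha>) (\<pi> i) = count \<alpha> i" for i \<alpha>
    by (induction \<alpha>) (auto simp: inj_eq [OF bij_is_inj [OF b]])
  have "(\<forall>i. count (image_mset \<pi> \<alpha>) i \<le> 1) \<longleftrightarrow> (\<forall>i. count \<alpha> i \<le> 1)"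
    using bij_is_surj [OF b] by (metis c surjD)
  then show "coeff (elementary m) (image_mset \<pi> \<alpha>) = coeff (elementary m) \<alpha>"
    by (simp add: elementary.rep_eq)
qed (auto simp: elementary.rep_eq split: if_splits)

lemma Sym_prod_list: "(\<And>x. x \<in> set xs \<Longrightarrow> f x \<in> Sym) \<Longrightarrow> prod_list (map f xs) \<in> Sym"
  by (induction xs) (auto intro: Sym_one Sym_mult)

section \<open>Plethysm by degree two\<close>

text \<open>Both sides are endomorphisms in \<open>g\<close> that agree on the power sums, and these
  generate \<open>Sym\<close>.\<close>

lemma plethysm_power_sum:
  assumes g: "g \<in> Sym"
  shows "plethysm (pw k) g = adams (Suc k) g"
proof -
  note P = is_plethysm_plethysm
  obtain Q where Q: "g = ev (\<lambda>k. pw k) Q" using g Sym_eq_range by blast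
  have e: "Sym_endo (plethysm (pw k))" using P unfolding is_plethysm_def by simp
  have "plethysm (pw k) (pw m) = adams (Suc k) (pw m)" for m
    using P unfolding is_plethysm_def adams_power_sum by simp
  then show ?thesis
    unfolding Q Sym_endo_ev [OF e Sym_power_sum] Sym_endo_ev [OF Sym_endo_adams Sym_power_sum] by simp
qed

lemma adams_one [simp]: "adams (Suc 0) g = g"
proof (rule adams_eqI)
  have r: "repeat_mset (Suc 0) \<beta> = \<beta>" for \<beta> :: "nat multiset" by simp
  show "coeff g (repeat_mset (Suc 0) \<beta>) = coeff g \<beta>" for \<beta> unfolding r ..
  show "coeff g \<alpha> = 0" if "\<And>\<beta>. \<alpha> \<noteq> repeat_mset (Suc 0) \<beta>" for \<alpha>
    using that [of \<alpha>] unfolding r by simp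
qed

lemma complete_one: "complete 1 = pw 0"
proof (rule mseries_eqI)
  fix \<alpha> :: "nat multiset"
  have "size \<alpha> = 1 \<longleftrightarrow> (\<exists>i. \<alpha> = replicate_mset (Suc 0) i)" by (auto simp: size_1_singleton_mset)
  then show "coeff (complete 1) \<alpha> = coeff (pw 0) \<alpha>" by (simp add: complete.rep_eq coeff_power_sum)
qed

lemma elementary_one: "elementary 1 = pw 0"
proof (rule mseries_eqI)
  fix \<alpha> :: "nat multiset"
  have "size \<alpha> = 1 \<and> (\<forall>i. count \<alpha> i \<le> 1) \<longleftrightarrow> (\<exists>i. \<alpha> = replicate_mset (Suc 0) i)"
    by (auto simp: size_1_singleton_mset dest!: size_1_singleton_mset)
  then show "coeff (elementary 1) \<alpha> = coeff (pw 0) \<alpha>" by (simp add: elementary.rep_eq coeff_power_sum)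
qed

lemma complete_zero [simp]: "complete 0 = 1"
  by (rule mseries_eqI) (simp add: complete.rep_eq coeff_one)

lemma elementary_zero [simp]: "elementary 0 = 1"
  by (rule mseries_eqI) (auto simp: elementary.rep_eq coeff_one)

lemma adams_pw0: "adams 2 (pw 0) = pw 1"
  using adams_power_sum [of 1 1] by (simp add: numeral_2_eq_2)

text \<open>The case m = 1 of \<open>adams_complete\<close> reads p_2 = 2 h_2 - p_1^2.\<close>

lemma complete_two: "complete 2 = scale (1 / 2) (pw 0 * pw 0 + pw 1)"
proof -
  have "pw 1 = (\<Sum>k\<le>2. scale ((- 1) ^ k) (complete k * complete (2 - k)))"
    using adams_complete [of 1] unfolding complete_one adams_pw0 by simp
  also have "\<dots> = complete 2 + complete 2 - pw 0 * pw 0"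
    by (rule mseries_eqI) (simp add: numeral_2_eq_2 complete_one [simplified])
  finally have "coeff (pw 1) \<alpha> = coeff (complete 2) \<alpha> + coeff (complete 2) \<alpha> - coeff (pw 0 * pw 0) \<alpha>" for \<alpha>
    by (simp only: coeff_diff coeff_add)
  then show ?thesis by (intro mseries_eqI) (simp only: coeff_scale coeff_add, simp)
qed

text \<open>The case m = 1 of \<open>adams_elementary\<close> reads p_2 = p_1^2 - 2 e_2.\<close>

lemma elementary_two: "elementary 2 = scale (1 / 2) (pw 0 * pw 0 - pw 1)"
proof -
  have "pw 1 = scale (- 1) (\<Sum>k\<le>2. scale ((- 1) ^ k) (elementary k * elementary (2 - k)))"
    using adams_elementary [of 1] unfolding elementary_one adams_pw0 by simp
  also have "\<dots> = pw 0 * pw 0 - (elementary 2 + elementary 2)"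
    by (rule mseries_eqI) (simp add: numeral_2_eq_2 elementary_one [simplified])
  finally have "coeff (pw 1) \<alpha> = coeff (pw 0 * pw 0) \<alpha> - (coeff (elementary 2) \<alpha> + coeff (elementary 2) \<alpha>)" for \<alpha>
    by (simp only: coeff_diff coeff_add)
  then show ?thesis by (intro mseries_eqI) (simp only: coeff_scale coeff_diff, simp)
qed

lemma plethysm_complete_two:
  assumes g: "g \<in> Sym"
  shows "plethysm (complete 2) g = scale (1 / 2) (g * g + adams 2 g)"
    and "plethysm (elementary 2) g = scale (1 / 2) (g * g - adams 2 g)"
proof -
  have e: "Sym_endo (\<lambda>f. plethysm f g)" using is_plethysm_plethysm g unfolding is_plethysm_def by blast
  have add: "plethysm (f + h) g = plethysm f g + plethysm h g"
    and mult: "plethysm (f * h) g = plethysm f g * plethysm h g"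
    and scale: "plethysm (scale c f) g = scale c (plethysm f g)" if "f \<in> Sym" "h \<in> Sym" for c f h
    using e that unfolding Sym_endo_def by blast+
  have p1: "plethysm (pw 0) g = g" and p2: "plethysm (pw 1) g = adams 2 g"
    using plethysm_power_sum [OF g, of 0] plethysm_power_sum [OF g, of 1] by (simp_all add: numeral_2_eq_2)
  have sym: "pw 0 * pw 0 \<in> Sym" "pw 1 \<in> Sym" "scale (- 1) (pw 1) \<in> Sym"
    by (intro Sym_mult Sym_power_sum Sym_scale)+
  show "plethysm (complete 2) g = scale (1 / 2) (g * g + adams 2 g)"
    unfolding complete_two
    by (simp only: scale [OF Sym_add [OF sym(1,2)] sym(1)] add [OF sym(1,2)]
        mult [OF Sym_power_sum Sym_power_sum] p1 p2)
  have minus: "f - h = f + scale (- 1) h" for f h by (rule mseries_eqI) simp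
  show "plethysm (elementary 2) g = scale (1 / 2) (g * g - adams 2 g)"
    unfolding elementary_two minus
    by (simp only: scale [OF Sym_add [OF sym(1,3)] sym(1)] add [OF sym(1,3)] scale [OF sym(2,2)]
        mult [OF Sym_power_sum Sym_power_sum] p1 p2)
qed

section \<open>The Pieri rules\<close>

definition S :: "(nat \<Rightarrow> nat) \<Rightarrow> mseries" where
  "S f = schur (shape_list f)"

lemma coeff_S: "f \<in> shapes \<Longrightarrow> coeff (S f) \<alpha> = of_nat (card (SYT f (count \<alpha>)))"
  by (simp add: S_def schur.rep_eq SSYT_eq partition_shape_list nth_default_shape_list)

lemma coeff_S_strip:
  assumes f: "f \<in> shapes" and lt: "\<And>x. x \<in># \<alpha> \<Longrightarrow> x < n"
  shows "coeff (S f) (\<alpha> + replicate_mset a n) = (\<Sum>g\<in>down f a. coeff (S g) \<alpha>)"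
proof -
  let ?\<beta> = "\<alpha> + replicate_mset a n"
  have n: "n \<notin># \<alpha>" using lt by blast
  have "count ?\<beta> k = 0" if "n < k" for k
  proof -
    have "k \<notin># \<alpha>" using lt [of k] that by auto
    then show ?thesis using that by (simp add: not_in_iff)
  qed
  note sum = SYT_strip_sum [where F = "\<lambda>_. 1 :: rat" and \<alpha> = "count ?\<beta>" and n = n, OF f this]
  moreover have "count ?\<beta> n = a" using n by (simp add: not_in_iff)
  moreover have "(count ?\<beta>)(n := 0) = count \<alpha>" using n by (auto simp: not_in_iff)
  ultimately have "of_nat (card (SYT f (count ?\<beta>))) = (\<Sum>g\<in>down f a. rat_of_nat (card (SYT g (count \<alpha>))))"
    by simp
  moreover have "(\<Sum>g\<in>down f a. rat_of_nat (card (SYT g (count \<alpha>)))) = (\<Sum>g\<in>down f a. coeff (S g) \<alpha>)"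
    by (rule sum.cong) (auto simp: coeff_S down_def)
  ultimately show ?thesis using coeff_S [OF f] by simp
qed

lemma coeff_S_empty: "f \<in> shapes \<Longrightarrow> coeff (S f) {#} = (if f = (\<lambda>_. 0) then 1 else 0)"
  using SYT_zero_content [of f] by (simp add: coeff_S zero_multiset.rep_eq)

lemma coeff_S_size: "f \<in> shapes \<Longrightarrow> coeff (S f) \<alpha> \<noteq> 0 \<Longrightarrow> size \<alpha> = wt f"
proof (induction \<alpha> arbitrary: f rule: letter_induct)
  case 1
  then show ?case by (auto simp: coeff_S_empty split: if_splits)
next
  case (2 n \<alpha> a)
  have "(\<Sum>g\<in>down f a. coeff (S g) \<alpha>) \<noteq> 0"
    using 2(4) coeff_S_strip [OF 2(3) 2(1)] by simp
  then obtain g where "g \<in> down f a" "coeff (S g) \<alpha> \<noteq> 0" by (meson sum.not_neutral_contains_not_neutral)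
  then show ?case using 2(2) [of g] by (simp add: down_def)
qed

lemma S_zero: "S (\<lambda>_. 0) = 1"
proof (rule mseries_eqI)
  fix \<alpha>
  show "coeff (S (\<lambda>_. 0)) \<alpha> = coeff 1 \<alpha>"
    using coeff_S_size [OF zero_shapes, of \<alpha>] coeff_S_empty [OF zero_shapes] by (auto simp: coeff_one)
qed

section \<open>Horizontal strips: local growth rule and Pieri rule\<close>

text \<open>The local rule of Fomin's growth diagrams: given \<open>\<nu>\<close> and \<open>\<kappa>\<close>, it exchanges the common
  enlargements \<open>\<rho>\<close> of both by horizontal strips with the common reductions, together with the excess
  in the first row.\<close>

definition reflect :: "(nat \<Rightarrow> nat) \<Rightarrow> (nat \<Rightarrow> nat) \<Rightarrow> (nat \<Rightarrow> nat) \<Rightarrow> nat \<Rightarrow> nat" where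
  "reflect \<nu> \<kappa> \<rho> i = min (\<nu> i) (\<kappa> i) + max (\<nu> (Suc i)) (\<kappa> (Suc i)) - \<rho> (Suc i)"

definition unreflect :: "(nat \<Rightarrow> nat) \<Rightarrow> (nat \<Rightarrow> nat) \<Rightarrow> nat \<Rightarrow> (nat \<Rightarrow> nat) \<Rightarrow> nat \<Rightarrow> nat" where
  "unreflect \<nu> \<kappa> d g i = (case i of 0 \<Rightarrow> max (\<nu> 0) (\<kappa> 0) + d
     | Suc i \<Rightarrow> min (\<nu> i) (\<kappa> i) + max (\<nu> (Suc i)) (\<kappa> (Suc i)) - g i)"

text \<open>Row \<open>Suc i\<close> of \<rho> ranges between the maximum of \<nu>, \<kappa> in row
  \<open>Suc i\<close> and their minimum in row \<open>i\<close>. Reflecting in this interval gives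
  row \<open>i\<close> of the common reduction, for which the same interval expresses interlacing.
  Row 0 of \<rho> is unbounded above, so its excess is recorded separately.\<close>

lemma reflect:
  assumes "\<rho> \<in> shapes" and h: "hstrip \<rho> \<nu>" "hstrip \<rho> \<kappa>"
  shows "hstrip \<nu> (reflect \<nu> \<kappa> \<rho>)" (is "hstrip _ ?g") "hstrip \<kappa> (reflect \<nu> \<kappa> \<rho>)"
    and "unreflect \<nu> \<kappa> (\<rho> 0 - max (\<nu> 0) (\<kappa> 0)) (reflect \<nu> \<kappa> \<rho>) = \<rho>"
    and "wt (reflect \<nu> \<kappa> \<rho>) + wt \<rho> = wt \<nu> + wt \<kappa> + (\<rho> 0 - max (\<nu> 0) (\<kappa> 0))"
proof -
  have b: "\<nu> i \<le> \<rho> i" "\<kappa> i \<le> \<rho> i" "\<rho> (Suc i) \<le> \<nu> i" "\<rho> (Suc i) \<le> \<kappa> i" for i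
    using h by (auto simp: hstrip_def)
  have "?g i \<le> \<nu> i \<and> ?g i \<le> \<kappa> i \<and>
      \<nu> (Suc i) \<le> ?g i \<and> \<kappa> (Suc i) \<le> ?g i" for i
    using b [of i] b [of "Suc i"] unfolding reflect_def by linarith
  then show "hstrip \<nu> ?g" "hstrip \<kappa> ?g"
    by (simp_all add: hstrip_def)
  show "unreflect \<nu> \<kappa> (\<rho> 0 - max (\<nu> 0) (\<kappa> 0)) ?g = \<rho>"
  proof
    fix i show "unreflect \<nu> \<kappa> (\<rho> 0 - max (\<nu> 0) (\<kappa> 0)) ?g i = \<rho> i"
    proof (cases i)
      case 0
      then show ?thesis using b [of 0] by (simp add: unreflect_def)
    next
      case (Suc j)
      then show ?thesis using b [of j] b [of "Suc j"] by (simp add: unreflect_def reflect_def)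
    qed
  qed
  obtain N where N: "\<And>i. N \<le> i \<Longrightarrow> \<rho> i = 0"
    using finite_support_bound [OF shapes_finite [OF assms(1)]] by blast
  have N': "\<nu> i = 0" "\<kappa> i = 0" if "N \<le> i" for i using b [of i] N [OF that] by auto
  have wr: "wt \<rho> = \<rho> 0 + (\<Sum>i<N. \<rho> (Suc i))"
    by (subst wt_bound [of "Suc N"]) (auto simp: N sum.lessThan_Suc_shift simp del: sum.lessThan_Suc)
  have wg: "wt ?g = (\<Sum>i<N. ?g i)"
    by (rule wt_bound) (auto simp: reflect_def N N')
  have "(\<Sum>i<N. ?g i) + (\<Sum>i<N. \<rho> (Suc i)) =
      (\<Sum>i<N. min (\<nu> i) (\<kappa> i) + max (\<nu> (Suc i)) (\<kappa> (Suc i)))"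
    unfolding sum.distrib [symmetric]
  proof (rule sum.cong)
    fix i show "?g i + \<rho> (Suc i) = min (\<nu> i) (\<kappa> i) + max (\<nu> (Suc i)) (\<kappa> (Suc i))"
      using b [of i] b [of "Suc i"] unfolding reflect_def by linarith
  qed simp
  also have "\<dots> = (\<Sum>i<N. min (\<nu> i) (\<kappa> i)) + (\<Sum>i<N. max (\<nu> (Suc i)) (\<kappa> (Suc i)))"
    by (rule sum.distrib)
  finally have e: "(\<Sum>i<N. ?g i) + (\<Sum>i<N. \<rho> (Suc i)) = \<dots>" .
  \<comment> \<open>The maxima entered shifted by one row; the missing one of row 0 is part of
    \<open>\<rho> 0\<close>, which exceeds it by the recorded amount. Minima and maxima of equal
    rows then add up to both weights.\<close>
  have "(\<Sum>i<Suc N. max (\<nu> i) (\<kappa> i)) = max (\<nu> 0) (\<kappa> 0) + (\<Sum>i<N. max (\<nu> (Suc i)) (\<kappa> (Suc i)))"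
    by (rule sum.lessThan_Suc_shift)
  moreover have "(\<Sum>i<Suc N. max (\<nu> i) (\<kappa> i)) = (\<Sum>i<N. max (\<nu> i) (\<kappa> i))" by (simp add: N')
  moreover have "(\<Sum>i<N. min (\<nu> i) (\<kappa> i)) + (\<Sum>i<N. max (\<nu> i) (\<kappa> i)) = wt \<nu> + wt \<kappa>"
  proof -
    have "wt \<nu> = sum \<nu> {..<N}" "wt \<kappa> = sum \<kappa> {..<N}" by (rule wt_bound; simp add: N')+
    then show ?thesis unfolding sum.distrib [symmetric] by (auto intro!: sum.cong simp flip: sum.distrib)
  qed
  moreover have "max (\<nu> 0) (\<kappa> 0) \<le> \<rho> 0" using b [of 0] by simp
  ultimately show "wt ?g + wt \<rho> = wt \<nu> + wt \<kappa> + (\<rho> 0 - max (\<nu> 0) (\<kappa> 0))"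
    using wr wg e by linarith
qed

lemma unreflect:
  assumes "\<nu> \<in> shapes" "\<kappa> \<in> shapes" and h: "hstrip \<nu> g" "hstrip \<kappa> g"
  shows "unreflect \<nu> \<kappa> d g \<in> shapes" (is "?u \<in> _") "hstrip (unreflect \<nu> \<kappa> d g) \<nu>" "hstrip (unreflect \<nu> \<kappa> d g) \<kappa>"
    and "reflect \<nu> \<kappa> (unreflect \<nu> \<kappa> d g) = g"
    and "unreflect \<nu> \<kappa> d g 0 - max (\<nu> 0) (\<kappa> 0) = d"
proof -
  have b: "g i \<le> \<nu> i" "g i \<le> \<kappa> i" "\<nu> (Suc i) \<le> g i" "\<kappa> (Suc i) \<le> g i" for i
    using h by (auto simp: hstrip_def)
  have "\<nu> i \<le> ?u i \<and> \<kappa> i \<le> ?u i" for i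
  proof (cases i)
    case (Suc j)
    then show ?thesis using b [of j] by (simp add: unreflect_def) linarith
  qed (simp add: unreflect_def trans_le_add1)
  moreover have "?u (Suc i) \<le> \<nu> i \<and> ?u (Suc i) \<le> \<kappa> i" for i
    using b [of i] by (simp add: unreflect_def) linarith
  ultimately show "hstrip ?u \<nu>" "hstrip ?u \<kappa>"
    by (auto simp: hstrip_def)
  then show "?u \<in> shapes" using hstrip_shapes_iff assms(1) by blast
  show "reflect \<nu> \<kappa> ?u = g"
  proof
    fix i show "reflect \<nu> \<kappa> ?u i = g i"
      using b [of i] by (simp add: unreflect_def reflect_def)
  qed
  show "?u 0 - max (\<nu> 0) (\<kappa> 0) = d" by (simp add: unreflect_def)
qed

text \<open>The commutation relation between adding and removing horizontal strips; \<open>d\<close>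
  is the excess in the first row.\<close>

lemma up_down_sum:
  fixes F :: "(nat \<Rightarrow> nat) \<Rightarrow> rat"
  assumes \<nu>: "\<nu> \<in> shapes"
  shows "(\<Sum>\<rho>\<in>up \<nu> m. \<Sum>\<kappa>\<in>down \<rho> a. F \<kappa>) =
    (\<Sum>d\<le>a. \<Sum>g\<in>down \<nu> (a - d). \<Sum>\<kappa>\<in>(if d \<le> m then up g (m - d) else {}). F \<kappa>)"
proof -
  let ?A = "SIGMA \<rho> : up \<nu> m. down \<rho> a"
  let ?B = "SIGMA d : {..a}. SIGMA g : down \<nu> (a - d). if d \<le> m then up g (m - d) else {}"
  let ?i = "\<lambda>(\<rho>, \<kappa>). (\<rho> 0 - max (\<nu> 0) (\<kappa> 0), reflect \<nu> \<kappa> \<rho>, \<kappa>)"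
  let ?j = "\<lambda>(d, g, \<kappa>). (unreflect \<nu> \<kappa> d g, \<kappa>)"
  have "(\<Sum>(\<rho>, \<kappa>)\<in>?A. F \<kappa>) = (\<Sum>(d, g, \<kappa>)\<in>?B. F \<kappa>)"
  proof (rule sum.reindex_bij_witness [of _ ?j ?i])
    fix z assume "z \<in> ?A"
    then obtain \<rho> \<kappa> where z: "z = (\<rho>, \<kappa>)" and \<rho>: "\<rho> \<in> shapes" "hstrip \<rho> \<nu>" "wt \<rho> = wt \<nu> + m"
      and \<kappa>: "\<kappa> \<in> shapes" "hstrip \<rho> \<kappa>" "wt \<rho> = wt \<kappa> + a"
      by (auto simp: up_def down_def)
    note r = reflect [OF \<rho>(1,2) \<kappa>(2)]
    show "?j (?i z) = z" by (simp add: z r(3))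
    have gs: "reflect \<nu> \<kappa> \<rho> \<in> shapes" using hstrip_shapes_iff [OF r(1)] \<nu> by simp
    have "wt (reflect \<nu> \<kappa> \<rho>) \<le> wt \<nu>" "wt (reflect \<nu> \<kappa> \<rho>) \<le> wt \<kappa>"
      using r(1,2) \<nu> \<kappa>(1) by (auto intro!: wt_mono simp: hstrip_def)
    then show "?i z \<in> ?B" using r(1,2,4) gs \<rho> \<kappa> by (auto simp: z up_def down_def)
    show "(case ?i z of (d, g, \<kappa>) \<Rightarrow> F \<kappa>) = (case z of (\<rho>, \<kappa>) \<Rightarrow> F \<kappa>)" by (simp add: z)
  next
    fix z assume "z \<in> ?B"
    then obtain d g \<kappa> where z: "z = (d, g, \<kappa>)" and d: "d \<le> a" "d \<le> m"
      and g: "g \<in> shapes" "hstrip \<nu> g" "wt \<nu> = wt g + (a - d)"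
      and \<kappa>: "\<kappa> \<in> shapes" "hstrip \<kappa> g" "wt \<kappa> = wt g + (m - d)"
      by (auto simp: up_def down_def split: if_splits)
    note u = unreflect [OF \<nu> \<kappa>(1) g(2) \<kappa>(2), of d]
    show "?i (?j z) = z" by (simp add: z u(4,5))
    have "wt (unreflect \<nu> \<kappa> d g) + wt g = wt \<nu> + wt \<kappa> + d"
      using reflect(4) [OF u(1-3)] u(4,5) by simp
    then show "?j z \<in> ?A" using u(1-3) g \<kappa> d by (auto simp: z up_def down_def)
  qed
  then show ?thesis by (simp add: sum.Sigma)
qed

text \<open>Both sides obey the same recursion in the largest variable: on the left \<open>d\<close>
  of its \<open>a\<close> copies come from the complete function and the others remove a strip from
  \<open>f\<close>, and \<open>up_down_sum\<close> matches this with removing a strip from each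
  \<rho>.\<close>

lemma pieri_complete:
  assumes "f \<in> shapes"
  shows "S f * complete m = (\<Sum>\<rho>\<in>up f m. S \<rho>)"
proof (rule mseries_eqI)
  fix \<alpha>
  show "coeff (S f * complete m) \<alpha> = coeff (\<Sum>\<rho>\<in>up f m. S \<rho>) \<alpha>"
    using assms
  proof (induction \<alpha> arbitrary: f m rule: letter_induct)
    case 1
    have "splits {#} = {({#}, {#})}" by (auto simp: splits_def)
    then have l: "coeff (S f * complete m) {#} = (if f = (\<lambda>_. 0) \<and> m = 0 then 1 else 0)"
      using 1 by (simp add: coeff_mult coeff_S_empty complete.rep_eq)
    have r: "coeff (\<Sum>\<rho>\<in>up f m. S \<rho>) {#} = (\<Sum>\<rho>\<in>up f m. if \<rho> = (\<lambda>_. 0) then 1 else 0)"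
      unfolding coeff_sum by (rule sum.cong) (auto simp: up_def coeff_S_empty)
    have "(\<lambda>_. 0) \<in> up f m \<longleftrightarrow> f = (\<lambda>_. 0) \<and> m = 0"
      by (auto simp: up_def hstrip_def fun_eq_iff wt_def)
    then show ?case unfolding l r by (simp add: sum.delta')
  next
    case (2 n \<alpha> a)
    note lt = 2(1) and IH = 2(2) and f = 2(3)
    have n: "n \<notin># \<alpha>" using lt by blast
    let ?L = "\<lambda>d \<beta> \<gamma>. coeff (S f) (\<beta> + replicate_mset (a - d) n) * coeff (complete m) (\<gamma> + replicate_mset d n)"
    let ?M = "\<lambda>d g z. if d \<le> m then coeff (S g) (fst z) * coeff (complete (m - d)) (snd z) else 0"
    let ?R = "\<lambda>d g. \<Sum>\<kappa>\<in>(if d \<le> m then up g (m - d) else {}). coeff (S \<kappa>) \<alpha>"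
    have "coeff (S f * complete m) (\<alpha> + replicate_mset a n) =
      (\<Sum>d\<le>a. \<Sum>(\<beta>, \<gamma>)\<in>splits \<alpha>. ?L d \<beta> \<gamma>)"
      unfolding coeff_mult by (rule sum_splits_add [OF n])
    also have "\<dots> = (\<Sum>d\<le>a. \<Sum>g\<in>down f (a - d). ?R d g)"
    proof (rule sum.cong)
      fix d
      have h: "coeff (complete m) (\<gamma> + replicate_mset d n) =
          (if d \<le> m then coeff (complete (m - d)) \<gamma> else 0)" for \<gamma>
        by (auto simp: complete.rep_eq)
      have "(\<Sum>(\<beta>, \<gamma>)\<in>splits \<alpha>. ?L d \<beta> \<gamma>) =
         (\<Sum>z\<in>splits \<alpha>. \<Sum>g\<in>down f (a - d). ?M d g z)"
      proof (rule sum.cong)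
        fix z assume z: "z \<in> splits \<alpha>"
        then have "x < n" if "x \<in># fst z" for x using that lt by (auto simp: splits_def)
        then show "(case z of (\<beta>, \<gamma>) \<Rightarrow> ?L d \<beta> \<gamma>) = (\<Sum>g\<in>down f (a - d). ?M d g z)"
          by (simp add: case_prod_beta coeff_S_strip [OF f] h sum_distrib_right)
      qed simp
      also have "\<dots> = (\<Sum>g\<in>down f (a - d). \<Sum>z\<in>splits \<alpha>. ?M d g z)"
        by (rule sum.swap)
      also have "\<dots> = (\<Sum>g\<in>down f (a - d). ?R d g)"
      proof (rule sum.cong)
        fix g assume "g \<in> down f (a - d)"
        then have "g \<in> shapes" by (simp add: down_def)
        from IH [OF this, of "m - d"] show "(\<Sum>z\<in>splits \<alpha>. ?M d g z) = ?R d g"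
          by (simp add: coeff_mult case_prod_beta)
      qed simp
      finally show "(\<Sum>(\<beta>, \<gamma>)\<in>splits \<alpha>. ?L d \<beta> \<gamma>) =
         (\<Sum>g\<in>down f (a - d). ?R d g)" .
    qed simp
    also have "\<dots> = (\<Sum>\<rho>\<in>up f m. \<Sum>\<kappa>\<in>down \<rho> a. coeff (S \<kappa>) \<alpha>)"
      by (rule up_down_sum [OF f, symmetric])
    also have "\<dots> = (\<Sum>\<rho>\<in>up f m. coeff (S \<rho>) (\<alpha> + replicate_mset a n))"
      by (rule sum.cong) (auto simp: coeff_S_strip [OF _ lt] up_def)
    finally show ?case by simp
  qed
qed

section \<open>Vertical strips: Pieri rule by cancellation\<close>

definition vstrip :: "(nat \<Rightarrow> nat) \<Rightarrow> (nat \<Rightarrow> nat) \<Rightarrow> bool" where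
  "vstrip f g \<longleftrightarrow> (\<forall>i. g i \<le> f i \<and> f i \<le> Suc (g i))"

definition vup :: "(nat \<Rightarrow> nat) \<Rightarrow> nat \<Rightarrow> (nat \<Rightarrow> nat) set" where
  "vup g m = {f \<in> shapes. vstrip f g \<and> wt f = wt g + m}"

lemma finite_vup [simp]: "finite (vup g m)"
  by (rule finite_subset [OF _ finite_shapes [of "wt g + m"]]) (auto simp: vup_def)

lemma wt_fun_upd:
  assumes "f \<in> shapes"
  shows "wt (f(i := v)) + f i = wt f + v"
proof -
  obtain N where N: "\<And>k. N \<le> k \<Longrightarrow> f k = 0"
    using finite_support_bound [OF shapes_finite [OF assms]] by blast
  let ?N = "max N (Suc i)"
  have s: "sum h {..<?N} = h i + sum h ({..<?N} - {i})" for h :: "nat \<Rightarrow> nat"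
    by (rule sum.remove) auto
  have "sum (f(i := v)) ({..<?N} - {i}) = sum f ({..<?N} - {i})" by (rule sum.cong) auto
  moreover have "wt f = sum f {..<?N}" "wt (f(i := v)) = sum (f(i := v)) {..<?N}"
    by (rule wt_bound; use N in auto)+
  ultimately show ?thesis using s [of f] s [of "f(i := v)"] by simp
qed

text \<open>Sign-reversing involution: in the last row where \<open>\<rho>\<close> exceeds \<open>f\<close>, the last box of the
  vertical strip can be moved to the horizontal strip and back.\<close>

lemma strip_cancel:
  assumes f: "f \<in> shapes" and \<rho>: "\<rho> \<in> shapes" and ne: "\<rho> \<noteq> f"
  shows "(\<Sum>\<sigma> | \<sigma> \<in> shapes \<and> vstrip \<sigma> f \<and> hstrip \<rho> \<sigma>. (- 1) ^ (wt \<rho> + wt \<sigma>)) = (0 :: rat)"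
proof -
  let ?A = "{\<sigma>. \<sigma> \<in> shapes \<and> vstrip \<sigma> f \<and> hstrip \<rho> \<sigma>}"
  let ?D = "{i. \<rho> i \<noteq> f i}"
  have "finite ?D"
    by (rule finite_subset [OF _ finite_UnI [OF shapes_finite [OF f] shapes_finite [OF \<rho>]]]) auto
  moreover have "?D \<noteq> {}" using ne by auto
  ultimately have k: "Max ?D \<in> ?D" by (rule Max_in)
  have kmax: "i \<le> Max ?D" if "i \<in> ?D" for i by (rule Max_ge [OF \<open>finite ?D\<close> that])
  define k where "k = Max ?D"
  have k1: "\<rho> k \<noteq> f k" using k by (simp add: k_def)
  have k2: "\<rho> i = f i" if "k < i" for i using kmax [of i] that unfolding k_def by fastforce
  define t where "t \<sigma> = \<sigma>(k := if \<sigma> k = f k then Suc (f k) else f k)" for \<sigma> :: "nat \<Rightarrow> nat"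
  have tt: "t (t \<sigma>) = \<sigma>" and tA: "t \<sigma> \<in> ?A"
    and sgn: "(- 1) ^ (wt \<rho> + wt (t \<sigma>)) = - ((- 1) ^ (wt \<rho> + wt \<sigma>) :: rat)" if \<sigma>: "\<sigma> \<in> ?A" for \<sigma>
  proof -
    have v: "f i \<le> \<sigma> i" "\<sigma> i \<le> Suc (f i)" and h: "\<sigma> i \<le> \<rho> i" "\<rho> (Suc i) \<le> \<sigma> i" for i
      using \<sigma> by (auto simp: vstrip_def hstrip_def)
    have sk: "\<sigma> k = f k \<or> \<sigma> k = Suc (f k)" using v [of k] by linarith
    then show "t (t \<sigma>) = \<sigma>" by (auto simp: t_def)
    have gt: "f k < \<rho> k" using v(1) [of k] h(1) [of k] k1 by linarith
    \<comment> \<open>As \<open>k\<close> is the last row where \<rho> and \<open>f\<close> differ,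
      the row below leaves room for \<open>\<sigma> k = f k\<close>; in row \<open>k\<close> itself
      \<rho> leaves room for \<open>Suc (f k)\<close>.\<close>
    have "\<rho> (Suc k) \<le> f k" using k2 [of "Suc k"] shapes_antimono [OF f, of k "Suc k"] by simp
    then have h': "hstrip \<rho> (t \<sigma>)" using h gt by (auto simp: hstrip_def t_def)
    moreover have "vstrip (t \<sigma>) f" using v by (auto simp: vstrip_def t_def)
    ultimately show "t \<sigma> \<in> ?A" using hstrip_shapes_iff [OF h'] \<rho> by simp
    have "wt (t \<sigma>) + \<sigma> k = wt \<sigma> + t \<sigma> k"
      using wt_fun_upd [of \<sigma> k "t \<sigma> k"] \<sigma> by (simp add: t_def)
    then have "wt (t \<sigma>) = Suc (wt \<sigma>) \<or> wt \<sigma> = Suc (wt (t \<sigma>))"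
      using sk by (auto simp: t_def split: if_splits)
    then show "(- 1) ^ (wt \<rho> + wt (t \<sigma>)) = - ((- 1) ^ (wt \<rho> + wt \<sigma>) :: rat)" by auto
  qed
  have "(\<Sum>\<sigma>\<in>?A. (- 1) ^ (wt \<rho> + wt \<sigma>)) = (\<Sum>\<sigma>\<in>?A. - ((- 1) ^ (wt \<rho> + wt \<sigma>)) :: rat)"
    by (rule sum.reindex_bij_witness [of _ t t]) (use tt tA sgn in \<open>auto simp del: mem_Collect_eq\<close>)
  then show ?thesis by (simp add: sum_negf)
qed

text \<open>Grouped by the outer shape \<rho>, with \<open>k = wt \<rho> - wt \<sigma>\<close> of
  the same parity as \<open>wt \<rho> + wt \<sigma>\<close>, each inner sum is that of
  \<open>strip_cancel\<close>; \<open>0 < m\<close> makes \<rho> differ from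
  \<open>f\<close>.\<close>

lemma strip_cancel_sum:
  fixes F :: "(nat \<Rightarrow> nat) \<Rightarrow> rat"
  assumes f: "f \<in> shapes" and m: "0 < m"
  shows "(\<Sum>k\<le>m. \<Sum>\<sigma>\<in>vup f (m - k). \<Sum>\<rho>\<in>up \<sigma> k. (- 1) ^ k * F \<rho>) = 0"
proof -
  let ?A = "SIGMA k : {..m}. SIGMA \<sigma> : vup f (m - k). up \<sigma> k"
  let ?B = "SIGMA \<rho> : {\<rho> \<in> shapes. wt \<rho> = wt f + m}. {\<sigma>. \<sigma> \<in> shapes \<and> vstrip \<sigma> f \<and> hstrip \<rho> \<sigma>}"
  have fin: "finite {\<sigma>. \<sigma> \<in> shapes \<and> vstrip \<sigma> f \<and> hstrip \<rho> \<sigma>}" if "\<rho> \<in> shapes" for \<rho>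
  proof (rule finite_subset)
    show "{\<sigma>. \<sigma> \<in> shapes \<and> vstrip \<sigma> f \<and> hstrip \<rho> \<sigma>} \<subseteq> (\<Union>n\<le>wt \<rho>. {\<sigma> \<in> shapes. wt \<sigma> = n})"
      using wt_mono [OF that] by (auto simp: hstrip_def)
  qed (use finite_shapes in auto)
  have "(\<Sum>(k, \<sigma>, \<rho>)\<in>?A. (- 1) ^ k * F \<rho>) = (\<Sum>(\<rho>, \<sigma>)\<in>?B. (- 1) ^ (wt \<rho> + wt \<sigma>) * F \<rho>)"
  proof (rule sum.reindex_bij_witness [of _ "\<lambda>(\<rho>, \<sigma>). (wt \<rho> - wt \<sigma>, \<sigma>, \<rho>)" "\<lambda>(k, \<sigma>, \<rho>). (\<rho>, \<sigma>)"])
    fix z assume "z \<in> ?B"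
    then obtain \<rho> \<sigma> where z: "z = (\<rho>, \<sigma>)" and *: "\<rho> \<in> shapes" "wt \<rho> = wt f + m" "\<sigma> \<in> shapes"
      "vstrip \<sigma> f" "hstrip \<rho> \<sigma>" by auto
    have "wt f \<le> wt \<sigma>" "wt \<sigma> \<le> wt \<rho>"
      using * wt_mono [of \<sigma> f] wt_mono [of \<rho> \<sigma>] by (auto simp: vstrip_def hstrip_def)
    then show "(case z of (\<rho>, \<sigma>) \<Rightarrow> (wt \<rho> - wt \<sigma>, \<sigma>, \<rho>)) \<in> ?A"
      using * by (simp add: z vup_def up_def)
  next
    fix z assume z: "z \<in> ?A"
    then show "(case z of (k, \<sigma>, \<rho>) \<Rightarrow> (\<rho>, \<sigma>)) \<in> ?B" by (auto simp: up_def vup_def)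
    show "(case case z of (k, \<sigma>, \<rho>) \<Rightarrow> (\<rho>, \<sigma>) of (\<rho>, \<sigma>) \<Rightarrow> (- 1) ^ (wt \<rho> + wt \<sigma>) * F \<rho>) =
        (case z of (k, \<sigma>, \<rho>) \<Rightarrow> (- 1) ^ k * F \<rho>)"
      using z by (auto simp: up_def power_add)
  qed (auto simp: up_def)
  also have "\<dots> = (\<Sum>\<rho> | \<rho> \<in> shapes \<and> wt \<rho> = wt f + m. \<Sum>\<sigma> | \<sigma> \<in> shapes \<and> vstrip \<sigma> f \<and> hstrip \<rho> \<sigma>.
      (- 1) ^ (wt \<rho> + wt \<sigma>) * F \<rho>)"
    by (rule sum.Sigma [symmetric]) (use fin finite_shapes in auto)
  also have "\<dots> = (\<Sum>\<rho> | \<rho> \<in> shapes \<and> wt \<rho> = wt f + m. 0)"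
  proof (rule sum.cong)
    fix \<rho> assume "\<rho> \<in> {\<rho>. \<rho> \<in> shapes \<and> wt \<rho> = wt f + m}"
    then have "\<rho> \<in> shapes" "\<rho> \<noteq> f" using m by auto
    from strip_cancel [OF f this]
    show "(\<Sum>\<sigma> | \<sigma> \<in> shapes \<and> vstrip \<sigma> f \<and> hstrip \<rho> \<sigma>. (- 1) ^ (wt \<rho> + wt \<sigma>) * F \<rho>) = 0"
      by (simp flip: sum_distrib_right)
  qed simp
  finally show ?thesis by (simp add: sum.Sigma)
qed

lemma eq_of_wt_eq:
  assumes f: "f \<in> shapes" and le: "\<And>i. g i \<le> f i" and wt: "wt g = wt f"
  shows "g = f"
proof -
  obtain N where N: "\<And>i. N \<le> i \<Longrightarrow> f i = 0"
    using finite_support_bound [OF shapes_finite [OF f]] by blast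
  have N': "g i = 0" if "N \<le> i" for i using N [OF that] le [of i] by simp
  have eq: "sum g {..<N} = sum f {..<N}" using wt wt_bound [of N f, OF N] wt_bound [of N g, OF N'] by simp
  show ?thesis
  proof
    fix i show "g i = f i"
    proof (cases "i < N")
      case True
      then show ?thesis using sum_mono_inv [OF eq le] by simp
    qed (simp add: N N')
  qed
qed

lemma vup_zero:
  assumes "f \<in> shapes"
  shows "vup f 0 = {f}"
proof -
  have "\<rho> = f" if "\<rho> \<in> vup f 0" for \<rho>
    by (rule eq_of_wt_eq [of \<rho> f, symmetric]) (use that in \<open>auto simp: vup_def vstrip_def\<close>)
  moreover have "f \<in> vup f 0" using assms by (simp add: vup_def vstrip_def)
  ultimately show ?thesis by blast
qed

lemma up_zero:
  assumes "f \<in> shapes"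
  shows "up f 0 = {f}"
proof -
  have "\<rho> = f" if "\<rho> \<in> up f 0" for \<rho>
    by (rule eq_of_wt_eq [of \<rho> f, symmetric]) (use that in \<open>auto simp: up_def hstrip_def\<close>)
  moreover have "f \<in> up f 0" using assms by (simp add: up_def hstrip_def shapes_def)
  ultimately show ?thesis by blast
qed

text \<open>The alternating relation between complete and elementary functions expresses the case
  \<open>m\<close> by smaller ones. By induction and \<open>pieri_complete\<close>, the product and
  the sum over vertical strips are both the negative of the same expression.\<close>

lemma pieri_elementary:
  assumes "f \<in> shapes"
  shows "S f * elementary m = (\<Sum>\<rho>\<in>vup f m. S \<rho>)"
proof (induction m rule: less_induct)
  case (less m)
  show ?case
  proof (cases "m = 0")
    case True
    then show ?thesis using vup_zero [OF assms] by simp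
  next
    case False
    let ?t = "\<lambda>k. \<Sum>\<sigma>\<in>vup f (m - k). \<Sum>\<rho>\<in>up \<sigma> k. S \<rho>"
    have split: "{..m} = insert 0 {1..m}" using False by auto
    have "(\<Sum>k\<le>m. scale ((- 1) ^ k) (S f * elementary (m - k) * complete k)) =
        S f * (\<Sum>k\<le>m. scale ((- 1) ^ k) (complete k * elementary (m - k)))"
      by (simp add: sum_distrib_left scale_mult_right mult_ac)
    also have "\<dots> = 0" using alternating_complete_elementary [of m] False by simp
    finally have 0: "(\<Sum>k\<le>m. scale ((- 1) ^ k) (S f * elementary (m - k) * complete k)) = 0" .
    have "scale ((- 1) ^ k) (S f * elementary (m - k) * complete k) = scale ((- 1) ^ k) (?t k)"
      if "k \<in> {1..m}" for k
    proof -
      have "S f * elementary (m - k) * complete k = (\<Sum>\<sigma>\<in>vup f (m - k). S \<sigma> * complete k)"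
        using less [of "m - k"] that by (simp add: sum_distrib_right)
      also have "\<dots> = ?t k"
        by (rule sum.cong) (auto simp: pieri_complete vup_def)
      finally show ?thesis by simp
    qed
    then have "S f * elementary m + (\<Sum>k\<in>{1..m}. scale ((- 1) ^ k) (?t k)) = 0"
      using 0 unfolding split by simp
    moreover have "(\<Sum>\<rho>\<in>vup f m. S \<rho>) + (\<Sum>k\<in>{1..m}. scale ((- 1) ^ k) (?t k)) = 0"
    proof -
      have t0: "?t 0 = (\<Sum>\<rho>\<in>vup f m. S \<rho>)"
        by (auto intro!: sum.cong simp: up_zero vup_def)
      have "(\<Sum>k\<le>m. scale ((- 1) ^ k) (?t k)) = 0"
      proof (rule mseries_eqI)
        fix \<alpha>
        show "coeff (\<Sum>k\<le>m. scale ((- 1) ^ k) (?t k)) \<alpha> = coeff 0 \<alpha>"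
          using strip_cancel_sum [OF assms, of m "\<lambda>\<rho>. coeff (S \<rho>) \<alpha>"] False
          by (simp add: sum_distrib_left)
      qed
      then show ?thesis unfolding split by (simp add: t0 [simplified])
    qed
    ultimately show ?thesis by (simp add: add_eq_0_iff2)
  qed
qed

section \<open>Conjugation\<close>

definition conj_shape :: "(nat \<Rightarrow> nat) \<Rightarrow> nat \<Rightarrow> nat" where
  "conj_shape f j = card {i. j < f i}"

text \<open>The transposed diagram is again an ideal, and the row lengths of its shape are the
  column lengths of \<open>f\<close>. Facts on conjugation follow by comparing the numbers below
  each value.\<close>

lemma conj_shape_less: "f \<in> shapes \<Longrightarrow> i < conj_shape f j \<longleftrightarrow> j < f i"
proof -
  assume f: "f \<in> shapes"
  let ?D = "(diag f)\<inverse>"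
  have "ideal ?D"
    unfolding ideal_def using idealD [OF ideal_diag [OF f]] by blast
  moreover have "finite ?D" using f by simp
  ultimately obtain g where g: "g \<in> shapes" "?D = diag g" by (rule ideal_shape)
  have eq: "j < f i \<longleftrightarrow> i < g j" for i j
  proof -
    have "(j, i) \<in> ?D \<longleftrightarrow> (i, j) \<in> diag f" by blast
    then show ?thesis unfolding g(2) by simp
  qed
  have "{i. j < f i} = {..<g j}" by (simp add: eq lessThan_def)
  then have "conj_shape f j = g j" unfolding conj_shape_def by (simp only: card_lessThan)
  then show ?thesis by (simp only: eq)
qed

lemma conj_shape_shapes: "f \<in> shapes \<Longrightarrow> conj_shape f \<in> shapes"
proof -
  assume f: "f \<in> shapes"
  have "conj_shape f (Suc j) \<le> conj_shape f j" for j
  proof (rule ccontr)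
    assume "\<not> conj_shape f (Suc j) \<le> conj_shape f j"
    then have "Suc j < f (conj_shape f j)" using conj_shape_less [OF f, of "conj_shape f j" "Suc j"] by simp
    then have "conj_shape f j < conj_shape f j" unfolding conj_shape_less [OF f] by simp
    then show False by simp
  qed
  moreover have "conj_shape f j = 0" if "f 0 \<le> j" for j
  proof (rule ccontr)
    assume "conj_shape f j \<noteq> 0"
    then have "0 < conj_shape f j" by simp
    then show False using that unfolding conj_shape_less [OF f] by simp
  qed
  then have "{j. conj_shape f j \<noteq> 0} \<subseteq> {..<f 0}" by (metis (mono_tags) lessThan_iff mem_Collect_eq not_le subsetI)
  then have "finite {j. conj_shape f j \<noteq> 0}" by (rule finite_subset) simp
  ultimately show ?thesis by (simp add: shapes_def)
qed

lemma nat_eqI: "(\<And>k. k < a \<longleftrightarrow> k < b) \<Longrightarrow> a = (b :: nat)"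
  by (metis linorder_neqE_nat less_irrefl)

lemma conj_shape_conj: "f \<in> shapes \<Longrightarrow> conj_shape (conj_shape f) = f"
  by (intro ext nat_eqI) (simp add: conj_shape_less conj_shape_shapes)

lemma diag_conj: "f \<in> shapes \<Longrightarrow> diag (conj_shape f) = (diag f)\<inverse>"
  by (auto simp: conj_shape_less diag_def)

lemma wt_conj: "f \<in> shapes \<Longrightarrow> wt (conj_shape f) = wt f"
proof -
  assume f: "f \<in> shapes"
  have "card (diag (conj_shape f)) = card (diag f)"
    unfolding diag_conj [OF f] by (rule card_inverse)
  then show ?thesis using f by (simp add: card_diag shapes_finite conj_shape_shapes del: neq0_conv)
qed

lemma vstrip_conj:
  assumes "f \<in> shapes" "g \<in> shapes"
  shows "vstrip (conj_shape f) (conj_shape g) \<longleftrightarrow> hstrip f g"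
proof -
  have le: "a \<le> b \<longleftrightarrow> (\<forall>k. k < a \<longrightarrow> k < b)" for a b :: nat
    by (cases "a \<le> b") (auto simp: not_le)
  have le_Suc: "a \<le> Suc b \<longleftrightarrow> (\<forall>k. Suc k < a \<longrightarrow> k < b)" for a b :: nat
    by (cases a) (simp_all add: le [of _ b])
  have "(\<forall>i. conj_shape g i \<le> conj_shape f i) \<longleftrightarrow> (\<forall>i. g i \<le> f i)"
    unfolding le conj_shape_less [OF assms(1)] conj_shape_less [OF assms(2)] by blast
  moreover have "(\<forall>i. conj_shape f i \<le> Suc (conj_shape g i)) \<longleftrightarrow> (\<forall>i. f (Suc i) \<le> g i)"
    unfolding le_Suc unfolding le conj_shape_less [OF assms(1)] conj_shape_less [OF assms(2)] by blast
  ultimately show ?thesis unfolding vstrip_def hstrip_def by blast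
qed

text \<open>Indexed by conjugate shapes, the rule for \<open>elementary\<close> runs over
  \<open>up\<close> just as \<open>pieri_complete\<close> does.\<close>

lemma pieri_elementary_conj:
  assumes g: "g \<in> shapes"
  shows "S (conj_shape g) * elementary m = (\<Sum>\<rho>\<in>up g m. S (conj_shape \<rho>))"
proof -
  have "(\<Sum>\<rho>\<in>vup (conj_shape g) m. S \<rho>) = (\<Sum>\<rho>\<in>up g m. S (conj_shape \<rho>))"
  proof (rule sum.reindex_bij_witness [of _ conj_shape conj_shape])
    fix \<rho> assume "\<rho> \<in> vup (conj_shape g) m"
    then have \<rho>: "\<rho> \<in> shapes" "vstrip \<rho> (conj_shape g)" "wt \<rho> = wt g + m"
      using wt_conj [OF g] by (auto simp: vup_def)
    show "conj_shape (conj_shape \<rho>) = \<rho>" using \<rho>(1) by (rule conj_shape_conj)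
    then have "hstrip (conj_shape \<rho>) g"
      using vstrip_conj [OF conj_shape_shapes [OF \<rho>(1)] g] \<rho>(2) by simp
    then show "conj_shape \<rho> \<in> up g m" using \<rho> by (simp add: up_def conj_shape_shapes wt_conj)
    show "S (conj_shape (conj_shape \<rho>)) = S \<rho>" using \<rho>(1) by (simp add: conj_shape_conj)
  next
    fix \<rho> assume "\<rho> \<in> up g m"
    then have \<rho>: "\<rho> \<in> shapes" "hstrip \<rho> g" "wt \<rho> = wt g + m" by (auto simp: up_def)
    show "conj_shape (conj_shape \<rho>) = \<rho>" using \<rho>(1) by (rule conj_shape_conj)
    show "conj_shape \<rho> \<in> vup (conj_shape g) m"
      using \<rho> vstrip_conj [OF \<rho>(1) g] by (simp add: vup_def conj_shape_shapes wt_conj g)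
  qed
  then show ?thesis using pieri_elementary [OF conj_shape_shapes [OF g]] by simp
qed

section \<open>The sign identity for two-letter words\<close>

text \<open>Rows are read from bottom to top.  A row contributes \<open>a\<close> closing parentheses followed by
  \<open>c - a\<close> opening ones; the state \<open>(u, h)\<close> counts the unmatched closing and opening parentheses.\<close>

fun step :: "nat \<Rightarrow> nat \<Rightarrow> nat \<times> nat \<Rightarrow> nat \<times> nat" where
  "step c a (u, h) = (if a \<le> h then (u, h - a + (c - a)) else (u + (a - h), c - a))"

fun word_state :: "nat list \<Rightarrow> nat list \<Rightarrow> nat \<times> nat" where
  "word_state (c # cs) (a # as) = step c a (word_state cs as)"
| "word_state _ _ = (0, 0)"

fun word_pairs :: "nat list \<Rightarrow> nat list \<Rightarrow> nat" where
  "word_pairs (c # cs) (a # as) = min (sum_list cs - sum_list as) (a + word_pairs cs as)"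
| "word_pairs _ _ = 0"

text \<open>\<open>cs\<close> lists the row lengths from top to bottom, \<open>as\<close> the number
  of closing letters in each row.\<close>

definition choices :: "nat list \<Rightarrow> nat list set" where
  "choices cs = {as. list_all2 (\<le>) as cs}"

lemma choices_Nil [simp]: "choices [] = {[]}"
  by (simp add: choices_def)

lemma choices_Cons: "choices (c # cs) = (\<lambda>(as, a). a # as) ` (choices cs \<times> {..c})"
  by (auto simp: choices_def list_all2_Cons2 image_iff)

lemma finite_choices [simp]: "finite (choices cs)"
  by (induction cs) (simp_all add: choices_Cons)

lemma sum_choices_Cons:
  "(\<Sum>as\<in>choices (c # cs). F as) = (\<Sum>as\<in>choices cs. \<Sum>a\<le>c. F (a # as))"
proof -
  have "inj_on (\<lambda>(as, a). a # as) (choices cs \<times> {..c})" by (auto intro: inj_onI)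
  then have "(\<Sum>as\<in>choices (c # cs). F as) = (\<Sum>(as, a)\<in>choices cs \<times> {..c}. F (a # as))"
    unfolding choices_Cons by (subst sum.reindex) (auto intro: sum.cong)
  then show ?thesis by (simp add: sum.cartesian_product)
qed

text \<open>A row with \<open>a\<close> closing letters over \<open>h\<close> open ones adds
  \<open>min a h\<close> pairs. As \<open>h\<close> is the number of openings below minus the pairs
  so far, the new count is the minimum in \<open>word_pairs\<close>.\<close>

lemma word_state_pairs:
  assumes "as \<in> choices cs"
  shows "fst (word_state cs as) + word_pairs cs as = sum_list as \<and>
    snd (word_state cs as) + word_pairs cs as + sum_list as = sum_list cs"
  using assms
proof (induction cs arbitrary: as)
  case (Cons c cs)
  then obtain a bs where as: "as = a # bs" and a: "a \<le> c" and bs: "bs \<in> choices cs"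
    by (auto simp: choices_Cons)
  obtain u h where st: "word_state cs bs = (u, h)" by (cases "word_state cs bs")
  have "u + word_pairs cs bs = sum_list bs" "h + word_pairs cs bs + sum_list bs = sum_list cs"
    using Cons.IH [OF bs] st by auto
  then show ?case using a by (auto simp: as st)
qed simp

text \<open>The states with u + h = d correspond to the weights of the irreducible sl_2-module of
  dimension d + 1; the sum over each such string has to vanish.\<close>

definition antizero :: "(nat \<times> nat \<Rightarrow> rat) \<Rightarrow> bool" where
  "antizero \<Phi> \<longleftrightarrow> (\<forall>d. (\<Sum>u\<le>d. \<Phi> (u, d - u)) = 0)"

text \<open>The Clebsch--Gordan rule: a row of length \<open>c\<close> maps the states with \<open>u + h = d\<close> onto those with
  \<open>u + h = d + c - 2 k\<close>, each of the latter being reached once for every \<open>k \<le> min c d\<close>.\<close>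

lemma antizero_step:
  assumes "antizero \<Phi>"
  shows "antizero (\<lambda>s. \<Sum>a\<le>c. \<Phi> (step c a s))"
  unfolding antizero_def
proof
  fix d
  let ?B = "SIGMA k : {..min c d}. {..d + c - 2 * k}"
  let ?i = "\<lambda>(u, a). (min a (d - u), u + (a - min a (d - u)))"
  \<comment> \<open>\<open>k\<close> is the number of pairs closed by the row. If
    \<open>u' \<le> d - k\<close>, all its closing letters were matched, so \<open>a = k\<close>;
    otherwise all open letters were used up, so \<open>u = d - k\<close>.\<close>
  let ?j = "\<lambda>(k, u'). if u' \<le> d - k then (u', k) else (d - k, u' - (d - k) + k)"
  have "(\<Sum>(u, a)\<in>{..d} \<times> {..c}. \<Phi> (step c a (u, d - u))) = (\<Sum>(k, u')\<in>?B. \<Phi> (u', d + c - 2 * k - u'))"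
  proof (rule sum.reindex_bij_witness [of _ ?j ?i])
    fix z assume "z \<in> {..d} \<times> {..c}"
    then obtain u a where z: "z = (u, a)" "u \<le> d" "a \<le> c" by auto
    show "?j (?i z) = z" using z by (auto simp: min_def)
    show "?i z \<in> ?B" using z by (auto simp: min_def)
    show "(case ?i z of (k, u') \<Rightarrow> \<Phi> (u', d + c - 2 * k - u')) = (case z of (u, a) \<Rightarrow> \<Phi> (step c a (u, d - u)))"
      using z by (auto simp: min_def intro!: arg_cong [of _ _ \<Phi>])
  next
    fix z assume "z \<in> ?B"
    then obtain k u' where z: "z = (k, u')" "k \<le> c" "k \<le> d" "u' \<le> d + c - 2 * k" by auto
    show "?i (?j z) = z" using z by (auto simp: min_def)
    show "?j z \<in> {..d} \<times> {..c}" using z by auto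
  qed
  also have "\<dots> = (\<Sum>k\<le>min c d. \<Sum>u'\<le>d + c - 2 * k. \<Phi> (u', d + c - 2 * k - u'))"
    by (simp add: sum.Sigma)
  also have "\<dots> = 0" using assms unfolding antizero_def by (intro sum.neutral) blast
  finally show "(\<Sum>u\<le>d. \<Sum>a\<le>c. \<Phi> (step c a (u, d - u))) = 0" by (simp add: sum.cartesian_product)
qed

lemma antizero_words: "antizero \<Phi> \<Longrightarrow> (\<Sum>as\<in>choices cs. \<Phi> (word_state cs as)) = 0"
proof (induction cs arbitrary: \<Phi>)
  case Nil
  have "(\<Sum>u\<le>0. \<Phi> (u, 0 - u)) = 0" using Nil unfolding antizero_def by blast
  then show ?case by simp
next
  case (Cons c cs)
  have "(\<Sum>as\<in>choices (c # cs). \<Phi> (word_state (c # cs) as)) =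
      (\<Sum>as\<in>choices cs. \<Sum>a\<le>c. \<Phi> (step c a (word_state cs as)))"
    by (simp add: sum_choices_Cons)
  then show ?case using Cons.IH [OF antizero_step [OF Cons.prems, of c]] by simp
qed

lemma alternating_sum: "(\<Sum>u\<le>d. (- 1) ^ u) = (if even d then 1 else (0 :: rat))"
  by (induction d) auto

lemma word_sign_sum:
  assumes cs: "sum_list cs = 2 * n"
  shows "(\<Sum>as | as \<in> choices cs \<and> sum_list as = n. (- 1) ^ word_pairs cs as) =
    (\<Sum>as\<in>choices cs. (- 1) ^ sum_list as :: rat)"
proof -
  \<comment> \<open>\<Phi> is the difference of the two summands written in terms of the state: u +
    h + 2 p = 2 n for p pairs, and the content is balanced iff u = h. On a string with d = 2 e the
    indicator of u = e and the alternating sum both give 1; odd d cannot occur for such words and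
    gets the value 0.\<close>
  define \<Phi> :: "nat \<times> nat \<Rightarrow> rat" where "\<Phi> = (\<lambda>(u, h). if even (u + h) then
    (- 1) ^ (n - (u + h) div 2) * ((if u = h then 1 else 0) - (- 1) ^ u) else 0)"
  have "antizero \<Phi>"
    unfolding antizero_def
  proof
    fix d
    show "(\<Sum>u\<le>d. \<Phi> (u, d - u)) = 0"
    proof (cases "even d")
      case True
      then obtain e where e: "d = 2 * e" by blast
      have "(\<Sum>u\<le>d. \<Phi> (u, d - u)) =
          (\<Sum>u\<le>d. (- 1) ^ (n - e) * ((if u = e then 1 else 0) - (- 1) ^ u))"
        by (rule sum.cong) (auto simp: \<Phi>_def e)
      also have "\<dots> = (- 1) ^ (n - e) * ((\<Sum>u\<le>d. if u = e then 1 else 0) - (\<Sum>u\<le>d. (- 1) ^ u))"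
        by (simp only: sum_distrib_left [symmetric] sum_subtractf)
      also have "\<dots> = 0" using e by (simp add: alternating_sum)
      finally show ?thesis .
    next
      case False
      have "(\<Sum>u\<le>d. \<Phi> (u, d - u)) = (\<Sum>u\<le>d. 0)"
        by (rule sum.cong) (use False in \<open>auto simp: \<Phi>_def\<close>)
      then show ?thesis by simp
    qed
  qed
  then have "(\<Sum>as\<in>choices cs. \<Phi> (word_state cs as)) = 0" by (rule antizero_words)
  moreover have "\<Phi> (word_state cs as) =
      (if sum_list as = n then (- 1) ^ word_pairs cs as else 0) - (- 1) ^ sum_list as"
    if as: "as \<in> choices cs" for as
  proof -
    obtain u h where st: "word_state cs as = (u, h)" by (cases "word_state cs as")
    let ?p = "word_pairs cs as"
    have u: "u + ?p = sum_list as" and h: "h + ?p + sum_list as = 2 * n"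
      using word_state_pairs [OF as] st cs by auto
    have uh: "u + h + 2 * ?p = 2 * n" using u h by linarith
    then have ev: "even (u + h)" by presburger
    have p: "n - (u + h) div 2 = ?p" using uh by linarith
    have eq: "u = h \<longleftrightarrow> sum_list as = n" using u h by linarith
    have "\<Phi> (word_state cs as) = (- 1) ^ ?p * ((if sum_list as = n then 1 else 0) - (- 1) ^ u)"
      using ev by (simp add: \<Phi>_def st p eq)
    also have "(- 1) ^ ?p * (- 1) ^ u = (- 1 :: rat) ^ sum_list as"
      unfolding u [symmetric] by (simp add: power_add)
    then have "(- 1) ^ ?p * ((if sum_list as = n then 1 else 0) - (- 1) ^ u) =
        (if sum_list as = n then (- 1) ^ ?p else 0) - (- 1 :: rat) ^ sum_list as"
      by (simp add: right_diff_distrib)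
    finally show ?thesis .
  qed
  ultimately have "(\<Sum>as\<in>choices cs. (if sum_list as = n then (- 1) ^ word_pairs cs as else 0) - (- 1) ^ sum_list as) = (0 :: rat)"
    by simp
  then have "(\<Sum>as\<in>choices cs. if sum_list as = n then (- 1) ^ word_pairs cs as else 0) =
      (\<Sum>as\<in>choices cs. (- 1) ^ sum_list as :: rat)"
    by (simp add: sum_subtractf)
  then show ?thesis by (simp add: sum.inter_filter [symmetric])
qed

section \<open>The pair count as a minimum of cuts\<close>

lemma nat_INF_split: "(INF k. f k :: nat) = min (f 0) (INF k. f (Suc k))"
proof -
  have "(INF k. f k) \<le> n \<longleftrightarrow> min (f 0) (INF k. f (Suc k)) \<le> n" for n
    unfolding min_le_iff_disj nat_INF_le_iff by (metis not0_implies_Suc)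
  then show ?thesis by (metis order_antisym order_refl)
qed

lemma nat_INF_add: "(INF k. a + f k :: nat) = a + (INF k. f k)"
proof -
  have "(INF k. a + f k) \<le> n \<longleftrightarrow> a + (INF k. f k) \<le> n" for n
  proof -
    have "a + (INF k. f k) \<le> n \<longleftrightarrow> a \<le> n \<and> (INF k. f k) \<le> n - a" by linarith
    also have "\<dots> \<longleftrightarrow> (\<exists>k. a + f k \<le> n)" unfolding nat_INF_le_iff by (auto simp: le_diff_conv2 add.commute)
    finally show ?thesis unfolding nat_INF_le_iff ..
  qed
  then show ?thesis by (metis order_antisym order_refl)
qed

text \<open>Unrolling the recursion gives one term per row: closing letters above row
  \<open>k\<close> plus opening letters below it. This is \<open>letter_cut\<close>; a pair has its
  opening letter in the lower row, so each cut counts it at least once.\<close>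

lemma word_pairs_INF:
  assumes "as \<in> choices cs"
  shows "word_pairs cs as =
    (INF k. sum_list (take k as) + (sum_list (drop (Suc k) cs) - sum_list (drop (Suc k) as)))"
  using assms
proof (induction cs arbitrary: as)
  case Nil
  then show ?case by simp
next
  case (Cons c cs)
  then obtain a bs where as: "as = a # bs" and bs: "bs \<in> choices cs"
    by (auto simp: choices_Cons)
  show ?case
    unfolding as by (subst nat_INF_split) (simp add: Cons.IH [OF bs] nat_INF_add add.assoc)
qed

section \<open>Chains of two horizontal strips\<close>

definition between :: "(nat \<Rightarrow> nat) \<Rightarrow> (nat \<Rightarrow> nat) \<Rightarrow> (nat \<Rightarrow> nat) set" where
  "between \<rho> g = {\<sigma> \<in> shapes. hstrip \<rho> \<sigma> \<and> hstrip \<sigma> g}"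

text \<open>The minimum of the cuts when the smaller letter fills \<sigma> minus \<open>g\<close>
  and the larger one \<rho> minus \<sigma>. The condition \<open>\<rho> i \<noteq> 0\<close> keeps
  the second index set finite.\<close>

definition chain_pairs :: "(nat \<Rightarrow> nat) \<Rightarrow> (nat \<Rightarrow> nat) \<Rightarrow> (nat \<Rightarrow> nat) \<Rightarrow> nat" where
  "chain_pairs \<rho> \<sigma> g = (INF k. (\<Sum>i<k. \<sigma> i - g i) + (\<Sum>i | k < i \<and> \<rho> i \<noteq> 0. \<rho> i - \<sigma> i))"

lemma between_wt:
  assumes "\<rho> \<in> shapes" "\<sigma> \<in> between \<rho> g"
  shows "g \<in> shapes" "wt g \<le> wt \<sigma>" "wt \<sigma> \<le> wt \<rho>"
proof -
  have "\<sigma> \<in> shapes" "hstrip \<rho> \<sigma>" "hstrip \<sigma> g" using assms by (auto simp: between_def)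
  then show "g \<in> shapes" "wt g \<le> wt \<sigma>" "wt \<sigma> \<le> wt \<rho>"
    using hstrip_shapes_iff [of \<sigma> g] wt_mono [of \<sigma> g] wt_mono [OF assms(1), of \<sigma>] by (auto simp: hstrip_def)
qed

lemma finite_between [simp]: "\<rho> \<in> shapes \<Longrightarrow> finite (between \<rho> g)"
proof -
  assume \<rho>: "\<rho> \<in> shapes"
  have "between \<rho> g \<subseteq> (\<Union>n\<le>wt \<rho>. {\<sigma> \<in> shapes. wt \<sigma> = n})"
    using between_wt [OF \<rho>] by (auto simp: between_def)
  then show ?thesis by (rule finite_subset) (use finite_shapes in auto)
qed

text \<open>In row \<open>i\<close> the chain is free to choose \<open>\<sigma> i\<close> between \<open>lo i\<close> and \<open>hi i\<close>; the forced letters form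
  adjacent matched blocks, which contribute \<open>F\<close> pairs.\<close>

lemma chain_sign_sum:
  assumes \<rho>: "\<rho> \<in> shapes" and wt: "wt \<rho> = wt g + 2 * m"
  shows "(\<Sum>\<sigma> | \<sigma> \<in> between \<rho> g \<and> wt \<sigma> = wt g + m. (- 1) ^ chain_pairs \<rho> \<sigma> g) =
    (\<Sum>\<sigma>\<in>between \<rho> g. (- 1) ^ (wt \<sigma> - wt g) :: rat)"
proof (cases "between \<rho> g = {}")
  case False
  then obtain \<tau> where \<tau>: "\<tau> \<in> between \<rho> g" by blast
  define lo where "lo i = max (g i) (\<rho> (Suc i))" for i
  \<comment> \<open>Row 0 has no row above it, so there only \<rho> bounds \<sigma>.\<close>
  define hi where "hi i = min (\<rho> i) (if i = 0 then \<rho> 0 else g (i - 1))" for i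
  have between_iff: "\<sigma> \<in> between \<rho> g \<longleftrightarrow> (\<forall>i. lo i \<le> \<sigma> i \<and> \<sigma> i \<le> hi i)" for \<sigma>
  proof -
    have "hstrip \<rho> \<sigma> \<and> hstrip \<sigma> g \<longleftrightarrow> (\<forall>i. lo i \<le> \<sigma> i \<and> \<sigma> i \<le> hi i)"
    proof
      assume *: "hstrip \<rho> \<sigma> \<and> hstrip \<sigma> g"
      show "\<forall>i. lo i \<le> \<sigma> i \<and> \<sigma> i \<le> hi i"
      proof
        fix i show "lo i \<le> \<sigma> i \<and> \<sigma> i \<le> hi i"
          using * by (cases i) (auto simp: hstrip_def lo_def hi_def)
      qed
    next
      assume *: "\<forall>i. lo i \<le> \<sigma> i \<and> \<sigma> i \<le> hi i"
      have "\<rho> (Suc i) \<le> \<sigma> i" "g i \<le> \<sigma> i" "\<sigma> i \<le> \<rho> i" "\<sigma> (Suc i) \<le> g i" for i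
        using *[rule_format, of i] *[rule_format, of "Suc i"] by (auto simp: lo_def hi_def)
      then show "hstrip \<rho> \<sigma> \<and> hstrip \<sigma> g" by (simp add: hstrip_def)
    qed
    then show ?thesis unfolding between_def using hstrip_shapes_iff [of \<rho> \<sigma>] \<rho> by blast
  qed
  have lohi: "lo i \<le> hi i" for i using \<tau> between_iff by (meson le_trans)
  have g_le: "g i \<le> \<rho> i" for i using \<tau> by (auto simp: between_def hstrip_def intro: le_trans)
  obtain M where M: "\<And>i. M \<le> i \<Longrightarrow> \<rho> i = 0"
    using finite_support_bound [OF shapes_finite [OF \<rho>]] by blast
  have Mg: "g i = 0" if "M \<le> i" for i using M [OF that] g_le [of i] by simp
  have Mlo: "lo i = 0" if "M \<le> i" for i using that M Mg by (simp add: lo_def)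
  have Mhi: "hi i = 0" if "M \<le> i" for i using that M by (simp add: hi_def)
  define c where "c i = hi i - lo i" for i
  define f where "f i = lo i - g i" for i
  define F where "F = (\<Sum>i<M. f i)"
  \<comment> \<open>With rows 0 to \<open>M\<close> included, the forced larger letters of rows
    \<open>Suc k\<close> to \<open>M\<close> are counted by \<open>f\<close> over
    \<open>k..<M\<close>, as \<open>shift\<close> requires.\<close>
  let ?N = "Suc M"
  define cs where "cs = map c [0..<?N]"
  define code where "code \<sigma> = map (\<lambda>i. \<sigma> i - lo i) [0..<?N]" for \<sigma> :: "nat \<Rightarrow> nat"
  define decode where "decode as i = (if i < ?N then lo i + as ! i else 0)" for as :: "nat list" and i
  have fM: "f i = 0" if "M \<le> i" for i using that M Mg by (simp add: f_def lo_def)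
  have glo: "g i \<le> lo i" for i by (simp add: lo_def)
  have hirho: "hi i \<le> \<rho> i" for i by (simp add: hi_def)
  \<comment> \<open>A column of height two in rows \<open>i\<close> and \<open>Suc i\<close> has the
    smaller letter on top of the larger one, so both rows have the same number \<open>f i\<close> of
    forced letters from these columns.\<close>
  have forced: "\<rho> (Suc i) - hi (Suc i) = f i" "\<rho> 0 - hi 0 = 0" for i
    by (auto simp: f_def lo_def hi_def)
  have shift: "(\<Sum>i = Suc k..<?N. \<rho> i - hi i) = (\<Sum>i = k..<M. f i)" for k
    by (simp add: sum.shift_bounds_Suc_ivl forced del: sum.op_ivl_Suc)
  have wt_sigma: "wt \<sigma> = wt g + F + sum_list (code \<sigma>)" if \<sigma>: "\<sigma> \<in> between \<rho> g" for \<sigma>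
  proof -
    have s: "lo i \<le> \<sigma> i" "\<sigma> i \<le> hi i" for i using \<sigma> between_iff by auto
    have s0: "\<sigma> i = 0" if "M \<le> i" for i using s(2) [of i] Mhi [OF that] by simp
    have "wt \<sigma> = (\<Sum>i<?N. \<sigma> i)" by (rule wt_bound) (simp add: s0)
    also have "\<dots> = (\<Sum>i<?N. g i + f i + (\<sigma> i - lo i))"
      by (rule sum.cong) (use s glo in \<open>auto simp: f_def\<close>)
    also have "\<dots> = (\<Sum>i<?N. g i) + (\<Sum>i<?N. f i) + (\<Sum>i<?N. \<sigma> i - lo i)" by (simp only: sum.distrib)
    also have "(\<Sum>i<?N. g i) = wt g" by (rule wt_bound [symmetric]) (simp add: Mg)
    also have "(\<Sum>i<?N. f i) = F" by (simp add: F_def fM)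
    also have "(\<Sum>i<?N. \<sigma> i - lo i) = sum_list (code \<sigma>)"
      by (simp add: code_def sum_list_sum_nth atLeast0LessThan nth_append)
    finally show ?thesis .
  qed
  have sum_cs: "sum_list cs + 2 * F = 2 * m"
  proof -
    have "wt \<rho> = (\<Sum>i<?N. \<rho> i)" by (rule wt_bound) (simp add: M)
    also have "\<dots> = (\<Sum>i<?N. g i + f i + c i + (\<rho> i - hi i))"
    proof (rule sum.cong)
      fix i show "\<rho> i = g i + f i + c i + (\<rho> i - hi i)"
        using glo [of i] lohi [of i] hirho [of i] unfolding f_def c_def by linarith
    qed simp
    also have "\<dots> = (\<Sum>i<?N. g i) + (\<Sum>i<?N. f i) + (\<Sum>i<?N. c i) + (\<Sum>i<?N. \<rho> i - hi i)"
      by (simp only: sum.distrib)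
    also have "(\<Sum>i<?N. g i) = wt g" by (rule wt_bound [symmetric]) (simp add: Mg)
    also have "(\<Sum>i<?N. f i) = F" by (simp add: F_def fM)
    also have "(\<Sum>i<?N. c i) = sum_list cs"
      by (simp add: cs_def sum_list_sum_nth atLeast0LessThan nth_append)
    also have "(\<Sum>i<?N. \<rho> i - hi i) = F"
      unfolding F_def by (simp only: sum.lessThan_Suc_shift forced)
    finally show ?thesis using wt by simp
  qed
  have len: "length as = ?N" if "as \<in> choices cs" for as
    using that by (auto simp: choices_def cs_def dest: list_all2_lengthD)
  have cs_nth: "cs ! i = c i" if "i < ?N" for i using that by (simp add: cs_def del: upt_Suc)
  have as_le: "as ! i \<le> c i" if "as \<in> choices cs" "i < ?N" for as i
    using that cs_nth [OF that(2)] by (auto simp: choices_def list_all2_conv_all_nth cs_def)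
  have code_in: "code \<sigma> \<in> choices cs" if "\<sigma> \<in> between \<rho> g" for \<sigma>
    using that unfolding between_iff choices_def code_def cs_def c_def
    by (auto simp: list_all2_conv_all_nth simp del: upt_Suc intro: diff_le_mono)
  have decode_in: "decode as \<in> between \<rho> g" if "as \<in> choices cs" for as
    unfolding between_iff
  proof
    fix i
    show "lo i \<le> decode as i \<and> decode as i \<le> hi i"
    proof (cases "i < ?N")
      case True
      then show ?thesis using as_le [OF that True] lohi [of i] by (simp add: decode_def c_def)
    next
      case False
      then show ?thesis using Mlo [of i] by (simp add: decode_def)
    qed
  qed
  have code_decode: "code (decode as) = as" if "as \<in> choices cs" for as
    using len [OF that] by (intro nth_equalityI) (auto simp: code_def decode_def simp del: upt_Suc)
  have decode_code: "decode (code \<sigma>) = \<sigma>" if \<sigma>: "\<sigma> \<in> between \<rho> g" for \<sigma>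
  proof
    fix i
    have "lo i \<le> \<sigma> i" "\<sigma> i \<le> hi i" using \<sigma> between_iff by auto
    then show "decode (code \<sigma>) i = \<sigma> i"
      using Mhi [of i] by (cases "i < ?N") (auto simp: decode_def code_def simp del: upt_Suc)
  qed
  \<comment> \<open>Every cut counts each of the \<open>F\<close> forced pairs exactly once: by its
    upper letter if \<open>i < k\<close>, by its lower letter in row \<open>Suc i\<close> if
    \<open>k \<le> i\<close>. The rest of the cut belongs to the word of free letters.\<close>
  have pairs: "chain_pairs \<rho> \<sigma> g = F + word_pairs cs (code \<sigma>)" if \<sigma>: "\<sigma> \<in> between \<rho> g" for \<sigma>
  proof -
    have s: "lo i \<le> \<sigma> i" "\<sigma> i \<le> hi i" for i using \<sigma> between_iff by auto
    have s0: "\<sigma> i = 0" if "M \<le> i" for i using s(2) [of i] Mhi [OF that] by simp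
    let ?A = "\<lambda>i. \<sigma> i - lo i"
    have "(\<Sum>i<k. \<sigma> i - g i) + (\<Sum>i | k < i \<and> \<rho> i \<noteq> 0. \<rho> i - \<sigma> i) =
      F + (sum_list (take k (code \<sigma>)) + (sum_list (drop (Suc k) cs) - sum_list (drop (Suc k) (code \<sigma>))))" for k
    proof -
      have "(\<Sum>i<k. \<sigma> i - g i) = (\<Sum>i<k. f i + ?A i)"
        by (rule sum.cong) (use s glo in \<open>auto simp: f_def\<close>)
      then have 1: "(\<Sum>i<k. \<sigma> i - g i) = (\<Sum>i<k. f i) + (\<Sum>i<k. ?A i)" by (simp add: sum.distrib)
      have "(\<Sum>i | k < i \<and> \<rho> i \<noteq> 0. \<rho> i - \<sigma> i) = (\<Sum>i = Suc k..<?N. \<rho> i - \<sigma> i)"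
      proof (rule sum.mono_neutral_left)
        show "{i. k < i \<and> \<rho> i \<noteq> 0} \<subseteq> {Suc k..<?N}"
          using M by (auto simp: Suc_le_eq less_Suc_eq_le intro: ccontr)
      qed auto
      also have "\<dots> = (\<Sum>i = Suc k..<?N. (\<rho> i - hi i) + (c i - ?A i))"
      proof (rule sum.cong)
        fix i show "\<rho> i - \<sigma> i = (\<rho> i - hi i) + (c i - ?A i)"
          using s [of i] hirho [of i] unfolding c_def by linarith
      qed simp
      also have "\<dots> = (\<Sum>i = k..<M. f i) + (\<Sum>i = Suc k..<?N. c i - ?A i)"
        by (simp only: sum.distrib shift)
      also have "(\<Sum>i = Suc k..<?N. c i - ?A i) = (\<Sum>i = Suc k..<?N. c i) - (\<Sum>i = Suc k..<?N. ?A i)"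
        by (rule sum_subtractf_nat) (use s in \<open>auto simp: c_def intro: diff_le_mono\<close>)
      finally have 2: "(\<Sum>i | k < i \<and> \<rho> i \<noteq> 0. \<rho> i - \<sigma> i) =
        (\<Sum>i = k..<M. f i) + ((\<Sum>i = Suc k..<?N. c i) - (\<Sum>i = Suc k..<?N. ?A i))" .
      have 3: "(\<Sum>i<k. f i) + (\<Sum>i = k..<M. f i) = F"
      proof (cases "k \<le> M")
        case True
        then show ?thesis
          unfolding F_def using sum.atLeastLessThan_concat [of 0 k M f] by (simp add: atLeast0LessThan)
      next
        case False
        then have "(\<Sum>i<k. f i) = (\<Sum>i<M. f i)"
          by (intro sum.mono_neutral_right) (auto simp: fM)
        then show ?thesis using False by (simp add: F_def)
      qed
      have "sum_list (take k (code \<sigma>)) = (\<Sum>i<min k ?N. ?A i)"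
        by (simp add: code_def take_map take_upt sum_list_sum_nth atLeast0LessThan min_def del: upt_Suc)
      also have "\<dots> = (\<Sum>i<k. ?A i)"
        by (rule sum.mono_neutral_left) (auto simp: s0)
      finally have 4: "sum_list (take k (code \<sigma>)) = (\<Sum>i<k. ?A i)" .
      have 5: "sum_list (drop (Suc k) (map h [0..<?N])) = (\<Sum>i = Suc k..<?N. h i)" for h :: "nat \<Rightarrow> nat"
        by (simp add: drop_map drop_upt interv_sum_list_conv_sum_set_nat del: upt_Suc)
      show ?thesis using 1 2 3 4 unfolding cs_def code_def 5 by simp
    qed
    then show ?thesis
      unfolding chain_pairs_def word_pairs_INF [OF code_in [OF \<sigma>]] by (simp only: nat_INF_add)
  qed
  \<comment> \<open>Of the 2 m letters 2 F are forced; a balanced chain leaves \<open>m - F\<close>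
    free letters of each kind.\<close>
  let ?n = "m - F"
  have n: "sum_list cs = 2 * ?n" using sum_cs by simp
  have Fm: "F \<le> m" using sum_cs by simp
  have "(\<Sum>\<sigma> | \<sigma> \<in> between \<rho> g \<and> wt \<sigma> = wt g + m. (- 1) ^ chain_pairs \<rho> \<sigma> g) =
      (\<Sum>as | as \<in> choices cs \<and> sum_list as = ?n. (- 1) ^ (F + word_pairs cs as) :: rat)"
    by (rule sum.reindex_bij_witness [of _ decode code])
       (use code_in decode_in code_decode decode_code pairs wt_sigma Fm in auto)
  also have "\<dots> = (- 1) ^ F * (\<Sum>as\<in>choices cs. (- 1) ^ sum_list as)"
    by (simp only: power_add sum_distrib_left [symmetric] word_sign_sum [OF n])
  also have "\<dots> = (\<Sum>as\<in>choices cs. (- 1) ^ (F + sum_list as))"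
    by (simp only: power_add sum_distrib_left)
  also have "\<dots> = (\<Sum>\<sigma>\<in>between \<rho> g. (- 1) ^ (wt \<sigma> - wt g))"
    by (rule sum.reindex_bij_witness [of _ code decode])
       (use code_in decode_in code_decode decode_code wt_sigma in auto)
  finally show ?thesis .
qed simp

section \<open>Tableaux of content \<open>\<lambda>\<^sup>2\<close>\<close>

abbreviation square_content :: "nat list \<Rightarrow> nat \<Rightarrow> nat" where
  "square_content lam \<equiv> nth_default 0 (partition_square lam)"

lemma square_content_nth:
  "square_content lam (2 * k) = nth_default 0 lam k" "square_content lam (Suc (2 * k)) = nth_default 0 lam k"
proof (induction lam arbitrary: k)
  case (Cons m lam)
  have ps: "partition_square (m # lam) = m # m # partition_square lam" by (simp add: partition_square_def)
  case 1
  show ?case using Cons by (cases k) (simp_all add: ps)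
  case 2
  show ?case using Cons by (cases k) (simp_all add: ps)
qed (simp_all add: partition_square_def)

lemma length_partition_square: "length (partition_square lam) = 2 * length lam"
  by (induction lam) (simp_all add: partition_square_def)

lemma square_content_zero: "2 * length lam \<le> k \<Longrightarrow> square_content lam k = 0"
  by (simp add: nth_default_def length_partition_square)

text \<open>The updates appear in the form that two uses of \<open>SYT_strip_sum\<close>, for the
  letters 2 l + 2 and 2 l + 1, leave behind.\<close>

lemma square_content_snoc:
  fixes lam m
  defines "l \<equiv> length lam"
  shows "square_content (lam @ [m]) (Suc (2 * l)) = m"
    and "((square_content (lam @ [m]))(Suc (2 * l) := 0)) (2 * l) = m"
    and "(square_content (lam @ [m]))(Suc (2 * l) := 0, 2 * l := 0) = square_content lam"
proof -
  have ps: "partition_square (lam @ [m]) = partition_square lam @ [m, m]" by (simp add: partition_square_def)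
  show "square_content (lam @ [m]) (Suc (2 * l)) = m"
    "((square_content (lam @ [m]))(Suc (2 * l) := 0)) (2 * l) = m"
    by (simp_all add: ps nth_default_append length_partition_square l_def)
  show "(square_content (lam @ [m]))(Suc (2 * l) := 0, 2 * l := 0) = square_content lam"
  proof
    fix k
    consider "k < 2 * l" | "k = 2 * l" | "k = Suc (2 * l)" | "Suc (2 * l) < k" by linarith
    then show "((square_content (lam @ [m]))(Suc (2 * l) := 0, 2 * l := 0)) k = square_content lam k"
      by cases (auto simp: ps nth_default_def nth_append length_partition_square l_def)
  qed
qed

section \<open>Adjoining the two letters of a part\<close>

definition extend :: "nat \<Rightarrow> (nat \<Rightarrow> nat) \<Rightarrow> (nat \<Rightarrow> nat) \<Rightarrow> filling \<Rightarrow> filling" where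
  "extend l \<rho> \<sigma> T = add_strip \<rho> (Suc (Suc (2 * l))) (add_strip \<sigma> (Suc (2 * l)) T)"

text \<open>The inner shape \<open>g\<close> becomes the outermost index because the recursion in
  \<lambda> multiplies the expansion over \<open>g\<close> by the new part.\<close>

lemma SYT_snoc_sum:
  fixes F :: "filling \<Rightarrow> 'a :: comm_monoid_add"
  assumes \<rho>: "\<rho> \<in> shapes"
  shows "sum F (SYT \<rho> (square_content (lam @ [m]))) =
    (\<Sum>g | g \<in> shapes \<and> wt \<rho> = wt g + 2 * m. \<Sum>\<sigma> | \<sigma> \<in> between \<rho> g \<and> wt \<sigma> = wt g + m.
       \<Sum>T\<in>SYT g (square_content lam). F (extend (length lam) \<rho> \<sigma> T))"
proof -
  let ?l = "length lam"
  let ?\<alpha> = "square_content (lam @ [m])"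
  note c = square_content_snoc [of lam m]
  have "sum F (SYT \<rho> ?\<alpha>) = (\<Sum>\<sigma>\<in>down \<rho> m. \<Sum>T\<in>SYT \<sigma> (?\<alpha>(Suc (2 * ?l) := 0)).
      F (add_strip \<rho> (Suc (Suc (2 * ?l))) T))"
    using SYT_strip_sum [OF \<rho>, of "Suc (2 * ?l)" ?\<alpha> F] square_content_zero [of "lam @ [m]"] by (simp add: c)
  also have "\<dots> = (\<Sum>\<sigma>\<in>down \<rho> m. \<Sum>g\<in>down \<sigma> m. \<Sum>T\<in>SYT g (square_content lam). F (extend ?l \<rho> \<sigma> T))"
  proof (rule sum.cong)
    fix \<sigma> assume "\<sigma> \<in> down \<rho> m"
    then have \<sigma>: "\<sigma> \<in> shapes" by (simp add: down_def)
    have z: "(?\<alpha>(Suc (2 * ?l) := 0)) k = 0" if "2 * ?l < k" for k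
      using that square_content_zero [of "lam @ [m]" k] by auto
    show "(\<Sum>T\<in>SYT \<sigma> (?\<alpha>(Suc (2 * ?l) := 0)). F (add_strip \<rho> (Suc (Suc (2 * ?l))) T)) =
      (\<Sum>g\<in>down \<sigma> m. \<Sum>T\<in>SYT g (square_content lam). F (extend ?l \<rho> \<sigma> T))"
      using SYT_strip_sum [where \<alpha> = "?\<alpha>(Suc (2 * ?l) := 0)" and n = "2 * ?l", OF \<sigma> z, where F = "\<lambda>T. F (add_strip \<rho> (Suc (Suc (2 * ?l))) T)"]
      unfolding extend_def c by simp
  qed simp
  also have "\<dots> = (\<Sum>(\<sigma>, g)\<in>(SIGMA \<sigma> : down \<rho> m. down \<sigma> m).
      \<Sum>T\<in>SYT g (square_content lam). F (extend ?l \<rho> \<sigma> T))"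
    by (rule sum.Sigma) auto
  also have "\<dots> = (\<Sum>(g, \<sigma>)\<in>(SIGMA g : {g. g \<in> shapes \<and> wt \<rho> = wt g + 2 * m}.
      {\<sigma>. \<sigma> \<in> between \<rho> g \<and> wt \<sigma> = wt g + m}). \<Sum>T\<in>SYT g (square_content lam). F (extend ?l \<rho> \<sigma> T))"
    by (rule sum.reindex_bij_witness [of _ prod.swap prod.swap]) (auto simp: down_def between_def)
  also have "\<dots> = (\<Sum>g | g \<in> shapes \<and> wt \<rho> = wt g + 2 * m. \<Sum>\<sigma> | \<sigma> \<in> between \<rho> g \<and> wt \<sigma> = wt g + m.
       \<Sum>T\<in>SYT g (square_content lam). F (extend ?l \<rho> \<sigma> T))"
  proof (rule sum.Sigma [symmetric])
    show "finite {g. g \<in> shapes \<and> wt \<rho> = wt g + 2 * m}"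
      by (rule finite_subset [OF _ finite_shapes [of "wt \<rho> - 2 * m"]]) auto
  qed (use \<rho> in simp)
  finally show ?thesis .
qed

lemma extend_entries:
  assumes \<sigma>: "\<sigma> \<in> between \<rho> g" and T: "T \<in> SYT g (square_content lam)" and g: "g \<in> shapes"
  shows "extend (length lam) \<rho> \<sigma> T (i, j) = Some x \<longleftrightarrow>
    (T (i, j) = Some x \<and> x \<le> 2 * length lam) \<or> (g i \<le> j \<and> j < \<sigma> i \<and> x = Suc (2 * length lam)) \<or>
    (\<sigma> i \<le> j \<and> j < \<rho> i \<and> x = Suc (Suc (2 * length lam)))"
proof -
  have le: "g i \<le> \<sigma> i" "\<sigma> i \<le> \<rho> i" using \<sigma> by (auto simp: between_def hstrip_def)
  have d: "T (i, j) = None \<longleftrightarrow> g i \<le> j"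
  proof -
    have "(i, j) \<in> dom T \<longleftrightarrow> (i, j) \<in> diag g" using T by (simp add: SYT_def)
    then show ?thesis by (auto simp: not_less [symmetric])
  qed
  have "y \<le> 2 * length lam" if "T (i, j) = Some y" for y
    by (rule SYT_le(2) [OF g T _ that]) (rule square_content_zero)
  then show ?thesis using le d by (cases "T (i, j)") (auto simp: extend_def add_strip_def)
qed

section \<open>Signs read off from the two-letter subtableaux\<close>

lemma sub_filling_Some:
  "sub_filling Q (Suc i) b = Some x \<longleftrightarrow> Q b = Some x \<and> (x = Suc (2 * i) \<or> x = Suc (Suc (2 * i)))"
  by (auto simp: sub_filling_def restrict_map_def)

lemma chain_pairs_eq:
  assumes \<sigma>: "\<sigma> \<in> between \<rho> g" and T: "T \<in> SYT g (square_content lam)" and g: "g \<in> shapes" and \<rho>: "\<rho> \<in> shapes"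
  shows "pairs (Suc (2 * length lam)) (Suc (Suc (2 * length lam)))
      (sub_filling (extend (length lam) \<rho> \<sigma> T) (Suc (length lam))) = chain_pairs \<rho> \<sigma> g"
    (is "pairs ?p ?q ?P = _")
proof -
  have le: "g i \<le> \<sigma> i" "\<sigma> i \<le> \<rho> i" for i using \<sigma> by (auto simp: between_def hstrip_def)
  have P: "?P (i, j) = Some ?p \<longleftrightarrow> g i \<le> j \<and> j < \<sigma> i" "?P (i, j) = Some ?q \<longleftrightarrow> \<sigma> i \<le> j \<and> j < \<rho> i" for i j
    unfolding sub_filling_Some extend_entries [OF \<sigma> T g] by auto
  have "letter_cut ?p ?q ?P k = (\<Sum>i<k. \<sigma> i - g i) + (\<Sum>i | k < i \<and> \<rho> i \<noteq> 0. \<rho> i - \<sigma> i)" for k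
  proof -
    have "{b. ?P b = Some ?p \<and> fst b < k} = (SIGMA i : {..<k}. {g i..<\<sigma> i})" using P by auto
    moreover have "{b. ?P b = Some ?q \<and> k < fst b} = (SIGMA i : {i. k < i \<and> \<rho> i \<noteq> 0}. {\<sigma> i..<\<rho> i})"
      using P by auto
    moreover have "finite {i. k < i \<and> \<rho> i \<noteq> 0}"
      by (rule finite_subset [OF _ shapes_finite [OF \<rho>]]) auto
    ultimately show ?thesis unfolding letter_cut_def by (simp del: neq0_conv)
  qed
  then show ?thesis unfolding pairs_def chain_pairs_def by simp
qed

lemma sub_filling_two_letters:
  assumes f: "f \<in> shapes" and Q: "Q \<in> SYT f (square_content lam)" and i: "i < length lam"
  obtains R M where "skew_tab R M (sub_filling Q (Suc i))"
    "ran (sub_filling Q (Suc i)) \<subseteq> {Suc (2 * i), Suc (Suc (2 * i))}"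
    "card {b. sub_filling Q (Suc i) b = Some (Suc (2 * i))} = lam ! i"
    "card {b. sub_filling Q (Suc i) b = Some (Suc (Suc (2 * i)))} = lam ! i"
proof -
  let ?P = "sub_filling Q (Suc i)"
  \<comment> \<open>The entries up to 2 i + 2 and up to 2 i occupy ideals, as entries increase away
    from the origin; their difference carries the two letters.\<close>
  let ?R = "dom (restr (Suc (Suc (2 * i))) Q)" and ?M = "dom (restr (2 * i) Q)"
  have dQ: "dom Q = diag f" and mono: "entries_mono Q" and c: "content Q = square_content lam"
    using Q by (auto simp: SYT_def)
  have "dom ?P = ?R - ?M"
  proof (intro equalityI subsetI)
    fix b assume "b \<in> dom ?P"
    then obtain x where "Q b = Some x" "x = Suc (2 * i) \<or> x = Suc (Suc (2 * i))"
      by (auto simp only: sub_filling_Some dom_def mem_Collect_eq not_None_eq)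
    then show "b \<in> ?R - ?M" by (cases b) (auto simp: restr_Some)
  next
    fix b assume b: "b \<in> ?R - ?M"
    then obtain x where x: "Q b = Some x" "x \<le> Suc (Suc (2 * i))"
      by (auto simp only: restr_Some dom_def mem_Collect_eq not_None_eq Diff_iff)
    have "\<not> x \<le> 2 * i"
    proof
      assume "x \<le> 2 * i"
      then have "restr (2 * i) Q b = Some x" using x by (simp add: restr_Some)
      then show False using b by blast
    qed
    then have "?P b = Some x" using x by (auto simp: sub_filling_Some)
    then show "b \<in> dom ?P" by blast
  qed
  moreover have "?M \<subseteq> ?R"
  proof
    fix b assume "b \<in> ?M"
    then obtain x where "restr (2 * i) Q b = Some x" by blast
    then have "restr (Suc (Suc (2 * i))) Q b = Some x" by (simp add: restr_Some)
    then show "b \<in> ?R" by blast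
  qed
  moreover have "?R \<subseteq> diag f" unfolding dQ [symmetric] by (force simp: restr_Some)
  then have "finite ?R" using finite_diag_shapes [OF f] by (rule finite_subset)
  moreover have "entries_mono ?P" using mono unfolding entries_mono_def sub_filling_Some by blast
  ultimately have "skew_tab ?R ?M ?P"
    using ideal_restr [OF f dQ mono] by (simp add: skew_tab_def)
  moreover have "ran ?P \<subseteq> {Suc (2 * i), Suc (Suc (2 * i))}"
    unfolding ran_def by (auto simp only: sub_filling_Some)
  moreover have "card {b. ?P b = Some (Suc k)} = lam ! i" if "k = 2 * i \<or> k = Suc (2 * i)" for k
  proof -
    have "{b. ?P b = Some (Suc k)} = {b. Q b = Some (Suc k)}" using that by (auto simp: sub_filling_Some)
    also have "card \<dots> = content Q k" by (simp only: content_def)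
    finally show ?thesis using i that by (auto simp: c square_content_nth nth_default_nth)
  qed
  ultimately show ?thesis by (intro that) auto
qed

lemma sub_filling_signs:
  assumes f: "f \<in> shapes" and Q: "Q \<in> SYT f (square_content lam)" and i: "i < length lam"
  shows "sign_index (lam ! i) (sub_filling Q (Suc i)) =
      pairs (Suc (2 * i)) (Suc (Suc (2 * i))) (sub_filling Q (Suc i))" (is "sign_index _ ?P = pairs ?p ?q _")
    and "sign_index (lam ! i) (sub_filling Q (Suc i)) \<le> lam ! i"
    and "conj_sign_index (lam ! i) (conj_filling (sub_filling Q (Suc i))) =
      lam ! i - sign_index (lam ! i) (sub_filling Q (Suc i))"
proof -
  obtain R M where *: "skew_tab R M ?P" "ran ?P \<subseteq> {?p, ?q}" "?p < ?q"
    "card {b. ?P b = Some ?p} = lam ! i" "card {b. ?P b = Some ?q} = lam ! i"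
    using sub_filling_two_letters [OF f Q i] by (metis lessI)
  show s: "sign_index (lam ! i) ?P = pairs ?p ?q ?P"
    by (rule sign_index_eq [OF *])
  show "sign_index (lam ! i) ?P \<le> lam ! i"
    unfolding s using rect_two_letters [OF *] by simp
  show "conj_sign_index (lam ! i) (conj_filling ?P) = lam ! i - sign_index (lam ! i) ?P"
    unfolding s by (rule conj_sign_index_eq [OF *])
qed

lemma tableau_sign_lessThan:
  "tableau_sign lam Q = (\<Prod>i<length lam. (- 1) ^ sign_index (lam ! i) (sub_filling Q (Suc i)))"
  unfolding tableau_sign_def by (simp add: prod.atLeast1_atMost_eq)

text \<open>By \<open>conj_sign_index_eq\<close> a part m has exponent m - j in place of j, which
  has the parity of m + j.\<close>

lemma conj_tableau_sign_eq:
  assumes f: "f \<in> shapes" and Q: "Q \<in> SYT f (square_content lam)"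
  shows "conj_tableau_sign lam (conj_filling Q) = (- 1) ^ sum_list lam * tableau_sign lam Q"
proof -
  have sub: "sub_filling (conj_filling Q) i = conj_filling (sub_filling Q i)" for i
    by (rule ext) (auto simp: sub_filling_def conj_filling_def restrict_map_def)
  have "conj_tableau_sign lam (conj_filling Q) =
      (\<Prod>i<length lam. (- 1) ^ conj_sign_index (lam ! i) (conj_filling (sub_filling Q (Suc i))))"
    unfolding conj_tableau_sign_def sub by (simp add: prod.atLeast1_atMost_eq)
  also have "\<dots> = (\<Prod>i<length lam. (- 1) ^ (lam ! i) * (- 1) ^ sign_index (lam ! i) (sub_filling Q (Suc i)))"
  proof (rule prod.cong)
    fix i assume "i \<in> {..<length lam}"
    then have i: "i < length lam" by simp
    let ?s = "sign_index (lam ! i) (sub_filling Q (Suc i))"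
    have "lam ! i + ?s = (lam ! i - ?s) + 2 * ?s" using sub_filling_signs(2) [OF f Q i] by simp
    then have "(- 1 :: int) ^ (lam ! i + ?s) = (- 1) ^ (lam ! i - ?s)" by (simp only: power_add) simp
    then show "(- 1 :: int) ^ conj_sign_index (lam ! i) (conj_filling (sub_filling Q (Suc i))) =
        (- 1) ^ (lam ! i) * (- 1) ^ ?s"
      by (simp add: sub_filling_signs(3) [OF f Q i] power_add)
  qed simp
  also have "\<dots> = (- 1) ^ sum_list lam * tableau_sign lam Q"
    unfolding tableau_sign_lessThan prod.distrib
    by (simp add: power_sum sum_list_sum_nth atLeast0LessThan)
  finally show ?thesis .
qed

lemma extend_mem:
  assumes \<rho>: "\<rho> \<in> shapes" and \<sigma>: "\<sigma> \<in> between \<rho> g" and w: "wt \<sigma> = wt g + m" "wt \<rho> = wt g + 2 * m"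
    and T: "T \<in> SYT g (square_content lam)"
  shows "extend (length lam) \<rho> \<sigma> T \<in> SYT \<rho> (square_content (lam @ [m]))"
proof -
  note c = square_content_snoc [of lam m]
  let ?l = "length lam" and ?\<alpha> = "square_content (lam @ [m])"
  have g: "g \<in> shapes" and s: "\<sigma> \<in> shapes" using between_wt [OF \<rho> \<sigma>] \<sigma> by (auto simp: between_def)
  have z: "(?\<alpha>(Suc (2 * ?l) := 0)) k = 0" if "2 * ?l < k" for k
    using that square_content_zero [of "lam @ [m]" k] by auto
  have "g \<in> down \<sigma> ((?\<alpha>(Suc (2 * ?l) := 0)) (2 * ?l))" unfolding c using g \<sigma> w by (simp add: down_def between_def)
  moreover have "T \<in> SYT g (?\<alpha>(Suc (2 * ?l) := 0, 2 * ?l := 0))" unfolding c by (rule T)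
  ultimately have "add_strip \<sigma> (Suc (2 * ?l)) T \<in> SYT \<sigma> (?\<alpha>(Suc (2 * ?l) := 0))"
    by (rule add_strip_mem(1) [OF s _ _ z])
  moreover have "\<sigma> \<in> down \<rho> (?\<alpha> (Suc (2 * ?l)))" unfolding c using s \<sigma> w by (simp add: down_def between_def)
  ultimately show ?thesis
    unfolding extend_def by (intro add_strip_mem(1) [OF \<rho>]) (use square_content_zero [of "lam @ [m]"] in auto)
qed

text \<open>The new letters exceed all old ones, so the earlier subtableaux stay as they are and
  only one factor is added.\<close>

lemma tableau_sign_extend:
  assumes \<rho>: "\<rho> \<in> shapes" and \<sigma>: "\<sigma> \<in> between \<rho> g" and w: "wt \<sigma> = wt g + m" "wt \<rho> = wt g + 2 * m"
    and T: "T \<in> SYT g (square_content lam)"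
  shows "tableau_sign (lam @ [m]) (extend (length lam) \<rho> \<sigma> T) =
    tableau_sign lam T * (- 1) ^ chain_pairs \<rho> \<sigma> g"
proof -
  let ?l = "length lam" and ?Q = "extend (length lam) \<rho> \<sigma> T"
  have g: "g \<in> shapes" by (rule between_wt [OF \<rho> \<sigma>])
  have "sub_filling ?Q (Suc i) = sub_filling T (Suc i)" if "i < ?l" for i
  proof (rule ext)
    fix b :: "nat \<times> nat"
    obtain r c where b: "b = (r, c)" by (cases b)
    have "sub_filling ?Q (Suc i) b = Some x \<longleftrightarrow> sub_filling T (Suc i) b = Some x" for x
      unfolding sub_filling_Some b extend_entries [OF \<sigma> T g] using that by (auto; presburger)
    then show "sub_filling ?Q (Suc i) b = sub_filling T (Suc i) b" by (metis not_Some_eq)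
  qed
  then have "(\<Prod>i<?l. (- 1 :: int) ^ sign_index ((lam @ [m]) ! i) (sub_filling ?Q (Suc i))) = tableau_sign lam T"
    unfolding tableau_sign_lessThan by (intro prod.cong) (auto simp: nth_append)
  moreover have "sign_index ((lam @ [m]) ! ?l) (sub_filling ?Q (Suc ?l)) = chain_pairs \<rho> \<sigma> g"
    using sub_filling_signs(1) [OF \<rho> extend_mem [OF assms], of ?l] chain_pairs_eq [OF \<sigma> T g \<rho>] by simp
  ultimately show ?thesis unfolding tableau_sign_lessThan [of "lam @ [m]"] by simp
qed

lemma tableau_sign_cases: "tableau_sign lam Q = 1 \<or> tableau_sign lam Q = - 1"
  unfolding tableau_sign_def power_sum [symmetric] by (simp add: minus_one_power_iff)

section \<open>Schur expansions\<close>

abbreviation shapes_of :: "nat \<Rightarrow> (nat \<Rightarrow> nat) set" where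
  "shapes_of n \<equiv> {f. f \<in> shapes \<and> wt f = n}"

lemma sum_const_scale: "(\<Sum>x\<in>A. b) = scale (of_nat (card A)) b"
  by (rule mseries_eqI) (simp only: coeff_sum coeff_scale, simp)

lemma scale_sum_left: "scale (sum c A) b = (\<Sum>x\<in>A. scale (c x) b)"
  by (rule mseries_eqI) (simp add: sum_distrib_right)

text \<open>Applying the Pieri rule twice and grouping by the outer shape makes the coefficient a
  number of chains with a first strip of size \<open>k\<close>.\<close>

lemma two_strips:
  assumes P: "\<And>g m. g \<in> shapes \<Longrightarrow> B g * Z m = (\<Sum>\<rho>\<in>up g m. B \<rho>)"
    and g: "g \<in> shapes" and k: "k \<le> n"
  shows "B g * (Z k * Z (n - k)) =
    (\<Sum>\<rho>\<in>shapes_of (wt g + n). scale (of_nat (card {\<sigma>. \<sigma> \<in> between \<rho> g \<and> wt \<sigma> = wt g + k})) (B \<rho>))"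
proof -
  have "B g * (Z k * Z (n - k)) = (\<Sum>\<sigma>\<in>up g k. B \<sigma> * Z (n - k))"
    by (simp add: P [OF g] sum_distrib_right flip: mult.assoc)
  also have "\<dots> = (\<Sum>\<sigma>\<in>up g k. \<Sum>\<rho>\<in>up \<sigma> (n - k). B \<rho>)"
    by (rule sum.cong) (auto simp: P up_def [of g])
  also have "\<dots> = (\<Sum>(\<sigma>, \<rho>)\<in>(SIGMA \<sigma> : up g k. up \<sigma> (n - k)). B \<rho>)"
    by (rule sum.Sigma) auto
  also have "\<dots> = (\<Sum>(\<rho>, \<sigma>)\<in>(SIGMA \<rho> : shapes_of (wt g + n). {\<sigma>. \<sigma> \<in> between \<rho> g \<and> wt \<sigma> = wt g + k}). B \<rho>)"
    by (rule sum.reindex_bij_witness [of _ prod.swap prod.swap]) (use k in \<open>auto simp: up_def between_def\<close>)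
  also have "\<dots> = (\<Sum>\<rho>\<in>shapes_of (wt g + n). \<Sum>\<sigma> | \<sigma> \<in> between \<rho> g \<and> wt \<sigma> = wt g + k. B \<rho>)"
    by (rule sum.Sigma [symmetric]) (use finite_shapes in auto)
  finally show ?thesis by (simp only: sum_const_scale)
qed

text \<open>The alternating sum over \<open>k\<close> is the signed sum over all chains, whatever
  the size of the first strip; \<open>chain_sign_sum\<close> trades it for the balanced chains
  signed by their pairs.\<close>

lemma two_strips_alternating:
  assumes P: "\<And>g m. g \<in> shapes \<Longrightarrow> B g * Z m = (\<Sum>\<rho>\<in>up g m. B \<rho>)" and g: "g \<in> shapes"
  shows "B g * (\<Sum>k\<le>2 * m. scale ((- 1) ^ k) (Z k * Z (2 * m - k))) =
    (\<Sum>\<rho>\<in>shapes_of (wt g + 2 * m).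
       scale (\<Sum>\<sigma> | \<sigma> \<in> between \<rho> g \<and> wt \<sigma> = wt g + m. (- 1) ^ chain_pairs \<rho> \<sigma> g) (B \<rho>))"
proof -
  let ?n = "\<lambda>\<rho> k. rat_of_nat (card {\<sigma>. \<sigma> \<in> between \<rho> g \<and> wt \<sigma> = wt g + k})"
  have "B g * (\<Sum>k\<le>2 * m. scale ((- 1) ^ k) (Z k * Z (2 * m - k))) =
      (\<Sum>k\<le>2 * m. scale ((- 1) ^ k) (B g * (Z k * Z (2 * m - k))))"
    by (simp only: sum_distrib_left scale_mult_right)
  also have "\<dots> = (\<Sum>k\<le>2 * m. \<Sum>\<rho>\<in>shapes_of (wt g + 2 * m). scale ((- 1) ^ k * ?n \<rho> k) (B \<rho>))"
  proof (rule sum.cong)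
    fix k assume "k \<in> {..2 * m}"
    then have "k \<le> 2 * m" by simp
    from two_strips [where B = B and Z = Z, OF P g this]
    show "scale ((- 1) ^ k) (B g * (Z k * Z (2 * m - k))) =
        (\<Sum>\<rho>\<in>shapes_of (wt g + 2 * m). scale ((- 1) ^ k * ?n \<rho> k) (B \<rho>))"
      by (simp only: scale_sum scale_scale)
  qed simp
  also have "\<dots> = (\<Sum>\<rho>\<in>shapes_of (wt g + 2 * m). scale (\<Sum>k\<le>2 * m. (- 1) ^ k * ?n \<rho> k) (B \<rho>))"
    by (subst sum.swap) (simp only: scale_sum_left)
  also have "\<dots> = (\<Sum>\<rho>\<in>shapes_of (wt g + 2 * m).
       scale (\<Sum>\<sigma> | \<sigma> \<in> between \<rho> g \<and> wt \<sigma> = wt g + m. (- 1) ^ chain_pairs \<rho> \<sigma> g) (B \<rho>))"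
  proof (rule sum.cong)
    fix \<rho> assume "\<rho> \<in> shapes_of (wt g + 2 * m)"
    then have \<rho>: "\<rho> \<in> shapes" "wt \<rho> = wt g + 2 * m" by auto
    have "(\<Sum>k\<le>2 * m. (- 1) ^ k * ?n \<rho> k) =
        (\<Sum>k\<le>2 * m. \<Sum>\<sigma> | \<sigma> \<in> between \<rho> g \<and> wt \<sigma> - wt g = k. (- 1) ^ (wt \<sigma> - wt g))"
    proof (rule sum.cong)
      fix k
      have "{\<sigma>. \<sigma> \<in> between \<rho> g \<and> wt \<sigma> - wt g = k} = {\<sigma>. \<sigma> \<in> between \<rho> g \<and> wt \<sigma> = wt g + k}"
        using between_wt(2) [OF \<rho>(1)] by fastforce
      then show "(- 1) ^ k * ?n \<rho> k = (\<Sum>\<sigma> | \<sigma> \<in> between \<rho> g \<and> wt \<sigma> - wt g = k. (- 1) ^ (wt \<sigma> - wt g))"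
        by simp
    qed simp
    also have "\<dots> = (\<Sum>\<sigma>\<in>between \<rho> g. (- 1) ^ (wt \<sigma> - wt g))"
      by (rule sum.group) (use between_wt(3) [OF \<rho>(1)] \<rho> in fastforce)+
    also have "\<dots> = (\<Sum>\<sigma> | \<sigma> \<in> between \<rho> g \<and> wt \<sigma> = wt g + m. (- 1) ^ chain_pairs \<rho> \<sigma> g)"
      by (rule chain_sign_sum [OF \<rho>, symmetric])
    finally show "scale (\<Sum>k\<le>2 * m. (- 1) ^ k * ?n \<rho> k) (B \<rho>) =
      scale (\<Sum>\<sigma> | \<sigma> \<in> between \<rho> g \<and> wt \<sigma> = wt g + m. (- 1) ^ chain_pairs \<rho> \<sigma> g) (B \<rho>)" by simp
  qed simp
  finally show ?thesis .
qed

text \<open>\<open>\<Omega>\<close> is a weight on tableaux of content \<open>\<lambda>\<^sup>2\<close> which is built up two letters at a time, with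
  factor \<open>\<omega>\<close> in each step.\<close>

lemma schur_expansion:
  fixes \<omega> :: "nat \<Rightarrow> (nat \<Rightarrow> nat) \<Rightarrow> (nat \<Rightarrow> nat) \<Rightarrow> (nat \<Rightarrow> nat) \<Rightarrow> rat"
  assumes X: "\<And>g m. g \<in> shapes \<Longrightarrow> B g * X m = (\<Sum>\<rho>\<in>shapes_of (wt g + 2 * m).
       scale (\<Sum>\<sigma> | \<sigma> \<in> between \<rho> g \<and> wt \<sigma> = wt g + m. \<omega> m \<rho> \<sigma> g) (B \<rho>))"
    and B0: "B (\<lambda>_. 0) = 1" and \<Omega>0: "\<Omega> [] Map.empty = 1"
    and \<Omega>: "\<And>lam m \<rho> \<sigma> g T. \<rho> \<in> shapes \<Longrightarrow> \<sigma> \<in> between \<rho> g \<Longrightarrow> wt \<sigma> = wt g + m \<Longrightarrow> wt \<rho> = wt g + 2 * m \<Longrightarrow>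
       T \<in> SYT g (square_content lam) \<Longrightarrow>
       \<Omega> (lam @ [m]) (extend (length lam) \<rho> \<sigma> T) = \<Omega> lam T * \<omega> m \<rho> \<sigma> g"
  shows "prod_list (map X lam) =
    (\<Sum>f\<in>shapes_of (2 * sum_list lam). scale (\<Sum>Q\<in>SYT f (square_content lam). \<Omega> lam Q) (B f))"
proof (induction lam rule: rev_induct)
  case Nil
  have "shapes_of 0 = {\<lambda>_. 0}" using wt_eq_0 by auto
  moreover have "square_content [] = (\<lambda>_. 0)" by (simp add: partition_square_def fun_eq_iff)
  ultimately show ?case by (simp add: SYT_zero_content B0 \<Omega>0)
next
  case (snoc m lam)
  let ?W = "\<lambda>f. \<Sum>Q\<in>SYT f (square_content lam). \<Omega> lam Q"
  let ?w = "\<lambda>\<rho> g. \<Sum>\<sigma> | \<sigma> \<in> between \<rho> g \<and> wt \<sigma> = wt g + m. \<omega> m \<rho> \<sigma> g"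
  let ?n = "2 * sum_list lam"
  have "prod_list (map X (lam @ [m])) = (\<Sum>g\<in>shapes_of ?n. scale (?W g) (B g)) * X m"
    using snoc.IH by simp
  also have "\<dots> = (\<Sum>g\<in>shapes_of ?n. scale (?W g) (B g * X m))"
    by (simp only: sum_distrib_right scale_mult_left)
  also have "\<dots> = (\<Sum>g\<in>shapes_of ?n. \<Sum>\<rho>\<in>shapes_of (?n + 2 * m). scale (?W g * ?w \<rho> g) (B \<rho>))"
    by (rule sum.cong) (auto simp: X scale_sum scale_scale)
  also have "\<dots> = (\<Sum>\<rho>\<in>shapes_of (?n + 2 * m). scale (\<Sum>g\<in>shapes_of ?n. ?W g * ?w \<rho> g) (B \<rho>))"
    by (subst sum.swap) (simp only: scale_sum_left)
  also have "\<dots> = (\<Sum>\<rho>\<in>shapes_of (?n + 2 * m).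
      scale (\<Sum>Q\<in>SYT \<rho> (square_content (lam @ [m])). \<Omega> (lam @ [m]) Q) (B \<rho>))"
  proof (rule sum.cong)
    fix \<rho> assume "\<rho> \<in> shapes_of (?n + 2 * m)"
    then have \<rho>: "\<rho> \<in> shapes" "wt \<rho> = ?n + 2 * m" by auto
    have G: "{g. g \<in> shapes \<and> wt \<rho> = wt g + 2 * m} = shapes_of ?n" using \<rho> by auto
    have "(\<Sum>Q\<in>SYT \<rho> (square_content (lam @ [m])). \<Omega> (lam @ [m]) Q) =
        (\<Sum>g\<in>shapes_of ?n. \<Sum>\<sigma> | \<sigma> \<in> between \<rho> g \<and> wt \<sigma> = wt g + m.
          \<Sum>T\<in>SYT g (square_content lam). \<Omega> lam T * \<omega> m \<rho> \<sigma> g)"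
      unfolding SYT_snoc_sum [OF \<rho>(1)] G
      by (intro sum.cong refl \<Omega> \<rho>(1)) (use \<rho> in auto)
    also have "\<dots> = (\<Sum>g\<in>shapes_of ?n. ?W g * ?w \<rho> g)"
      by (simp only: sum_distrib_left sum_distrib_right)
    finally show "scale (\<Sum>g\<in>shapes_of ?n. ?W g * ?w \<rho> g) (B \<rho>) =
        scale (\<Sum>Q\<in>SYT \<rho> (square_content (lam @ [m])). \<Omega> (lam @ [m]) Q) (B \<rho>)" by simp
  qed simp
  finally show ?case by (simp add: algebra_simps)
qed

lemma prod_list_adams:
  assumes "\<And>m. Z m \<in> Sym"
  shows "adams 2 (prod_list (map Z lam)) = prod_list (map (\<lambda>m. adams 2 (Z m)) lam)"
proof -
  have e: "Sym_endo (adams 2)" using Sym_endo_adams [of 1] by (simp add: numeral_2_eq_2)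
  show ?thesis
  proof (induction lam)
    case Nil
    then show ?case using e by (simp add: Sym_endo_def)
  next
    case (Cons m lam)
    have "prod_list (map Z lam) \<in> Sym" by (rule Sym_prod_list) (rule assms)
    then have "adams 2 (Z m * prod_list (map Z lam)) = adams 2 (Z m) * adams 2 (prod_list (map Z lam))"
      using e assms unfolding Sym_endo_def by blast
    then show ?case using Cons.IH by simp
  qed
qed

lemma prod_list_square:
  "prod_list (map Z lam) * prod_list (map Z lam) = prod_list (map (\<lambda>m. Z m * Z m) lam)"
  for Z :: "nat \<Rightarrow> mseries"
  by (induction lam) (simp_all add: ac_simps)

text \<open>(1 + s) / 2 and (1 - s) / 2 are the indicators of s = 1 and s = -1. The first sum will
  come from the square, the second from the substitution of squared variables.\<close>

lemma half_sum_scale: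
  assumes "\<And>f. f \<in> A \<Longrightarrow> finite (C f)" "\<And>f x. f \<in> A \<Longrightarrow> x \<in> C f \<Longrightarrow> s x = 1 \<or> s x = (- 1 :: int)"
  shows "scale (1 / 2) ((\<Sum>f\<in>A. scale (\<Sum>x\<in>C f. 1) (B f)) + (\<Sum>f\<in>A. scale (\<Sum>x\<in>C f. of_int (s x)) (B f))) =
      (\<Sum>f\<in>A. scale (of_nat (card {x \<in> C f. s x = 1})) (B f))" (is ?P1)
    and "scale (1 / 2) ((\<Sum>f\<in>A. scale (\<Sum>x\<in>C f. 1) (B f)) - (\<Sum>f\<in>A. scale (\<Sum>x\<in>C f. of_int (s x)) (B f))) =
      (\<Sum>f\<in>A. scale (of_nat (card {x \<in> C f. s x = - 1})) (B f))" (is ?P2)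
proof -
  have card: "rat_of_nat (card {x \<in> C f. s x = e}) = (\<Sum>x\<in>C f. (1 + of_int e * of_int (s x)) / 2)"
    if "f \<in> A" "e = 1 \<or> e = - 1" for f e
  proof -
    have "rat_of_nat (card {x \<in> C f. s x = e}) = (\<Sum>x\<in>C f. if s x = e then 1 else 0)"
      using assms(1) [OF that(1)] by (simp add: sum.inter_filter [symmetric])
    also have "\<dots> = (\<Sum>x\<in>C f. (1 + of_int e * of_int (s x)) / 2)"
      by (rule sum.cong) (use assms(2) [OF that(1)] that(2) in fastforce)+
    finally show ?thesis .
  qed
  show ?P1
    unfolding sum.distrib [symmetric] scale_add_left [symmetric] scale_sum scale_scale
    by (rule sum.cong) (simp_all add: card sum.distrib add_divide_distrib sum_divide_distrib)
  have minus: "(\<Sum>f\<in>A. scale (a f) (B f)) - (\<Sum>f\<in>A. scale (b f) (B f)) = (\<Sum>f\<in>A. scale (a f - b f) (B f))" for a b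
    by (rule mseries_eqI) (simp add: sum_subtractf left_diff_distrib)
  show ?P2
    unfolding minus scale_sum scale_scale
    by (rule sum.cong) (simp_all add: card sum_subtractf diff_divide_distrib sum_divide_distrib)
qed

text \<open>\<epsilon> is 1 for complete and -1 for elementary functions; its powers absorb the sign
  in \<open>adams_elementary\<close>.\<close>

lemma plethysm_prod_list:
  fixes \<epsilon> :: int
  assumes P: "\<And>g m. g \<in> shapes \<Longrightarrow> B g * Z m = (\<Sum>\<rho>\<in>up g m. B \<rho>)" and B0: "B (\<lambda>_. 0) = 1"
    and sym: "\<And>m. Z m \<in> Sym" and \<epsilon>: "\<epsilon> = 1 \<or> \<epsilon> = - 1"
    and adams: "\<And>m. adams 2 (Z m) =
      scale (of_int \<epsilon> ^ m) (\<Sum>k\<le>2 * m. scale ((- 1) ^ k) (Z k * Z (2 * m - k)))"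
  shows "plethysm (complete 2) (prod_list (map Z lam)) = (\<Sum>f\<in>shapes_of (2 * sum_list lam).
     scale (of_nat (card {Q \<in> SYT f (square_content lam). \<epsilon> ^ sum_list lam * tableau_sign lam Q = 1})) (B f))"
     (is ?P1)
    and "plethysm (elementary 2) (prod_list (map Z lam)) = (\<Sum>f\<in>shapes_of (2 * sum_list lam).
     scale (of_nat (card {Q \<in> SYT f (square_content lam). \<epsilon> ^ sum_list lam * tableau_sign lam Q = - 1})) (B f))"
     (is ?P2)
proof -
  let ?s = "\<lambda>lam Q. \<epsilon> ^ sum_list lam * tableau_sign lam Q"
  have sq: "prod_list (map Z lam) * prod_list (map Z lam) = (\<Sum>f\<in>shapes_of (2 * sum_list lam).
      scale (\<Sum>Q\<in>SYT f (square_content lam). 1) (B f))"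
    unfolding prod_list_square
  proof (rule schur_expansion [where \<Omega> = "\<lambda>_ _. 1" and \<omega> = "\<lambda>_ _ _ _. 1"])
    fix g m assume g: "g \<in> shapes"
    show "B g * (Z m * Z m) = (\<Sum>\<rho>\<in>shapes_of (wt g + 2 * m).
       scale (\<Sum>\<sigma> | \<sigma> \<in> between \<rho> g \<and> wt \<sigma> = wt g + m. 1) (B \<rho>))"
      using two_strips [where B = B and Z = Z, OF P g, of m "2 * m"] by (simp add: mult_2)
  qed (simp_all add: B0)
  have ad: "adams 2 (prod_list (map Z lam)) = (\<Sum>f\<in>shapes_of (2 * sum_list lam).
      scale (\<Sum>Q\<in>SYT f (square_content lam). of_int (?s lam Q)) (B f))"
    unfolding prod_list_adams [where Z = Z, OF sym]
  proof (rule schur_expansion [where \<omega> = "\<lambda>m \<rho> \<sigma> g. of_int \<epsilon> ^ m * (- 1) ^ chain_pairs \<rho> \<sigma> g"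
        and \<Omega> = "\<lambda>lam Q. of_int (?s lam Q)"])
    fix g m assume g: "g \<in> shapes"
    show "B g * adams 2 (Z m) = (\<Sum>\<rho>\<in>shapes_of (wt g + 2 * m).
       scale (\<Sum>\<sigma> | \<sigma> \<in> between \<rho> g \<and> wt \<sigma> = wt g + m. of_int \<epsilon> ^ m * (- 1) ^ chain_pairs \<rho> \<sigma> g) (B \<rho>))"
      unfolding adams scale_mult_right sum_distrib_left [symmetric] scale_scale [symmetric] scale_sum [symmetric]
      by (rule arg_cong [OF two_strips_alternating [where B = B and Z = Z, OF P g]])
  next
    show "of_int (?s [] Map.empty) = 1" by (simp add: tableau_sign_def)
  qed (simp_all add: B0 tableau_sign_extend power_add)
  have s: "?s lam Q = 1 \<or> ?s lam Q = - 1" for Q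
    using tableau_sign_cases [of lam Q] \<epsilon> by (auto simp: minus_one_power_iff split: if_splits)
  have in_Sym: "prod_list (map Z lam) \<in> Sym" by (rule Sym_prod_list) (rule sym)
  note half = half_sum_scale [of "shapes_of (2 * sum_list lam)" "\<lambda>f. SYT f (square_content lam)"
      "?s lam" B, folded sq ad]
  show ?P1
    unfolding plethysm_complete_two [OF in_Sym] by (rule half(1)) (use s in \<open>auto intro: finite_SYT\<close>)
  show ?P2
    unfolding plethysm_complete_two [OF in_Sym] by (rule half(2)) (use s in \<open>auto intro: finite_SYT\<close>)
qed

lemma plethysm_complete_part:
  "plethysm (complete 2) (complete_part lam) = (\<Sum>f\<in>shapes_of (2 * sum_list lam).
     scale (of_nat (card {Q \<in> SYT f (square_content lam). tableau_sign lam Q = 1})) (S f))"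
  "plethysm (elementary 2) (complete_part lam) = (\<Sum>f\<in>shapes_of (2 * sum_list lam).
     scale (of_nat (card {Q \<in> SYT f (square_content lam). tableau_sign lam Q = - 1})) (S f))"
  using plethysm_prod_list [of S complete 1 lam, OF pieri_complete S_zero Sym_complete]
  by (simp_all add: complete_part_def adams_complete)

lemma conj_shape_zero: "conj_shape (\<lambda>_. 0) = (\<lambda>_. 0)"
  by (rule ext) (simp add: conj_shape_def)

lemma plethysm_elementary_part:
  "plethysm (complete 2) (elementary_part lam) = (\<Sum>f\<in>shapes_of (2 * sum_list lam).
     scale (of_nat (card {Q \<in> SYT f (square_content lam). conj_tableau_sign lam (conj_filling Q) = 1})) (S (conj_shape f)))" (is ?P1)
  "plethysm (elementary 2) (elementary_part lam) = (\<Sum>f\<in>shapes_of (2 * sum_list lam).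
     scale (of_nat (card {Q \<in> SYT f (square_content lam). conj_tableau_sign lam (conj_filling Q) = - 1})) (S (conj_shape f)))" (is ?P2)
proof -
  \<comment> \<open>The ratio of the conjugate sign to the sign is the power of \<epsilon> = -1 in
    \<open>plethysm_prod_list\<close>.\<close>
  have ce: "(\<Sum>f\<in>shapes_of n. scale (of_nat (card {Q \<in> SYT f (square_content lam).
        conj_tableau_sign lam (conj_filling Q) = e})) (S (conj_shape f))) =
      (\<Sum>f\<in>shapes_of n. scale (of_nat (card {Q \<in> SYT f (square_content lam).
        (- 1) ^ sum_list lam * tableau_sign lam Q = e})) (S (conj_shape f)))" for n e
    by (intro sum.cong refl arg_cong [of _ _ "\<lambda>A. scale (of_nat (card A)) _"] Collect_cong)
       (auto simp: conj_tableau_sign_eq)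
  have B0: "S (conj_shape (\<lambda>_. 0)) = 1" by (simp add: conj_shape_zero S_zero)
  show ?P1 ?P2
    unfolding elementary_part_def ce
    by (rule plethysm_prod_list [OF pieri_elementary_conj B0 Sym_elementary]; simp add: adams_elementary)+
qed

section \<open>Translation to partitions\<close>

lemma up_zero_shape: "up (\<lambda>_. 0) m = {\<lambda>i. if i = 0 then m else 0}"
proof -
  let ?r = "\<lambda>i. if i = 0 then m else (0 :: nat)"
  have wt_r: "wt ?r = m" by (subst wt_bound [of 1]) auto
  have r: "?r \<in> shapes" by (simp add: shapes_def)
  have "f = ?r" if f: "f \<in> up (\<lambda>_. 0) m" for f
  proof -
    have z: "f i = 0" if "i \<noteq> 0" for i using that f by (cases i) (auto simp: up_def hstrip_def)
    then have "wt f = f 0" by (subst wt_bound [of 1]) auto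
    then show ?thesis using z f by (auto simp: up_def fun_eq_iff)
  qed
  moreover have "?r \<in> up (\<lambda>_. 0) m" using r wt_r by (simp add: up_def hstrip_def)
  ultimately show ?thesis by blast
qed

lemma schur_two: "schur [2] = complete 2"
proof -
  have "complete 2 = S (\<lambda>i. if i = 0 then 2 else 0)"
    using pieri_complete [OF zero_shapes, of 2] by (simp add: S_zero up_zero_shape)
  moreover have "(\<lambda>i. if i = 0 then 2 else (0::nat)) = nth_default 0 [2]"
    by (rule ext) (simp add: nth_default_def)
  ultimately show ?thesis
    using shape_list_nth_default [of "[2]"] by (simp add: S_def is_partition_def)
qed

text \<open>The only strip of size 2 on the empty shape is a row, and the rule for
  \<open>elementary\<close> turns it into a column.\<close>

lemma schur_one_one: "schur [1, 1] = elementary 2"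
proof -
  have "elementary 2 = S (conj_shape (\<lambda>i. if i = 0 then 2 else 0))"
    using pieri_elementary_conj [OF zero_shapes, of 2] by (simp add: S_zero up_zero_shape conj_shape_zero)
  moreover have "conj_shape (\<lambda>i. if i = 0 then 2 else 0) = nth_default 0 [1, 1]"
  proof
    fix j :: nat
    have "{i :: nat. j < (if i = 0 then 2 else 0)} = (if j < 2 then {0} else {})" by auto
    then show "conj_shape (\<lambda>i. if i = 0 then 2 else 0) j = nth_default 0 [1, 1] j"
      unfolding conj_shape_def nth_default_pair by simp
  qed
  ultimately show ?thesis
    using shape_list_nth_default [of "[1, 1]"] by (simp add: S_def is_partition_def)
qed

lemma conj_partition_eq:
  assumes \<nu>: "is_partition \<nu>"
  shows "conj_partition \<nu> = shape_list (conj_shape (nth_default 0 \<nu>))"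
proof -
  let ?f = "nth_default 0 \<nu>"
  note f = partition_shapes [OF \<nu>]
  have "conj_shape ?f j \<noteq> 0 \<longleftrightarrow> j < ?f 0" for j
    using conj_shape_less [OF f, of 0 j] by simp
  then have "{j. conj_shape ?f j \<noteq> 0} = {..<?f 0}" by (simp add: lessThan_def)
  then have "card {j. conj_shape ?f j \<noteq> 0} = ?f 0" by (simp only: card_lessThan)
  moreover have "?f 0 = (if \<nu> = [] then 0 else hd \<nu>)" by (simp add: nth_default_def hd_conv_nth)
  moreover have "conj_shape ?f j = length (filter (\<lambda>r. j < r) \<nu>)" for j
    unfolding conj_shape_def length_filter_conv_card
    by (rule arg_cong [of _ _ card]) (auto simp: nth_default_def split: if_splits)
  ultimately show ?thesis unfolding conj_partition_def shape_list_def by simp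
qed

lemma SSYT_conj_partition:
  assumes \<nu>: "is_partition \<nu>"
  shows "SSYT (conj_partition \<nu>) \<alpha> = SYT (conj_shape (nth_default 0 \<nu>)) \<alpha>"
proof -
  have c: "conj_shape (nth_default 0 \<nu>) \<in> shapes" by (rule conj_shape_shapes [OF partition_shapes [OF \<nu>]])
  then show ?thesis
    unfolding conj_partition_eq [OF \<nu>]
    by (simp add: SSYT_eq [OF partition_shape_list [OF c]] nth_default_shape_list)
qed

lemma sum_partitions:
  "(\<Sum>f\<in>shapes_of n. scale (of_nat (k f)) (S f)) =
    (\<Sum>\<nu> | is_partition \<nu> \<and> sum_list \<nu> = n. of_nat (k (nth_default 0 \<nu>)) * schur \<nu>)"
proof -
  have of_nat_scale: "of_nat k * x = scale (of_nat k) x" for k and x :: mseries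
    by (induction k) (simp_all add: scale_add_left distrib_right)
  show ?thesis
    unfolding sum.reindex_bij_betw [OF bij_partitions_shapes, symmetric]
    by (rule sum.cong) (auto simp: of_nat_scale S_def shape_list_nth_default)
qed

text \<open>Reindexing by the conjugate moves the conjugation from the Schur function to the shape
  whose tableaux are counted.\<close>

lemma sum_conj_partitions:
  "(\<Sum>f\<in>shapes_of n. scale (of_nat (k f)) (S (conj_shape f))) =
    (\<Sum>\<nu> | is_partition \<nu> \<and> sum_list \<nu> = n. of_nat (k (conj_shape (nth_default 0 \<nu>))) * schur \<nu>)"
proof -
  have "(\<Sum>f\<in>shapes_of n. scale (of_nat (k f)) (S (conj_shape f))) =
      (\<Sum>f\<in>shapes_of n. scale (of_nat (k (conj_shape f))) (S f))"
    by (rule sum.reindex_bij_witness [of _ conj_shape conj_shape])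
       (auto simp: conj_shape_conj conj_shape_shapes wt_conj)
  then show ?thesis by (simp only: sum_partitions [of "\<lambda>f. k (conj_shape f)"])
qed

theorem theorem2:
  fixes lam :: "nat list"
  assumes "is_partition lam"
  shows "plethysm (schur [2]) (complete_part lam) =
           (\<Sum>\<nu> | is_partition \<nu> \<and> sum_list \<nu> = 2 * sum_list lam. of_nat (K_plus lam \<nu>) * schur \<nu>) \<and>
         plethysm (schur [1, 1]) (complete_part lam) =
           (\<Sum>\<nu> | is_partition \<nu> \<and> sum_list \<nu> = 2 * sum_list lam. of_nat (K_minus lam \<nu>) * schur \<nu>) \<and>
         plethysm (schur [2]) (elementary_part lam) =
           (\<Sum>\<nu> | is_partition \<nu> \<and> sum_list \<nu> = 2 * sum_list lam. of_nat (K_conj_plus lam \<nu>) * schur \<nu>) \<and>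
         plethysm (schur [1, 1]) (elementary_part lam) =
           (\<Sum>\<nu> | is_partition \<nu> \<and> sum_list \<nu> = 2 * sum_list lam. of_nat (K_conj_minus lam \<nu>) * schur \<nu>)"
proof -
  \<comment> \<open>\<open>conj_filling\<close> is an involution, so the sets in
    \<open>K_conj_plus\<close> and \<open>K_conj_minus\<close> may be described by the conjugated
    tableaux themselves.\<close>
  have conj: "{conj_filling Q |Q. conj_filling Q \<in> A \<and> P Q} = {Q \<in> A. P (conj_filling Q)}" for A P
  proof (intro equalityI subsetI)
    fix Q assume "Q \<in> {Q \<in> A. P (conj_filling Q)}"
    then show "Q \<in> {conj_filling Q |Q. conj_filling Q \<in> A \<and> P Q}"
      by (intro CollectI exI [of _ "conj_filling Q"]) simp
  qed auto
  show ?thesis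
    unfolding schur_two schur_one_one plethysm_complete_part plethysm_elementary_part
      sum_partitions sum_conj_partitions K_plus_def K_minus_def K_conj_plus_def K_conj_minus_def conj
    by (intro conjI sum.cong) (auto simp: SSYT_eq SSYT_conj_partition)
qed

end
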